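(* Let $\alpha$ be a strong composition of $n$. The set $\{\pi_0(\mathfrak S_w(\mathbf x))\mid w\in W(\alpha)\}$ forms an additive ($\mathbb C$-vector space) basis of $\mathcal A_0\simeq H^*(\mathcal B^\alpha)$.
   Context: Ring. A strong composition $\alpha=(\alpha_1,\dots,\alpha_k)$ of $n$ is a sequence of positive integers with sum $n$. Let $W=S_n$ and $\mathfrak t=\{(t_1,\dots,t_n)\in\mathbb C^n:\sum t_i=0\}$, with $W$ acting by $(w\cdot t)_{w(i)}=t_i$. Let $\mathfrak s\subseteq\mathfrak t$ be the subspace of vectors $((z_1)^{\alpha_1},\dots,(z_k)^{\alpha_k})$, where $(z_i)^{\alpha_i}$ means $z_i$ repeated $\alpha_i$ times. Then $\mathbb C[\mathfrak t]=\mathbb C[x_1,\dots,x_n]/\langle\sum x_i\rangle\simeq\mathbb C[x_1,\dots,x_{n-1}]$ and $S(\mathfrak s^* )=\mathbb C[z_1,\dots,z_k]/\langle\sum\alpha_iz_i\rangle$. Let $Z_\alpha=\{(h,w\cdot h): h\in\mathfrak s,w\in W\}\subseteq\mathfrak s\times\mathfrak t$ (reduced), $\mathcal A=\mathbb C[Z_\alpha]$ its coordinate ring, an $S(\mathfrak s^* )$-algebra via the first projection, and $\mathcal A_0=\mathbb C\otimes_{S(\mathfrak s^* )}\mathcal A$, where $\mathbb C$ is an $S(\mathfrak s^* )$-module via evaluation at $0$. Equivalently $\mathcal A_0$ is the quotient of $\mathbb C[\mathfrak t]$ by the ideal obtained by setting $z=0$ in all elements of the vanishing ideal of $Z_\alpha$;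 $\pi_0:\mathbb C[\mathfrak t]\to\mathcal A_0$ is the quotient map. Geometry. Let $X_\alpha$ be a block diagonal nilpotent $n\times n$ matrix whose $i$-th diagonal block is a single nilpotent Jordan block of size $\alpha_i$, $B\subset GL_n(\mathbb C)$ the upper triangular matrices, $\mathfrak b=\mathrm{Lie}(B)$, $\mathcal B=GL_n(\mathbb C)/B$, and $\mathcal B^\alpha=\{gB\in\mathcal B:g^{-1}X_\alpha g\in\mathfrak b\}$ the Springer fiber. Cohomology has complex coefficients. By a theorem of Kumar and Procesi, there is a $\mathbb C$-algebra isomorphism $\mathcal A_0\simeq H^*(\mathcal B^\alpha)$ sending $x_i$ to the restriction of $-c_1(\mathcal L_i)$, where $\mathcal L_i$ is the line bundle on $\mathcal B$ with fiber $V_i/V_{i-1}$ over a flag $V_\bullet$. Schubert polynomials. $\mathfrak S_{w_0}(\mathbf x)=x_1^{n-1}x_2^{n-2}\cdots x_{n-1}$ for the longest $w_0\in W$, and $\mathfrak S_w=\partial_i\mathfrak S_{ws_i}$ if $\ell(ws_i)=\ell(w)+1$, where $s_i$ is the transposition of $i,i+1$ and $\partial_i(f)=\frac{f-s_i(f)}{x_i-x_{i+1}}$. The set $W(\alpha)$. $\mathrm{RSCT}_n(\alpha)$ is the set of fillings of the diagram with $\alpha_i$ left-justified boxes in row $i$ (rows numbered from top to bottom) by $1,\dots,n$, each used once, with entries decreasing from left to right in each row. A pair $(i,j)$ is a Springer inversion of $\Upsilon\in\mathrm{RSCT}_n(\alpha)$ if there is an entry $j'$ in row $j$ with $i<j'$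 such that either $j'$ appears above $i$ in the same column, or $j'$ appears in a column strictly to the right of the column containing $i$. The inversion vector of $\Upsilon$ is $\gamma=(\gamma_1,\dots,\gamma_{n-1})$, where $\gamma_i$ is the number of Springer inversions of $\Upsilon$ with first entry $i$. The Lehmer code of $w\in W$ is $(\gamma_1(w),\dots,\gamma_n(w))$ with $\gamma_k(w)=\#\{j>k: w(k)>w(j)\}$ (so $\gamma_n(w)=0$). $u_\Upsilon\in W$ is the unique permutation whose Lehmer code equals the inversion vector of $\Upsilon$ (with a final $0$ appended), and $W(\alpha)=\{u_\Upsilon\mid\Upsilon\in\mathrm{RSCT}_n(\alpha)\}$. *)

theory Defs
  imports
    "HOL-Library.Poly_Mapping"
    "HOL-Library.FuncSet"
    "HOL-Combinatorics.Permutations"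
    "HOL-Algebra.QuotRing"
    "Jordan_Normal_Form.VS_Connect"
begin

section \<open>Polynomial rings over the complex numbers\<close>

type_synonym 'v mpoly = "('v \<Rightarrow>\<^sub>0 nat) \<Rightarrow>\<^sub>0 complex"

definition Const :: "complex \<Rightarrow> 'v mpoly" where
  "Const c = Poly_Mapping.single 0 c"

definition Var :: "'v \<Rightarrow> 'v mpoly" where
  "Var i = Poly_Mapping.single (Poly_Mapping.single i 1) 1"

definition vars :: "'v mpoly \<Rightarrow> 'v set" where
  "vars p = (\<Union>m\<in>Poly_Mapping.keys p. Poly_Mapping.keys m)"

text \<open>The ring homomorphism that maps a constant \<open>c\<close> to \<open>C c\<close> and the variable \<open>i\<close> to \<open>f i\<close>.
  It is used both to evaluate at a point and to substitute polynomials.\<close>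

definition insertion :: "(complex \<Rightarrow> 'b) \<Rightarrow> ('v \<Rightarrow> 'b) \<Rightarrow> 'v mpoly \<Rightarrow> 'b::comm_ring_1" where
  "insertion C f p = (\<Sum>m\<in>Poly_Mapping.keys p.
     C (Poly_Mapping.lookup p m) * (\<Prod>i\<in>Poly_Mapping.keys m. f i ^ Poly_Mapping.lookup m i))"

abbreviation eval_at :: "('v \<Rightarrow> complex) \<Rightarrow> 'v mpoly \<Rightarrow> complex" where
  "eval_at \<equiv> insertion (\<lambda>c. c)"

abbreviation substitute :: "('v \<Rightarrow> 'u mpoly) \<Rightarrow> 'v mpoly \<Rightarrow> 'u mpoly" where
  "substitute \<equiv> insertion Const"

definition mpoly_ring :: "'v set \<Rightarrow> ('v mpoly) ring" where
  "mpoly_ring V = \<lparr>carrier = {p. vars p \<subseteq> V}, mult = (*), one = 1, zero = 0, add = (+)\<rparr>"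


section \<open>The ring \<open>A\<^sub>0\<close>\<close>

definition strong_composition :: "nat \<Rightarrow> nat list \<Rightarrow> bool" where
  "strong_composition n \<alpha> \<longleftrightarrow> (\<forall>a\<in>set \<alpha>. 0 < a) \<and> sum_list \<alpha> = n"

text \<open>Coordinates are numbered from 1. A vector of \<open>\<complex>\<^sup>n\<close> is a function on \<open>nat\<close> that is
  zero outside \<open>{1..n}\<close>; the composition \<open>\<alpha>\<close> is a list, so \<open>\<alpha>\<^sub>i\<close> is \<open>\<alpha> ! (i - 1)\<close>.\<close>

definition t_space :: "nat \<Rightarrow> (nat \<Rightarrow> complex) set" where
  "t_space n = {t. (\<forall>i. i \<notin> {1..n} \<longrightarrow> t i = 0) \<and> (\<Sum>i = 1..n. t i) = 0}"

text \<open>\<open>(w \<cdot> t)\<^bsub>w(i)\<^esub> = t\<^sub>i\<close>\<close>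

definition perm_act :: "(nat \<Rightarrow> nat) \<Rightarrow> (nat \<Rightarrow> complex) \<Rightarrow> nat \<Rightarrow> complex" where
  "perm_act w t = (\<lambda>j. t (inv_into UNIV w j))"

text \<open>The vector with \<open>z 1\<close> repeated \<open>\<alpha>\<^sub>1\<close> times, then \<open>z 2\<close> repeated \<open>\<alpha>\<^sub>2\<close> times, and so on.\<close>

definition block_vec :: "nat list \<Rightarrow> (nat \<Rightarrow> complex) \<Rightarrow> nat \<Rightarrow> complex" where
  "block_vec \<alpha> z = (\<lambda>j. if j \<in> {1..sum_list \<alpha>}
     then concat (map2 replicate \<alpha> (map z [1..<length \<alpha> + 1])) ! (j - 1) else 0)"

definition s_space :: "nat list \<Rightarrow> (nat \<Rightarrow> complex) set" where
  "s_space \<alpha> = {h \<in> t_space (sum_list \<alpha>). \<exists>z. h = block_vec \<alpha> z}"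

definition Z_variety :: "nat list \<Rightarrow> ((nat \<Rightarrow> complex) \<times> (nat \<Rightarrow> complex)) set" where
  "Z_variety \<alpha> = {(h, perm_act w h) | h w. h \<in> s_space \<alpha> \<and> w permutes {1..sum_list \<alpha>}}"

text \<open>The vanishing ideal is taken in \<open>\<complex>[z\<^sub>1,\<dots>,z\<^sub>k,x\<^sub>1,\<dots>,x\<^sub>n]\<close>, where the variable \<open>Inl i\<close> is
  \<open>z\<^sub>i\<close> and \<open>Inr j\<close> is \<open>x\<^sub>j\<close>; a point of \<open>\<s>\<close> has the coordinates \<open>z\<close> when it equals
  \<open>block_vec \<alpha> z\<close>. The relations \<open>\<Sum>\<alpha>\<^sub>i z\<^sub>i\<close> and \<open>\<Sum>x\<^sub>j\<close> cutting out \<open>\<s> \<times> \<t>\<close> lie in this ideal.\<close>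

definition zx_vars :: "nat list \<Rightarrow> (nat + nat) set" where
  "zx_vars \<alpha> = Inl ` {1..length \<alpha>} \<union> Inr ` {1..sum_list \<alpha>}"

definition vanishing_ideal :: "nat list \<Rightarrow> (nat + nat) mpoly set" where
  "vanishing_ideal \<alpha> = {f \<in> carrier (mpoly_ring (zx_vars \<alpha>)).
     \<forall>z x. (block_vec \<alpha> z, x) \<in> Z_variety \<alpha> \<longrightarrow> eval_at (case_sum z x) f = 0}"

definition set_z_zero :: "(nat + nat) mpoly \<Rightarrow> nat mpoly" where
  "set_z_zero = substitute (case_sum (\<lambda>_. 0) Var)"

definition I0 :: "nat list \<Rightarrow> nat mpoly set" where
  "I0 \<alpha> = set_z_zero ` vanishing_ideal \<alpha>"

abbreviation x_ring :: "nat list \<Rightarrow> (nat mpoly) ring" where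
  "x_ring \<alpha> \<equiv> mpoly_ring {1..sum_list \<alpha>}"

text \<open>Since \<open>\<Sum>x\<^sub>i\<close> lies in \<open>I0 \<alpha>\<close> (lemma \<open>sum_Var_in_I0\<close> below), the quotient of
  \<open>\<complex>[\<t>] = \<complex>[x\<^sub>1,\<dots>,x\<^sub>n]/\<langle>\<Sum>x\<^sub>i\<rangle>\<close> by the image of \<open>I0 \<alpha>\<close> is the quotient of \<open>\<complex>[x\<^sub>1,\<dots>,x\<^sub>n]\<close> by
  \<open>I0 \<alpha>\<close>, and \<open>pi0\<close> is the composite \<open>\<complex>[x\<^sub>1,\<dots>,x\<^sub>n] \<rightarrow> \<complex>[\<t>] \<rightarrow> A\<^sub>0\<close>.\<close>

definition pi0 :: "nat list \<Rightarrow> nat mpoly \<Rightarrow> nat mpoly set" where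
  "pi0 \<alpha> f = I0 \<alpha> +>\<^bsub>x_ring \<alpha>\<^esub> f"

definition A0 :: "nat list \<Rightarrow> (complex, nat mpoly set) module" where
  "A0 \<alpha> = (let Q = x_ring \<alpha> Quot I0 \<alpha> in
     \<lparr>carrier = carrier Q, mult = mult Q, one = one Q, zero = zero Q, add = add Q,
      smult = (\<lambda>c X. pi0 \<alpha> (Const c) \<otimes>\<^bsub>Q\<^esub> X)\<rparr>)"


section \<open>Schubert polynomials\<close>

definition swap_vars :: "nat \<Rightarrow> nat mpoly \<Rightarrow> nat mpoly" where
  "swap_vars i = substitute (\<lambda>j. Var (Transposition.transpose i (i + 1) j))"

text \<open>The quotient of \<open>f - s\<^sub>i(f)\<close> by \<open>x\<^sub>i - x\<^bsub>i+1\<^esub>\<close>, which is an exact division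
  (lemma \<open>divided_difference\<close> below).\<close>

definition divdiff :: "nat \<Rightarrow> nat mpoly \<Rightarrow> nat mpoly" where
  "divdiff i f = (THE g. (Var i - Var (i + 1)) * g = f - swap_vars i f)"

definition perm_length :: "nat \<Rightarrow> (nat \<Rightarrow> nat) \<Rightarrow> nat" where
  "perm_length n w = card {(i, j). 1 \<le> i \<and> i < j \<and> j \<le> n \<and> w j < w i}"

definition longest_perm :: "nat \<Rightarrow> nat \<Rightarrow> nat" where
  "longest_perm n = (\<lambda>i. if i \<in> {1..n} then n + 1 - i else i)"

text \<open>\<open>is_schubert n w f\<close>: starting from \<open>w\<^sub>0\<close>, the polynomial \<open>f\<close> is obtained for \<open>w\<close> along
  some chain of steps \<open>\<SS>\<^sub>w = \<partial>\<^sub>i \<SS>\<^bsub>w s\<^sub>i\<^esub>\<close>. By the braid relations for the \<open>\<partial>\<^sub>i\<close> it does not depend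
  on the chain.\<close>

inductive is_schubert :: "nat \<Rightarrow> (nat \<Rightarrow> nat) \<Rightarrow> nat mpoly \<Rightarrow> bool" for n where
  longest: "is_schubert n (longest_perm n) (\<Prod>i = 1..n. Var i ^ (n - i))"
| step: "w permutes {1..n} \<Longrightarrow> 1 \<le> i \<Longrightarrow> i < n \<Longrightarrow>
    perm_length n (w \<circ> Transposition.transpose i (i + 1)) = perm_length n w + 1 \<Longrightarrow>
    is_schubert n (w \<circ> Transposition.transpose i (i + 1)) f \<Longrightarrow>
    is_schubert n w (divdiff i f)"

definition schubert :: "nat \<Rightarrow> (nat \<Rightarrow> nat) \<Rightarrow> nat mpoly" where
  "schubert n w = (THE f. is_schubert n w f)"


section \<open>The set \<open>W(\<alpha>)\<close>\<close>

text \<open>A box is a pair (row, column), rows numbered from top to bottom.\<close>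

definition diagram :: "nat list \<Rightarrow> (nat \<times> nat) set" where
  "diagram \<alpha> = {(r, c). r \<in> {1..length \<alpha>} \<and> c \<in> {1..\<alpha> ! (r - 1)}}"

definition RSCT :: "nat list \<Rightarrow> (nat \<times> nat \<Rightarrow> nat) set" where
  "RSCT \<alpha> = {\<Upsilon> \<in> extensional (diagram \<alpha>). bij_betw \<Upsilon> (diagram \<alpha>) {1..sum_list \<alpha>} \<and>
     (\<forall>r c c'. (r, c) \<in> diagram \<alpha> \<and> (r, c') \<in> diagram \<alpha> \<and> c < c' \<longrightarrow> \<Upsilon> (r, c') < \<Upsilon> (r, c))}"

definition springer_inversion :: "nat list \<Rightarrow> (nat \<times> nat \<Rightarrow> nat) \<Rightarrow> nat \<Rightarrow> nat \<Rightarrow> bool" where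
  "springer_inversion \<alpha> \<Upsilon> i j \<longleftrightarrow> (\<exists>r c c'. (r, c) \<in> diagram \<alpha> \<and> (j, c') \<in> diagram \<alpha> \<and>
     \<Upsilon> (r, c) = i \<and> i < \<Upsilon> (j, c') \<and> ((c' = c \<and> j < r) \<or> c < c'))"

definition inversion_vector :: "nat list \<Rightarrow> (nat \<times> nat \<Rightarrow> nat) \<Rightarrow> nat \<Rightarrow> nat" where
  "inversion_vector \<alpha> \<Upsilon> i = card {j. springer_inversion \<alpha> \<Upsilon> i j}"

definition lehmer_code :: "nat \<Rightarrow> (nat \<Rightarrow> nat) \<Rightarrow> nat \<Rightarrow> nat" where
  "lehmer_code n w k = card {j. k < j \<and> j \<le> n \<and> w j < w k}"

definition u_perm :: "nat list \<Rightarrow> (nat \<times> nat \<Rightarrow> nat) \<Rightarrow> nat \<Rightarrow> nat" where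
  "u_perm \<alpha> \<Upsilon> = (THE u. u permutes {1..sum_list \<alpha>} \<and>
     (\<forall>k\<in>{1..sum_list \<alpha>}. lehmer_code (sum_list \<alpha>) u k =
        (if k < sum_list \<alpha> then inversion_vector \<alpha> \<Upsilon> k else 0)))"

definition W_set :: "nat list \<Rightarrow> (nat \<Rightarrow> nat) set" where
  "W_set \<alpha> = {u_perm \<alpha> \<Upsilon> | \<Upsilon>. \<Upsilon> \<in> RSCT \<alpha>}"


section \<open>Well-definedness\<close>

lemma insertion_superset:
  assumes "finite S" "Poly_Mapping.keys p \<subseteq> S" "C 0 = 0"
  shows "insertion C f p = (\<Sum>m\<in>S.
     C (Poly_Mapping.lookup p m) * (\<Prod>i\<in>Poly_Mapping.keys m. f i ^ Poly_Mapping.lookup m i))"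
  unfolding insertion_def using assms
  by (intro sum.mono_neutral_left) (auto simp: in_keys_iff)

lemma insertion_add:
  assumes "C 0 = 0" "\<And>a b. C (a + b) = C a + C b"
  shows "insertion C f (p + q) = insertion C f p + insertion C f q"
proof -
  let ?S = "Poly_Mapping.keys p \<union> Poly_Mapping.keys q"
  have "finite ?S" by simp
  note * = insertion_superset[where C = C and f = f, OF this _ assms(1)]
  show ?thesis
    using Poly_Mapping.keys_add[of p q] * [of p] * [of q] * [of "p + q"]
    by (simp add: lookup_add assms(2) distrib_right sum.distrib)
qed

lemma insertion_zero: "insertion C f 0 = 0"
  by (simp add: insertion_def)

lemma insertion_sum:
  assumes "C 0 = 0" "\<And>a b. C (a + b) = C a + C b"
  shows "insertion C f (sum p S) = (\<Sum>i\<in>S. insertion C f (p i))"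
  by (induction S rule: infinite_finite_induct) (simp_all add: insertion_zero insertion_add assms)

lemma insertion_single:
  assumes "C 0 = 0"
  shows "insertion C f (Poly_Mapping.single m c) =
    C c * (\<Prod>i\<in>Poly_Mapping.keys m. f i ^ Poly_Mapping.lookup m i)"
  using assms by (cases "c = 0") (auto simp: insertion_def)

lemma monomial_add:
  fixes f :: "'v \<Rightarrow> 'b::comm_ring_1"
  shows "(\<Prod>i\<in>Poly_Mapping.keys (m + m'). f i ^ Poly_Mapping.lookup (m + m') i) =
    (\<Prod>i\<in>Poly_Mapping.keys m. f i ^ Poly_Mapping.lookup m i) *
    (\<Prod>i\<in>Poly_Mapping.keys m'. f i ^ Poly_Mapping.lookup m' i)"
proof -
  let ?S = "Poly_Mapping.keys m \<union> Poly_Mapping.keys m'"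
  have *: "(\<Prod>i\<in>Poly_Mapping.keys k. f i ^ Poly_Mapping.lookup k i) =
      (\<Prod>i\<in>?S. f i ^ Poly_Mapping.lookup k i)" if "Poly_Mapping.keys k \<subseteq> ?S" for k
    using that by (intro prod.mono_neutral_left) (auto simp: in_keys_iff)
  show ?thesis
    using Poly_Mapping.keys_add[of m m'] * [of m] * [of m'] * [of "m + m'"]
    by (simp add: lookup_add power_add prod.distrib)
qed

lemma mpoly_induct [case_names single add]:
  assumes "\<And>m c. P (Poly_Mapping.single m c)" "\<And>p q. P p \<Longrightarrow> P q \<Longrightarrow> P (p + q)"
  shows "P (p :: 'v mpoly)"
proof (induction p rule: Poly_Mapping.update_induct)
  case const
  then show ?case using assms(1)[of 0 0] by simp
next
  case (update p m c)
  have "Poly_Mapping.update m c p = Poly_Mapping.single m c + p"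
    using update.hyps by (intro poly_mapping_eqI)
      (auto simp: lookup_update lookup_add lookup_single in_keys_iff when_def)
  then show ?case using assms update by simp
qed

lemma insertion_mult:
  assumes C: "C 0 = 0" "\<And>a b. C (a + b) = C a + C b" "\<And>a b. C (a * b) = C a * C b"
  shows "insertion C f (p * q) = insertion C f p * insertion C f q"
proof (induction p rule: mpoly_induct)
  case (single m c)
  show ?case
  proof (induction q rule: mpoly_induct)
    case (single m' c')
    show ?case
      by (simp add: Poly_Mapping.mult_single insertion_single C monomial_add mult_ac)
  next
    case (add p q)
    then show ?case by (simp add: distrib_left insertion_add C)
  qed
next
  case (add p q)
  then show ?case by (simp add: distrib_right insertion_add C)
qed

lemma Const_hom: "Const 0 = 0" "Const (a + b) = Const a + Const b"
  "Const (a * b) = Const a * Const b" "Const 1 = 1"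
  by (simp_all add: Const_def Poly_Mapping.single_add Poly_Mapping.mult_single)

lemma insertion_Const: "C 0 = 0 \<Longrightarrow> insertion C f (Const c) = C c"
  by (simp add: Const_def insertion_single)

lemma insertion_Var: "C 0 = 0 \<Longrightarrow> C 1 = 1 \<Longrightarrow> insertion C f (Var i) = f i"
  by (simp add: Var_def insertion_single)

lemmas eval_at_simps =
  insertion_zero insertion_add[where C = "\<lambda>c. c", OF refl refl]
  insertion_mult[where C = "\<lambda>c. c", OF refl refl refl]
  insertion_Const[where C = "\<lambda>c. c", OF refl] insertion_Var[where C = "\<lambda>c. c", OF refl refl]

lemmas substitute_simps =
  insertion_zero insertion_add[where C = Const, OF Const_hom(1,2)]
  insertion_mult[where C = Const, OF Const_hom(1-3)]
  insertion_Const[where C = Const, OF Const_hom(1)] insertion_Var[where C = Const, OF Const_hom(1,4)]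

lemma single_induct [case_names Const Var mult]:
  assumes "\<And>c. P (Const c)" "\<And>i. P (Var i)" "\<And>p q. P p \<Longrightarrow> P q \<Longrightarrow> P (p * q)"
  shows "P (Poly_Mapping.single m c :: 'v mpoly)"
proof -
  have pow: "P (Poly_Mapping.single (Poly_Mapping.single i k) 1)" for i and k :: nat
  proof (induction k)
    case 0
    show ?case using assms(1)[of 1] by (simp add: Const_def)
  next
    case (Suc k)
    have "Poly_Mapping.single (Poly_Mapping.single i (Suc k)) 1 =
      Var i * Poly_Mapping.single (Poly_Mapping.single i k) (1::complex)"
      by (simp add: Var_def Poly_Mapping.mult_single flip: Poly_Mapping.single_add)
    then show ?case using Suc assms by simp
  qed
  have "P (Poly_Mapping.single m 1)"
  proof (induction m rule: Poly_Mapping.update_induct)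
    case const
    show ?case using assms(1)[of 1] by (simp add: Const_def)
  next
    case (update m i k)
    have "Poly_Mapping.update i k m = Poly_Mapping.single i k + m"
      using update.hyps by (intro poly_mapping_eqI)
        (auto simp: lookup_update lookup_add lookup_single in_keys_iff when_def)
    then have "Poly_Mapping.single (Poly_Mapping.update i k m) 1 =
      Poly_Mapping.single (Poly_Mapping.single i k) 1 * Poly_Mapping.single m (1::complex)"
      by (simp add: Poly_Mapping.mult_single)
    then show ?case using pow update assms(3) by simp
  qed
  then have "P (Const c * Poly_Mapping.single m 1)" using assms by blast
  then show ?thesis by (simp add: Const_def Poly_Mapping.mult_single)
qed

lemma divided_difference: "(Var i - Var (i + 1)) * divdiff i f = f - swap_vars i f"
proof -
  let ?d = "Var i - Var (i + 1) :: nat mpoly"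
  have "?d \<noteq> 0"
  proof
    assume "?d = 0"
    then have "insertion (\<lambda>c. c) (\<lambda>j. if j = i then 1 else 0) (Var i :: nat mpoly) =
      insertion (\<lambda>c. c) (\<lambda>j. if j = i then 1 else 0) (Var (i + 1))" by simp
    then show False by (simp add: eval_at_simps)
  qed
  have "?d dvd f - swap_vars i f"
  proof (induction f rule: mpoly_induct)
    case (single m c)
    show ?case
    proof (induction m c rule: single_induct)
      case (Const c)
      show ?case by (simp add: swap_vars_def substitute_simps)
    next
      case (Var j)
      have "?d dvd Var (i + 1) - Var i" by (metis dvd_refl dvd_minus_iff minus_diff_eq)
      then show ?case
        by (cases "j = i \<or> j = i + 1") (auto simp: swap_vars_def substitute_simps)
    next
      case (mult p q)
      have "p * q - swap_vars i (p * q) =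
          (p - swap_vars i p) * q + swap_vars i p * (q - swap_vars i q)"
        by (simp add: swap_vars_def substitute_simps algebra_simps)
      then show ?case using mult by simp
    qed
  next
    case (add p q)
    have "p + q - swap_vars i (p + q) = (p - swap_vars i p) + (q - swap_vars i q)"
      by (simp add: swap_vars_def substitute_simps)
    then show ?case using add by (metis dvd_add)
  qed
  then obtain g where g: "?d * g = f - swap_vars i f" by (metis dvdE)
  then have "divdiff i f = g"
    unfolding divdiff_def using \<open>?d \<noteq> 0\<close> by (intro the_equality) (metis mult_left_cancel)+
  then show ?thesis using g by simp
qed

lemma vars_add: "vars (p + q) \<subseteq> vars p \<union> vars q"
  using Poly_Mapping.keys_add[of p q] by (auto simp: vars_def)

lemma vars_mult: "vars (p * q) \<subseteq> vars p \<union> vars q"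
proof
  fix i assume "i \<in> vars (p * q)"
  then obtain m where m: "m \<in> Poly_Mapping.keys (p * q)" "i \<in> Poly_Mapping.keys m"
    by (auto simp: vars_def)
  then obtain a b where "m = a + b" "a \<in> Poly_Mapping.keys p" "b \<in> Poly_Mapping.keys q"
    using Poly_Mapping.keys_mult[of p q] by blast
  then show "i \<in> vars p \<union> vars q"
    using m Poly_Mapping.keys_add[of a b] by (auto simp: vars_def)
qed

lemma vars_minus: "vars (- p) = vars p"
  by (simp add: vars_def)

lemma vars_Const: "vars (Const c) = {}"
  by (simp add: vars_def Const_def)

lemma vars_Var: "vars (Var i) = {i}"
  by (simp add: vars_def Var_def)

lemma vars_01: "vars 0 = {}" "vars 1 = {}"
  by (simp_all add: vars_def)

lemma cring_mpoly_ring: "cring (mpoly_ring V)"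
proof (rule cringI)
  show "abelian_group (mpoly_ring V)"
  proof (rule abelian_groupI)
    fix p assume "p \<in> carrier (mpoly_ring V)"
    then show "\<exists>q\<in>carrier (mpoly_ring V). q \<oplus>\<^bsub>mpoly_ring V\<^esub> p = \<zero>\<^bsub>mpoly_ring V\<^esub>"
      by (intro bexI[of _ "- p"]) (auto simp: mpoly_ring_def vars_minus)
  qed (use vars_add in \<open>fastforce simp: mpoly_ring_def vars_01 algebra_simps\<close>)+
  show "comm_monoid (mpoly_ring V)"
    by (rule comm_monoidI) (use vars_mult in \<open>fastforce simp: mpoly_ring_def vars_01 algebra_simps\<close>)+
qed (simp add: mpoly_ring_def distrib_right)


lemma vars_sum: "vars (sum f S) \<subseteq> (\<Union>i\<in>S. vars (f i))"
proof (induction S rule: infinite_finite_induct)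
  case (insert x S)
  then show ?case using vars_add[of "f x" "sum f S"] by auto
qed (simp_all add: vars_01)

lemma vars_prod: "vars (prod f S) \<subseteq> (\<Union>i\<in>S. vars (f i))"
proof (induction S rule: infinite_finite_induct)
  case (insert x S)
  then show ?case using vars_mult[of "f x" "prod f S"] by auto
qed (simp_all add: vars_01)

lemma vars_power: "vars (p ^ k) \<subseteq> vars p"
  by (induction k) (use vars_mult in \<open>fastforce simp: vars_01\<close>)+

lemma vars_substitute: "vars (substitute f p) \<subseteq> (\<Union>i\<in>vars p. vars (f i))"
proof -
  have "vars (Const c * (\<Prod>i\<in>Poly_Mapping.keys m. f i ^ Poly_Mapping.lookup m i)) \<subseteq>
      (\<Union>i\<in>Poly_Mapping.keys m. vars (f i))" for m c
    using vars_mult[of "Const c" "\<Prod>i\<in>Poly_Mapping.keys m. f i ^ Poly_Mapping.lookup m i"]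
      vars_prod[of "\<lambda>i. f i ^ Poly_Mapping.lookup m i" "Poly_Mapping.keys m"] vars_power
    by (fastforce simp: vars_Const)
  then show ?thesis
    unfolding insertion_def vars_def[of p] by (intro order.trans[OF vars_sum]) fastforce
qed

lemma set_z_zero_lift: "set_z_zero (substitute (\<lambda>j. Var (Inr j)) p) = p"
proof (induction p rule: mpoly_induct)
  case (single m c)
  show ?case
    by (induction m c rule: single_induct) (simp_all add: set_z_zero_def substitute_simps)
qed (simp add: set_z_zero_def substitute_simps)

lemma ideal_mpoly_ringI:
  assumes "I \<subseteq> carrier (mpoly_ring V)" "0 \<in> I" "\<And>p q. p \<in> I \<Longrightarrow> q \<in> I \<Longrightarrow> p + q \<in> I"
    and "\<And>p q. p \<in> I \<Longrightarrow> q \<in> carrier (mpoly_ring V) \<Longrightarrow> q * p \<in> I"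
  shows "ideal I (mpoly_ring V)"
proof -
  interpret cring "mpoly_ring V" by (rule cring_mpoly_ring)
  have minus: "\<ominus>\<^bsub>mpoly_ring V\<^esub> p = - p" if "p \<in> carrier (mpoly_ring V)" for p
    using that by (intro minus_equality) (auto simp: mpoly_ring_def vars_minus)
  have neg: "- p \<in> I" if "p \<in> I" for p
    using assms(4)[OF that, of "- 1"] by (simp add: mpoly_ring_def vars_minus vars_01)
  show ?thesis
  proof (rule idealI)
    show "subgroup I (add_monoid (mpoly_ring V))"
    proof
      fix p assume "p \<in> I"
      then have "inv\<^bsub>add_monoid (mpoly_ring V)\<^esub> p = - p"
        using minus assms(1) by (auto simp: a_inv_def)
      then show "inv\<^bsub>add_monoid (mpoly_ring V)\<^esub> p \<in> I" using neg \<open>p \<in> I\<close> by simp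
    qed (use assms in \<open>auto simp: mpoly_ring_def\<close>)
  qed (use assms in \<open>auto simp: ring_axioms, auto simp: mpoly_ring_def mult.commute\<close>)
qed

lemma vanishing_ideal_closed:
  "0 \<in> vanishing_ideal \<alpha>"
  "f \<in> vanishing_ideal \<alpha> \<Longrightarrow> g \<in> vanishing_ideal \<alpha> \<Longrightarrow> f + g \<in> vanishing_ideal \<alpha>"
  "f \<in> vanishing_ideal \<alpha> \<Longrightarrow> vars g \<subseteq> zx_vars \<alpha> \<Longrightarrow> g * f \<in> vanishing_ideal \<alpha>"
  using vars_add[of f g] vars_mult[of g f]
  by (auto simp: vanishing_ideal_def mpoly_ring_def vars_01 eval_at_simps)

lemma ideal_vanishing_ideal: "ideal (vanishing_ideal \<alpha>) (mpoly_ring (zx_vars \<alpha>))"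
  by (rule ideal_mpoly_ringI)
    (auto intro: vanishing_ideal_closed simp: mpoly_ring_def, auto simp: vanishing_ideal_def mpoly_ring_def)

lemma ideal_I0: "ideal (I0 \<alpha>) (x_ring \<alpha>)"
proof (rule ideal_mpoly_ringI)
  show "I0 \<alpha> \<subseteq> carrier (x_ring \<alpha>)"
  proof
    fix p assume "p \<in> I0 \<alpha>"
    then obtain f where f: "vars f \<subseteq> zx_vars \<alpha>" "p = set_z_zero f"
      by (auto simp: I0_def vanishing_ideal_def mpoly_ring_def)
    have "vars (case_sum (\<lambda>_. 0) Var v) \<subseteq> {1..sum_list \<alpha>}" if "v \<in> zx_vars \<alpha>" for v
      using that by (auto simp: zx_vars_def vars_01 vars_Var)
    then show "p \<in> carrier (x_ring \<alpha>)"
      using f vars_substitute[of "case_sum (\<lambda>_. 0) Var" f]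
      by (fastforce simp: set_z_zero_def mpoly_ring_def)
  qed
  show "0 \<in> I0 \<alpha>"
    unfolding I0_def using vanishing_ideal_closed(1)
    by (intro image_eqI[of _ _ 0]) (simp_all add: set_z_zero_def insertion_zero)
  fix p q assume "p \<in> I0 \<alpha>"
  then obtain f where f: "f \<in> vanishing_ideal \<alpha>" "p = set_z_zero f" by (auto simp: I0_def)
  show "p + q \<in> I0 \<alpha>" if "q \<in> I0 \<alpha>"
  proof -
    obtain g where g: "g \<in> vanishing_ideal \<alpha>" "q = set_z_zero g" using \<open>q \<in> I0 \<alpha>\<close> by (auto simp: I0_def)
    then have "p + q = set_z_zero (f + g)" using f by (simp add: set_z_zero_def substitute_simps)
    then show ?thesis using f g vanishing_ideal_closed(2) by (auto simp: I0_def)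
  qed
  show "q * p \<in> I0 \<alpha>" if "q \<in> carrier (x_ring \<alpha>)"
  proof -
    let ?g = "substitute (\<lambda>j. Var (Inr j)) q :: (nat + nat) mpoly"
    have "vars ?g \<subseteq> Inr ` vars q"
      using vars_substitute[of "\<lambda>j. Var (Inr j) :: (nat + nat) mpoly" q] by (auto simp: vars_Var)
    then have "vars ?g \<subseteq> zx_vars \<alpha>" using that by (fastforce simp: mpoly_ring_def zx_vars_def)
    moreover have "q * p = set_z_zero (?g * f)"
      using f set_z_zero_lift[of q] by (simp add: set_z_zero_def substitute_simps)
    ultimately show ?thesis using f vanishing_ideal_closed(3) by (auto simp: I0_def)
  qed
qed

lemma perm_act_in_t_space:
  assumes "w permutes {1..n}" "t \<in> t_space n"
  shows "perm_act w t \<in> t_space n"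
proof -
  have w: "inv_into UNIV w permutes {1..n}" using assms permutes_inv by blast
  have "(\<Sum>i = 1..n. t (inv_into UNIV w i)) = (\<Sum>i = 1..n. t i)"
    using sum.permute[OF w, of t] by (simp add: o_def)
  then show ?thesis
    using assms permutes_not_in[OF w] by (auto simp: t_space_def perm_act_def)
qed

lemma sum_Var_in_I0: "(\<Sum>i = 1..sum_list \<alpha>. Var i) \<in> I0 \<alpha>"
proof -
  let ?n = "sum_list \<alpha>" and ?f = "\<Sum>i = 1..sum_list \<alpha>. Var (Inr i) :: (nat + nat) mpoly"
  have eval: "eval_at v ?f = (\<Sum>i = 1..?n. v (Inr i))" for v
    by (simp add: insertion_sum eval_at_simps)
  have subst: "set_z_zero ?f = (\<Sum>i = 1..?n. Var i)"
    by (simp add: set_z_zero_def insertion_sum Const_hom substitute_simps)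
  have "vars ?f \<subseteq> zx_vars \<alpha>"
    by (intro order.trans[OF vars_sum]) (auto simp: vars_Var zx_vars_def)
  moreover have "(\<Sum>i = 1..?n. x i) = 0" if "(h, x) \<in> Z_variety \<alpha>" for h x
    using that perm_act_in_t_space by (fastforce simp: Z_variety_def s_space_def t_space_def)
  ultimately have "?f \<in> vanishing_ideal \<alpha>"
    by (auto simp: vanishing_ideal_def mpoly_ring_def eval simp del: One_nat_def)
  then show ?thesis using subst by (force simp: I0_def)
qed

lemma algebra_of_hom:
  fixes Q (structure)
  assumes "cring Q" and h: "\<And>c. h c \<in> carrier Q" "\<And>c d. h (c + d) = h c \<oplus> h d"
    "\<And>c d. h (c * d) = h c \<otimes> h d" "h 1 = \<one>"
  shows "algebra (class_ring :: complex ring)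
    \<lparr>carrier = carrier Q, mult = mult Q, one = one Q, zero = zero Q, add = add Q,
      smult = (\<lambda>c X. h c \<otimes> X)\<rparr>" (is "algebra _ ?A")
proof -
  interpret Q: cring Q by fact
  have cring: "cring ?A"
  proof (rule cringI)
    show "abelian_group ?A"
    proof (rule abelian_groupI)
      fix x assume "x \<in> carrier ?A"
      then show "\<exists>y\<in>carrier ?A. y \<oplus>\<^bsub>?A\<^esub> x = \<zero>\<^bsub>?A\<^esub>"
        by (intro bexI[of _ "\<ominus> x"]) (simp_all add: Q.l_neg)
    qed (simp_all add: Q.a_ac)
    show "comm_monoid ?A"
      by (rule comm_monoidI) (simp_all add: Q.m_ac)
  qed (simp add: Q.l_distr)
  show ?thesis
    by (rule algebraI[OF class_cring.is_cring cring])
      (use h in \<open>simp_all add: Q.l_distr Q.r_distr Q.m_assoc\<close>)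
qed

lemma algebra_A0: "algebra class_ring (A0 \<alpha>)"
proof -
  let ?R = "x_ring \<alpha>" and ?Q = "x_ring \<alpha> Quot I0 \<alpha>"
  interpret I: ideal "I0 \<alpha>" ?R by (rule ideal_I0)
  have "Const c \<in> carrier ?R" for c by (simp add: mpoly_ring_def vars_Const)
  then have hom: "pi0 \<alpha> (Const c) \<in> carrier ?Q"
    "pi0 \<alpha> (Const (c + d)) = pi0 \<alpha> (Const c) \<oplus>\<^bsub>?Q\<^esub> pi0 \<alpha> (Const d)"
    "pi0 \<alpha> (Const (c * d)) = pi0 \<alpha> (Const c) \<otimes>\<^bsub>?Q\<^esub> pi0 \<alpha> (Const d)"
    "pi0 \<alpha> (Const 1) = \<one>\<^bsub>?Q\<^esub>" for c d
    using ring_hom_closed[OF I.rcos_ring_hom] ring_hom_add[OF I.rcos_ring_hom]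
      ring_hom_mult[OF I.rcos_ring_hom] ring_hom_one[OF I.rcos_ring_hom]
    by (simp_all add: pi0_def Const_hom) (simp_all add: mpoly_ring_def)
  show ?thesis
    unfolding A0_def Let_def
    by (rule algebra_of_hom) (use I.quotient_is_cring cring_mpoly_ring hom in blast)+
qed

lemma vectorspace_A0: "vectorspace class_ring (A0 \<alpha>)"
  using algebra_A0 class_field by (simp add: vectorspace_def algebra_def)

end

theory Submission
  imports Defs
begin

text \<open>Two counts meet. Upper bound: the Schubert polynomials \<open>\<SS>\<^sub>w\<close>, \<open>w \<in> W(\<alpha>)\<close>, span \<open>A\<^sub>0\<close>, and there are at
  most as many of them as fillings in \<open>RSCT(\<alpha>)\<close>. Lower bound: a family of homogeneous polynomials that
  spans \<open>A\<^sub>0\<close> has at least as many members as the \<open>S\<^sub>n\<close>-orbit of a generic point \<open>h \<in> \<s>\<close>. The fillings inject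
  into this orbit, so no proper subset of the Schubert classes spans, and they form a basis.

  Spanning goes by induction on \<open>n\<close>, peeling off the variable \<open>x\<^sub>1\<close>. Removing the smallest entry \<open>1\<close> from a
  filling of shape \<open>\<alpha>\<close> leaves a filling of \<open>\<beta> = \<alpha> - e\<^sub>r\<close>, where \<open>r\<close> is the row of that entry, and the number
  of Springer inversions with first entry \<open>1\<close> is the position \<open>d\<close> of row \<open>r\<close> when the rows are sorted by
  decreasing length. So every code \<open>c\<close> occurring in \<open>W(\<beta>)\<close> yields a code \<open>(d, c)\<close> occurring in \<open>W(\<alpha>)\<close>
  (\<open>W_set_cons_perm\<close>). On the Schubert side, if \<open>w\<close> has code \<open>(d, c)\<close> and \<open>w'\<close> has code \<open>c\<close>, then
  \<open>\<SS>\<^sub>w \<equiv> x\<^sub>1\<^sup>d \<SS>\<^bsub>w'\<^esub>(x\<^sub>2, x\<^sub>3, \<dots>)\<close> modulo \<open>x\<^sub>1\<^bsup>d+1\<^esup>\<close> (\<open>schubert_cons_perm\<close>). On the side of ideals,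
  \<open>A\<^sub>0\<close> satisfies Tanisaki's relations: for a set \<open>S\<close> of \<open>n - q\<close> variables, at every point of \<open>Z\<^sub>\<alpha>\<close> the
  value \<open>z\<^sub>i\<close> occurs at least \<open>\<alpha>\<^sub>i - q\<close> times in \<open>S\<close>, so \<open>\<Prod>\<^bsub>s\<in>S\<^esub>(t - x\<^sub>s)\<close> is divisible by
  \<open>\<Prod>\<^sub>i(t - z\<^sub>i)\<^bsup>\<alpha>\<^sub>i-q\<^esup>\<close>; the remainder of the division lies in the vanishing ideal and becomes the part of
  low degree in \<open>t\<close> when \<open>z = 0\<close> (\<open>tanisaki_lift\<close>). Multiplication by \<open>x\<^sub>1\<^sup>d\<close> carries the relations for
  \<open>\<beta>\<close> into those for \<open>\<alpha>\<close> modulo \<open>x\<^sub>1\<^bsup>d+1\<^esup>\<close>. Hence a downward induction on \<open>d\<close> covers all multiples of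
  \<open>x\<^sub>1\<^sup>d\<close>, starting from the relation \<open>x\<^sub>1\<^sup>k = 0\<close>, with \<open>k\<close> the number of nonempty rows
  (\<open>schubert_span_mod_tanisaki_ideal\<close>).

  The lower bound degenerates the orbit to the origin. If \<open>f(z, x)\<close> is homogeneous and vanishes on the cone
  \<open>Z\<^sub>\<alpha>\<close>, then \<open>f(h, x)\<close> vanishes on the orbit of \<open>h\<close> and differs from \<open>f(0, x)\<close> only in lower degree. So a
  homogeneous family that spans modulo the polynomials \<open>f(0, x)\<close> also spans, by induction on the degree, the
  functions on the orbit (\<open>card_orbit_le_card_homogeneous_generators\<close>).\<close>

section \<open>Substitution in polynomials\<close>

lemma mpoly_ring_induct [case_names Const Var add mult]:
  assumes "\<And>c. P (Const c)" "\<And>i. P (Var i)"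
    "\<And>p q. P p \<Longrightarrow> P q \<Longrightarrow> P (p + q)" "\<And>p q. P p \<Longrightarrow> P q \<Longrightarrow> P (p * q)"
  shows "P (p :: 'v mpoly)"
proof (induction p rule: mpoly_induct)
  case (single m c)
  show ?case by (induction m c rule: single_induct) (use assms in auto)
qed (use assms in auto)

lemma substitute_minus: "substitute f (- p) = - substitute f p"
  using substitute_simps(2)[of f p "- p"] by (simp add: substitute_simps(1) add_eq_0_iff)

lemma substitute_diff: "substitute f (p - q) = substitute f p - substitute f q"
  using substitute_simps(2)[of f p "- q"] by (simp add: substitute_minus)

lemma substitute_1: "substitute f 1 = 1"
  using substitute_simps(4)[of f 1] by (simp add: Const_hom)

lemma substitute_power: "substitute f (p ^ k) = substitute f p ^ k"
  by (induction k) (simp_all add: substitute_1 substitute_simps)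

lemma substitute_prod: "substitute f (prod p S) = (\<Prod>i\<in>S. substitute f (p i))"
  by (induction S rule: infinite_finite_induct) (simp_all add: substitute_1 substitute_simps)

lemmas substitute_hom = substitute_simps substitute_minus substitute_diff substitute_1
  substitute_power substitute_prod

lemma substitute_substitute:
  "substitute g (substitute f p) = substitute (\<lambda>i. substitute g (f i)) p"
  by (induction p rule: mpoly_ring_induct) (simp_all add: substitute_simps)

lemma substitute_Var: "substitute Var p = p"
  by (induction p rule: mpoly_ring_induct) (simp_all add: substitute_simps)

lemma insertion_cong: "(\<And>i. i \<in> vars p \<Longrightarrow> f i = g i) \<Longrightarrow> insertion C f p = insertion C g p"
  unfolding insertion_def vars_def
  by (intro sum.cong prod.cong arg_cong2[where f = "(*)"] arg_cong2[where f = "(^)"]) auto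

section \<open>Divided differences\<close>

lemma Var_diff_nonzero: "i \<noteq> j \<Longrightarrow> (Var i - Var j :: nat mpoly) \<noteq> 0"
proof
  assume "i \<noteq> j" "(Var i - Var j :: nat mpoly) = 0"
  then have "eval_at (\<lambda>k. if k = i then 1 else 0) (Var i :: nat mpoly) =
      eval_at (\<lambda>k. if k = i then 1 else 0) (Var j)" by simp
  then show False using \<open>i \<noteq> j\<close> by (simp add: eval_at_simps)
qed

lemma divdiff_eqI:
  assumes "(Var i - Var (i + 1)) * g = f - swap_vars i f"
  shows "divdiff i f = g"
  using assms divided_difference[of i f] Var_diff_nonzero[of i "i + 1"]
  by (metis less_add_one less_irrefl mult_left_cancel)

lemma swap_vars_hom:
  "swap_vars i 0 = 0" "swap_vars i (p + q) = swap_vars i p + swap_vars i q"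
  "swap_vars i (p * q) = swap_vars i p * swap_vars i q"
  "swap_vars i (p - q) = swap_vars i p - swap_vars i q"
  "swap_vars i (p ^ k) = swap_vars i p ^ k" "swap_vars i (Const c) = Const c"
  "swap_vars i (prod f S) = (\<Prod>j\<in>S. swap_vars i (f j))"
  "swap_vars i (Var j) = Var (Transposition.transpose i (i + 1) j)"
  by (simp_all add: swap_vars_def substitute_hom)

lemma swap_vars_swap_vars: "swap_vars i (swap_vars i p) = p"
  by (simp add: swap_vars_def substitute_substitute substitute_simps substitute_Var)

lemma swap_vars_divdiff: "swap_vars i (divdiff i f) = divdiff i f"
proof -
  have "swap_vars i ((Var i - Var (i + 1)) * divdiff i f) = swap_vars i (f - swap_vars i f)"
    by (simp only: divided_difference)
  then have "(Var (i + 1) - Var i) * swap_vars i (divdiff i f) = swap_vars i f - f"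
    by (simp add: swap_vars_hom(3,4,8) swap_vars_swap_vars)
  then have "(Var i - Var (i + 1)) * swap_vars i (divdiff i f) = f - swap_vars i f"
    by (metis minus_diff_eq mult_minus_left)
  then show ?thesis by (metis divdiff_eqI)
qed

lemma divdiff_add: "divdiff i (f + g) = divdiff i f + divdiff i g"
  by (rule divdiff_eqI) (simp only: distrib_left divided_difference swap_vars_hom, simp)

lemma divdiff_mult_invariant: "swap_vars i h = h \<Longrightarrow> divdiff i (h * f) = h * divdiff i f"
  by (rule divdiff_eqI) (simp only: mult.left_commute[of _ h] divided_difference swap_vars_hom(3) right_diff_distrib)

lemma swap_vars_commute:
  "i + 1 < j \<Longrightarrow> swap_vars i (swap_vars j p) = swap_vars j (swap_vars i p)"
  unfolding swap_vars_def substitute_substitute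
  by (rule insertion_cong) (auto simp: substitute_simps Transposition.transpose_def)

lemma swap_vars_braid:
  "swap_vars i (swap_vars (i + 1) (swap_vars i p)) =
   swap_vars (i + 1) (swap_vars i (swap_vars (i + 1) p))"
  unfolding swap_vars_def substitute_substitute
  by (rule insertion_cong) (auto simp: substitute_simps Transposition.transpose_def)

text \<open>Both sides are determined after multiplication by the product of the two differences of variables, where
  they become the same alternating sum over \<open>{1, s\<^sub>i, s\<^sub>j, s\<^sub>i s\<^sub>j}\<close>.\<close>

lemma divdiff_commute:
  assumes "i + 1 < j"
  shows "divdiff i (divdiff j f) = divdiff j (divdiff i f)"
proof -
  let ?a = "Var i - Var (i + 1) :: nat mpoly" and ?b = "Var j - Var (j + 1) :: nat mpoly"
  have sa: "swap_vars j ?a = ?a" and sb: "swap_vars i ?b = ?b"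
    using assms by (simp_all add: swap_vars_hom Transposition.transpose_def)
  have 1: "?a * divdiff i f = f - swap_vars i f" for f by (rule divided_difference)
  have 2: "?b * divdiff j f = f - swap_vars j f" for f by (rule divided_difference)
  have "?b * (?a * divdiff i (divdiff j f)) = ?b * divdiff j f - swap_vars i (?b * divdiff j f)"
    by (simp only: 1 swap_vars_hom(3) sb right_diff_distrib)
  also have "\<dots> = ?a * divdiff i f - swap_vars j (?a * divdiff i f)"
    unfolding 1 2 using swap_vars_commute[OF assms, of f] by (simp add: swap_vars_hom(4))
  also have "\<dots> = ?a * (?b * divdiff j (divdiff i f))"
    by (simp only: 2 swap_vars_hom(3) sa right_diff_distrib)
  finally have "(?a * ?b) * divdiff i (divdiff j f) = (?a * ?b) * divdiff j (divdiff i f)"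
    by (simp only: mult_ac)
  moreover have "?a * ?b \<noteq> 0" using Var_diff_nonzero by simp
  ultimately show ?thesis using mult_left_cancel by blast
qed

text \<open>Multiplied by the Vandermonde product of \<open>x\<^sub>i, x\<^bsub>i+1\<^esub>, x\<^bsub>i+2\<^esub>\<close>, each side is the signed sum of \<open>f\<close> over the six
  permutations of these variables; the two sums differ only in the reduced word chosen for the longest one.\<close>

lemma divdiff_braid:
  "divdiff i (divdiff (i + 1) (divdiff i f)) = divdiff (i + 1) (divdiff i (divdiff (i + 1) f))"
proof -
  let ?s = "swap_vars i" and ?r = "swap_vars (i + 1)"
  define a b c :: "nat mpoly" where "a = Var i" and "b = Var (i + 1)" and "c = Var (i + 2)"
  have s: "?s a = b" "?s b = a" "?s c = c" "?r a = a" "?r b = c" "?r c = b"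
    by (simp_all add: a_def b_def c_def swap_vars_hom Transposition.transpose_def)
  have 1: "(a - b) * divdiff i f = f - ?s f" for f
    using divided_difference[of i f] by (simp add: a_def b_def)
  have 2: "(b - c) * divdiff (i + 1) f = f - ?r f" for f
    using divided_difference[of "i + 1" f] by (simp add: b_def c_def)
  note hom = swap_vars_hom(2,3,4)
  have L: "(a - b) * (b - c) * (a - c) * divdiff i (divdiff (i + 1) (divdiff i f)) =
      f - ?s f - ?r f + ?r (?s f) + ?s (?r f) - ?s (?r (?s f))"
  proof -
    define g where "g = divdiff i f"
    define h where "h = divdiff (i + 1) g"
    define k where "k = divdiff i h"
    have k: "(a - b) * k = h - ?s h" and h: "(b - c) * h = g - ?r g" and g: "(a - b) * g = f - ?s f"
      by (simp_all only: k_def h_def g_def 1 2)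
    have sg: "?s g = g" by (simp add: g_def swap_vars_divdiff)
    have sh: "(a - c) * ?s h = g - ?s (?r g)"
      using arg_cong[OF h, of ?s] by (simp only: hom s sg)
    have rg: "(a - c) * ?r g = ?r f - ?r (?s f)"
      using arg_cong[OF g, of ?r] by (simp only: hom s)
    have srg: "(b - c) * ?s (?r g) = ?s (?r f) - ?s (?r (?s f))"
      using arg_cong[OF rg, of ?s] by (simp only: hom s)
    have "(a - b) * (b - c) * (a - c) * k = (b - c) * (a - c) * ((a - b) * k)"
      by (simp only: mult_ac)
    also have "\<dots> = (a - c) * ((b - c) * h) - (b - c) * ((a - c) * ?s h)"
      unfolding k by (simp add: algebra_simps)
    also have "\<dots> = (a - b) * g - (a - c) * ?r g + (b - c) * ?s (?r g)"
      by (simp only: h sh) (simp add: algebra_simps)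
    finally show ?thesis 
      unfolding g rg srg unfolding k_def h_def g_def by (simp add: algebra_simps)
  qed
  have R: "(a - b) * (b - c) * (a - c) * divdiff (i + 1) (divdiff i (divdiff (i + 1) f)) =
      f - ?r f - ?s f + ?s (?r f) + ?r (?s f) - ?r (?s (?r f))"
  proof -
    define g where "g = divdiff (i + 1) f"
    define h where "h = divdiff i g"
    define k where "k = divdiff (i + 1) h"
    have k: "(b - c) * k = h - ?r h" and h: "(a - b) * h = g - ?s g" and g: "(b - c) * g = f - ?r f"
      by (simp_all only: k_def h_def g_def 1 2)
    have rg: "?r g = g" unfolding g_def by (rule swap_vars_divdiff)
    have rh: "(a - c) * ?r h = g - ?r (?s g)"
      using arg_cong[OF h, of ?r] by (simp only: hom s rg)
    have sg: "(a - c) * ?s g = ?s f - ?s (?r f)"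
      using arg_cong[OF g, of ?s] by (simp only: hom s)
    have rsg: "(a - b) * ?r (?s g) = ?r (?s f) - ?r (?s (?r f))"
      using arg_cong[OF sg, of ?r] by (simp only: hom s)
    have "(a - b) * (b - c) * (a - c) * k = (a - b) * (a - c) * ((b - c) * k)"
      by (simp only: mult_ac)
    also have "\<dots> = (a - c) * ((a - b) * h) - (a - b) * ((a - c) * ?r h)"
      unfolding k by (simp add: algebra_simps)
    also have "\<dots> = (b - c) * g - (a - c) * ?s g + (a - b) * ?r (?s g)"
      by (simp only: h rh) (simp add: algebra_simps)
    finally show ?thesis 
      unfolding g sg rsg unfolding k_def h_def g_def by (simp add: algebra_simps)
  qed
  have "a - b \<noteq> 0" "b - c \<noteq> 0" "a - c \<noteq> 0"
    unfolding a_def b_def c_def by (rule Var_diff_nonzero; simp)+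
  then have "(a - b) * (b - c) * (a - c) \<noteq> 0" by simp
  moreover have "(a - b) * (b - c) * (a - c) * divdiff i (divdiff (i + 1) (divdiff i f)) =
      (a - b) * (b - c) * (a - c) * divdiff (i + 1) (divdiff i (divdiff (i + 1) f))"
    unfolding L R using swap_vars_braid[of i f] by simp
  ultimately show ?thesis using mult_left_cancel by blast
qed

section \<open>Schubert polynomials\<close>

text \<open>Swapping positions \<open>i\<close> and \<open>i + 1\<close> maps the inversions of \<open>w\<close> bijectively to the inversions of the
  product other than \<open>(i, i + 1)\<close> itself.\<close>

lemma perm_length_ascent:
  assumes w: "w permutes {1..n}" and i: "1 \<le> i" "i < n" "w i < w (i + 1)"
  shows "perm_length n (w \<circ> Transposition.transpose i (i + 1)) = perm_length n w + 1"
proof -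
  let ?s = "Transposition.transpose i (i + 1)"
  let ?Inv = "\<lambda>w. {(a, b). 1 \<le> a \<and> a < b \<and> b \<le> n \<and> w b < (w a :: nat)}"
  have fin: "finite (?Inv w)" for w :: "nat \<Rightarrow> nat"
    by (rule finite_subset[of _ "{1..n} \<times> {1..n}"]) auto
  have mono: "?s a < ?s b" if "a < b" "(a, b) \<noteq> (i, i + 1)" for a b
    using that by (auto simp: Transposition.transpose_def)
  have range: "1 \<le> ?s a \<and> ?s a \<le> n" if "1 \<le> a" "a \<le> n" for a
    using that i by (auto simp: Transposition.transpose_def)
  have "?Inv (w \<circ> ?s) = insert (i, i + 1) (map_prod ?s ?s ` ?Inv w)" (is "_ = ?R")
  proof (intro equalityI subsetI)
    fix x assume x: "x \<in> ?Inv (w \<circ> ?s)"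
    then obtain a b where ab: "x = (a, b)" "1 \<le> a" "a < b" "b \<le> n" "w (?s b) < w (?s a)" by auto
    show "x \<in> ?R"
    proof (cases "x = (i, i + 1)")
      case False
      then have "(?s a, ?s b) \<in> ?Inv w" using ab mono[of a b] range[of a] range[of b] by auto
      moreover have "x = map_prod ?s ?s (?s a, ?s b)" using ab by simp
      ultimately show ?thesis by (intro insertI2 image_eqI[of x _ "(?s a, ?s b)"])
    qed simp
  next
    fix x assume "x \<in> ?R"
    then consider "x = (i, i + 1)" | a b where "x = (?s a, ?s b)" "(a, b) \<in> ?Inv w" by auto
    then show "x \<in> ?Inv (w \<circ> ?s)"
    proof cases
      case 1
      then show ?thesis using i by (simp add: Transposition.transpose_def)
    next
      case 2
      then have "(a, b) \<noteq> (i, i + 1)" using i by auto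
      then show ?thesis using 2 mono[of a b] range[of a] range[of b] by auto
    qed
  qed
  moreover have "(i, i + 1) \<notin> map_prod ?s ?s ` ?Inv w"
  proof
    assume "(i, i + 1) \<in> map_prod ?s ?s ` ?Inv w"
    then obtain a b where ab: "?s a = i" "?s b = i + 1" "a < b"
      by (smt (verit) case_prodE imageE map_prod_simp mem_Collect_eq prod.inject)
    then have "a = i + 1" "b = i" by (auto simp: Transposition.transpose_def split: if_splits)
    then show False using ab by simp
  qed
  moreover have "inj (map_prod ?s ?s)" by (intro prod.inj_map) auto
  ultimately show ?thesis
    using fin by (simp add: perm_length_def card_image inj_on_subset)
qed

lemma perm_length_le: "perm_length n w \<le> n * n"
proof -
  have "perm_length n w \<le> card ({1..n} \<times> {1..n})"
    unfolding perm_length_def by (intro card_mono) auto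
  then show ?thesis by simp
qed

lemma permutes_comp_transpose:
  "(w :: nat \<Rightarrow> nat) permutes {1..n} \<Longrightarrow> 1 \<le> i \<Longrightarrow> i < n \<Longrightarrow> w \<circ> Transposition.transpose i (i + 1) permutes {1..n}"
  by (rule permutes_compose[OF permutes_swap_id]) auto

lemma perm_length_step_iff:
  assumes w: "w permutes {1..n}" and i: "1 \<le> i" "i < n"
  shows "perm_length n (w \<circ> Transposition.transpose i (i + 1)) = perm_length n w + 1 \<longleftrightarrow> w i < w (i + 1)"
proof (cases "w i < w (i + 1)")
  case True
  then show ?thesis using perm_length_ascent[OF w i] by simp
next
  case False
  then have "w (i + 1) < w i"
    using permutes_inj[OF w] by (metis inj_eq less_add_one linorder_neqE_nat nat_neq_iff)
  then have "perm_length n ((w \<circ> Transposition.transpose i (i + 1)) \<circ> Transposition.transpose i (i + 1)) =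
      perm_length n (w \<circ> Transposition.transpose i (i + 1)) + 1"
    using i by (intro perm_length_ascent permutes_comp_transpose w) simp_all
  then show ?thesis using False by (simp add: o_assoc[symmetric])
qed

lemma is_schubert_step:
  assumes "w permutes {1..n}" "1 \<le> i" "i < n" "w i < w (i + 1)"
    "is_schubert n (w \<circ> Transposition.transpose i (i + 1)) f"
  shows "is_schubert n w (divdiff i f)"
  using assms perm_length_step_iff by (intro is_schubert.step) auto

lemma longest_perm_permutes: "longest_perm n permutes {1..n}"
proof (rule bij_imp_permutes)
  show "bij_betw (longest_perm n) {1..n} {1..n}"
    by (rule bij_betw_byWitness[where f' = "longest_perm n"]) (auto simp: longest_perm_def)
qed (auto simp: longest_perm_def)

lemma is_schubert_permutes: "is_schubert n w f \<Longrightarrow> w permutes {1..n}"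
  by (cases rule: is_schubert.cases) (auto simp: longest_perm_permutes simp del: One_nat_def)

text \<open>Strict decrease forces \<open>w(j) \<le> n + 1 - j\<close> from the left and \<open>w(j) \<ge> n + 1 - j\<close> from the right.\<close>

lemma no_ascent_longest_perm:
  assumes w: "w permutes {1..n}" and desc: "\<And>i. 1 \<le> i \<Longrightarrow> i < n \<Longrightarrow> w (i + 1) < w i"
  shows "w = longest_perm n"
proof
  fix i
  have "w (j + 1) + j \<le> n" if "j < n" for j
    using that
  proof (induction j)
    case 0
    then show ?case using permutes_in_image[OF w, of 1] by auto
  next
    case (Suc j)
    then show ?case using desc[of "j + 1"] by fastforce
  qed
  note upper = this
  have "j + 1 \<le> w (n - j)" if "j < n" for j
    using that
  proof (induction j)
    case 0
    then show ?case using permutes_in_image[OF w, of n] by auto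
  next
    case (Suc j)
    then show ?case using desc[of "n - Suc j"] by (fastforce simp: Suc_diff_Suc)
  qed
  note lower = this
  show "w i = longest_perm n i"
  proof (cases "i \<in> {1..n}")
    case True
    then have "i - 1 < n" "n - i < n" by auto
    then have "w i + i \<le> n + 1" "n + 1 \<le> w i + i"
      using True upper[of "i - 1"] lower[of "n - i"] by auto
    then show ?thesis using True by (simp add: longest_perm_def)
  next
    case False
    then show ?thesis using permutes_not_in[OF w] by (auto simp: longest_perm_def)
  qed
qed

text \<open>Going up along any ascent increases the length, and only the longest element has no ascent.\<close>

lemma is_schubert_exists:
  assumes "w permutes {1..n}"
  shows "\<exists>f. is_schubert n w f"
  using assms
proof (induction "n * n - perm_length n w" arbitrary: w rule: less_induct)
  case less
  show ?case
  proof (cases "\<exists>i. 1 \<le> i \<and> i < n \<and> w i < w (i + 1)")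
    case True
    then obtain i where i: "1 \<le> i" "i < n" "w i < w (i + 1)" by auto
    let ?v = "w \<circ> Transposition.transpose i (i + 1)"
    have "n * n - perm_length n ?v < n * n - perm_length n w"
      using perm_length_ascent[OF less.prems i] perm_length_le[of n ?v] by simp
    then obtain f where "is_schubert n ?v f"
      using less permutes_comp_transpose[OF less.prems i(1,2)] by blast
    then show ?thesis using is_schubert_step[OF less.prems i] by blast
  next
    case False
    have "w (i + 1) < w i" if "1 \<le> i" "i < n" for i
    proof -
      have "w i \<noteq> w (i + 1)" using permutes_inj[OF less.prems] by (metis inj_eq less_add_one less_irrefl)
      then show ?thesis using False that by auto
    qed
    then have "w = longest_perm n" using no_ascent_longest_perm less.prems by blast
    then show ?thesis using is_schubert.longest by blast
  qed
qed

text \<open>Newman's argument, by induction on the colength. Two first steps at \<open>i\<close> and \<open>j\<close> are completed to a common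
  permutation above, through a square if \<open>s\<^sub>i\<close> and \<open>s\<^sub>j\<close> commute and through a hexagon otherwise; the relations
  between divided differences then identify the two results.\<close>

lemma is_schubert_unique:
  assumes "is_schubert n w f" "is_schubert n w g"
  shows "f = g"
  using assms
proof (induction "n * n - perm_length n w" arbitrary: w f g rule: less_induct)
  case less
  let ?s = "\<lambda>i. Transposition.transpose i (i + 1 :: nat)"
  have w: "w permutes {1..n}" using less.prems is_schubert_permutes by blast
  have no_step_longest: False
    if "w = longest_perm n" "1 \<le> i" "i < n" "perm_length n (w \<circ> ?s i) = perm_length n w + 1" for i
  proof -
    have "w i < w (i + 1)" using that perm_length_step_iff[OF w] by blast
    then show False using that by (simp add: longest_perm_def)
  qed
  have IH: "f' = g'"
    if "1 \<le> i" "i < n" "w i < w (i + 1)" "is_schubert n (w \<circ> ?s i) f'" "is_schubert n (w \<circ> ?s i) g'"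
    for i f' g'
  proof (rule less.hyps[OF _ that(4,5)])
    show "n * n - perm_length n (w \<circ> ?s i) < n * n - perm_length n w"
      using perm_length_ascent[OF w that(1-3)] perm_length_le[of n "w \<circ> ?s i"] by simp
  qed
  have diamond: "divdiff i f' = divdiff j g'"
    if i: "1 \<le> i" "w i < w (i + 1)" and j: "j < n" "w j < w (j + 1)" and ij: "i < j"
      and f': "is_schubert n (w \<circ> ?s i) f'" and g': "is_schubert n (w \<circ> ?s j) g'" for i j f' g'
  proof (cases "i + 1 < j")
    case True
    have wi: "w \<circ> ?s i permutes {1..n}" and wj: "w \<circ> ?s j permutes {1..n}"
      and wij: "w \<circ> ?s i \<circ> ?s j permutes {1..n}"
      using w i j ij by (auto intro!: permutes_comp_transpose simp del: One_nat_def add_Suc_right)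
    obtain F where F: "is_schubert n (w \<circ> ?s i \<circ> ?s j) F" using is_schubert_exists[OF wij] by blast
    have comm: "w \<circ> ?s i \<circ> ?s j = w \<circ> ?s j \<circ> ?s i"
      using True by (auto simp: fun_eq_iff Transposition.transpose_def)
    have "is_schubert n (w \<circ> ?s i) (divdiff j F)"
      using F i j ij True by (intro is_schubert_step[OF wi]) (auto simp: Transposition.transpose_def)
    then have 1: "f' = divdiff j F" using IH[OF i(1) _ i(2) f'] i j ij by simp
    have "is_schubert n (w \<circ> ?s j) (divdiff i F)"
      using F i j ij True unfolding comm
      by (intro is_schubert_step[OF wj]) (auto simp: Transposition.transpose_def)
    then have 2: "g' = divdiff i F" using IH[OF _ j(1,2) g'] i j ij by simp
    show ?thesis unfolding 1 2 by (rule divdiff_commute[OF True])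
  next
    case False
    then have j_def: "j = i + 1" using ij by simp
    have in3: "i + 2 \<le> n" using j j_def by simp
    have asc: "w i < w (i + 1)" "w (i + 1) < w (i + 2)" using i j j_def by (simp_all add: numeral_2_eq_2)
    note perm = permutes_comp_transpose
    have wi: "w \<circ> ?s i permutes {1..n}" and wj: "w \<circ> ?s j permutes {1..n}"
      and wij: "w \<circ> ?s i \<circ> ?s j permutes {1..n}" and wji: "w \<circ> ?s j \<circ> ?s i permutes {1..n}"
      and wiji: "w \<circ> ?s i \<circ> ?s j \<circ> ?s i permutes {1..n}"
      using w i j ij by (auto intro!: perm simp del: One_nat_def add_Suc_right)
    obtain F where F: "is_schubert n (w \<circ> ?s i \<circ> ?s j \<circ> ?s i) F" using is_schubert_exists[OF wiji] by blast
    have braid: "w \<circ> ?s i \<circ> ?s j \<circ> ?s i = w \<circ> ?s j \<circ> ?s i \<circ> ?s j"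
      by (auto simp: fun_eq_iff Transposition.transpose_def j_def)
    have "is_schubert n (w \<circ> ?s i \<circ> ?s j) (divdiff i F)"
      using F i j asc j_def by (intro is_schubert_step[OF wij]) (auto simp: Transposition.transpose_def)
    then have "is_schubert n (w \<circ> ?s i) (divdiff j (divdiff i F))"
      using i j asc j_def by (intro is_schubert_step[OF wi]) (auto simp: Transposition.transpose_def)
    then have 1: "f' = divdiff j (divdiff i F)" using IH[OF i(1) _ i(2) f'] i j ij by simp
    have "is_schubert n (w \<circ> ?s j \<circ> ?s i) (divdiff j F)"
      using F i j asc j_def unfolding braid
      by (intro is_schubert_step[OF wji]) (auto simp: Transposition.transpose_def)
    then have "is_schubert n (w \<circ> ?s j) (divdiff i (divdiff j F))"
      using i j asc j_def by (intro is_schubert_step[OF wj]) (auto simp: Transposition.transpose_def)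
    then have 2: "g' = divdiff i (divdiff j F)" using IH[OF _ j(1,2) g'] i j ij by simp
    show ?thesis unfolding 1 2 j_def by (rule divdiff_braid)
  qed
  show ?case
    using less.prems(1)
  proof (cases rule: is_schubert.cases)
    case longest
    note f = this
    show ?thesis using less.prems(2)
      by (cases rule: is_schubert.cases) (use f no_step_longest in auto)
  next
    case (step i f')
    note f = this
    show ?thesis using less.prems(2)
    proof (cases rule: is_schubert.cases)
      case longest
      then show ?thesis using f no_step_longest by blast
    next
      case (step j g')
      have asc: "w i < w (i + 1)" "w j < w (j + 1)"
        using f step perm_length_step_iff[OF w] by blast+
      consider "i = j" | "i < j" | "j < i" by linarith
      then show ?thesis
      proof cases
        case 1
        have "is_schubert n (w \<circ> ?s i) g'" using step(6) 1 by simp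
        then have "f' = g'" by (rule IH[OF f(3,4) asc(1) f(6)])
        then show ?thesis using f(1) step(1) 1 by simp
      next
        case 2
        show ?thesis unfolding f(1) step(1)
          by (rule diamond[OF f(3) asc(1) step(4) asc(2) 2 f(6) step(6)])
      next
        case 3
        show ?thesis unfolding f(1) step(1)
          by (rule diamond[OF step(3) asc(2) f(4) asc(1) 3 step(6) f(6), symmetric])
      qed
    qed
  qed
qed

lemma schubert_eqI: "is_schubert n w f \<Longrightarrow> schubert n w = f"
  unfolding schubert_def using is_schubert_unique by blast

lemma is_schubert_schubert: "w permutes {1..n} \<Longrightarrow> is_schubert n w (schubert n w)"
  using is_schubert_exists schubert_eqI by metis

section \<open>Prepending an entry to the Lehmer code\<close>

text \<open>The permutation whose Lehmer code is that of \<open>w\<close> preceded by \<open>d\<close>: it starts with \<open>d + 1\<close>, and the other values keep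
  their relative order. Position \<open>0\<close> lies outside the range permuted and is fixed.\<close>

definition cons_perm :: "nat \<Rightarrow> (nat \<Rightarrow> nat) \<Rightarrow> nat \<Rightarrow> nat" where
  "cons_perm d w j = (if j = 0 then 0 else if j = 1 then d + 1
     else if w (j - 1) \<le> d then w (j - 1) else w (j - 1) + 1)"

lemma cons_perm_permutes:
  assumes w: "w permutes {1..n}" and d: "d \<le> n"
  shows "cons_perm d w permutes {1..n + 1}"
proof (rule bij_imp_permutes)
  have inj: "w a = w b \<longleftrightarrow> a = b" for a b using permutes_inj[OF w] by (auto dest: injD)
  have range: "1 \<le> w a \<and> w a \<le> n" if "1 \<le> a" "a \<le> n" for a
    using permutes_in_image[OF w, of a] that by auto
  have "inj_on (cons_perm d w) {1..n + 1}"
  proof (rule inj_onI)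
    fix a b assume "a \<in> {1..n + 1}" "b \<in> {1..n + 1}" and eq: "cons_perm d w a = cons_perm d w b"
    then have "1 \<le> a" "1 \<le> b" by auto
    moreover have "w (a - 1) = w (b - 1) \<longleftrightarrow> a - 1 = b - 1" by (rule inj)
    ultimately show "a = b" using eq by (auto simp: cons_perm_def split: if_splits)
  qed
  moreover have "cons_perm d w ` {1..n + 1} \<subseteq> {1..n + 1}"
  proof (rule image_subsetI)
    fix a assume "a \<in> {1..n + 1}"
    then show "cons_perm d w a \<in> {1..n + 1}" using range[of "a - 1"] d by (auto simp: cons_perm_def)
  qed
  ultimately show "bij_betw (cons_perm d w) {1..n + 1} {1..n + 1}"
    by (simp add: bij_betw_def endo_inj_surj)
  fix x assume x: "x \<notin> {1..n + 1}"
  show "cons_perm d w x = x"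
  proof (cases "x = 0")
    case False
    then have "x - 1 > n" using x by auto
    then have "w (x - 1) = x - 1" using permutes_not_in[OF w, of "x - 1"] by auto
    then show ?thesis using False \<open>x - 1 > n\<close> d by (auto simp: cons_perm_def)
  qed (simp add: cons_perm_def)
qed

lemma cons_perm_comp_transpose:
  assumes "1 \<le> i"
  shows "cons_perm d (w \<circ> Transposition.transpose i (i + 1)) =
    cons_perm d w \<circ> Transposition.transpose (i + 1) (i + 1 + 1)"
proof
  fix j
  consider "j = 0" | "j = 1" | k where "j = Suc (Suc k)" by (metis One_nat_def nat.exhaust)
  then show "cons_perm d (w \<circ> Transposition.transpose i (i + 1)) j =
      (cons_perm d w \<circ> Transposition.transpose (i + 1) (i + 1 + 1)) j"
    using assms by cases (auto simp: cons_perm_def Transposition.transpose_def)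
qed

lemma cons_perm_ascent: "1 \<le> i \<Longrightarrow> w i < w (i + 1) \<Longrightarrow> cons_perm d w (i + 1) < cons_perm d w (i + 1 + 1)"
  by (auto simp: cons_perm_def)

lemma cons_perm_longest: "cons_perm n (longest_perm n) = longest_perm (n + 1)"
  by (auto simp: fun_eq_iff cons_perm_def longest_perm_def)

lemma lehmer_code_cons_perm_1:
  assumes w: "w permutes {1..n}" and d: "d \<le> n"
  shows "lehmer_code (n + 1) (cons_perm d w) 1 = d"
proof -
  have "{j. 1 < j \<and> j \<le> n + 1 \<and> cons_perm d w j < cons_perm d w 1} = Suc ` {j \<in> {1..n}. w j \<le> d}"
    (is "?L = ?R")
  proof (intro equalityI subsetI)
    fix j assume "j \<in> ?L"
    then have "j = Suc (j - 1)" "j - 1 \<in> {j \<in> {1..n}. w j \<le> d}"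
      by (auto simp: cons_perm_def split: if_splits)
    then show "j \<in> ?R" by blast
  qed (auto simp: cons_perm_def)
  moreover have "w ` {j \<in> {1..n}. w j \<le> d} = {1..d}"
  proof (intro equalityI subsetI)
    fix v assume v: "v \<in> {1..d}"
    then have "v \<in> w ` {1..n}" using d permutes_image[OF w] by auto
    then show "v \<in> w ` {j \<in> {1..n}. w j \<le> d}" using v by auto
  next
    fix v assume "v \<in> w ` {j \<in> {1..n}. w j \<le> d}"
    then show "v \<in> {1..d}" using permutes_in_image[OF w] by auto
  qed
  then have "card {j \<in> {1..n}. w j \<le> d} = d"
    using card_image[OF inj_on_subset[OF permutes_inj[OF w]], of "{j \<in> {1..n}. w j \<le> d}"] by simp
  ultimately show ?thesis by (simp add: lehmer_code_def card_image)
qed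

lemma lehmer_code_cons_perm_Suc:
  assumes "1 \<le> k"
  shows "lehmer_code (n + 1) (cons_perm d w) (k + 1) = lehmer_code n w k"
proof -
  have "{j. k + 1 < j \<and> j \<le> n + 1 \<and> cons_perm d w j < cons_perm d w (k + 1)} =
      Suc ` {j. k < j \<and> j \<le> n \<and> w j < w k}" (is "?L = ?R")
  proof (intro equalityI subsetI)
    fix j assume "j \<in> ?L"
    then have "j = Suc (j - 1)" "j - 1 \<in> {j. k < j \<and> j \<le> n \<and> w j < w k}"
      using assms by (auto simp: cons_perm_def split: if_splits)
    then show "j \<in> ?R" by blast
  qed (use assms in \<open>auto simp: cons_perm_def\<close>)
  then show ?thesis by (simp add: lehmer_code_def card_image)
qed

lemma lehmer_code_exists:
  assumes "\<And>k. k \<in> {1..n} \<Longrightarrow> \<gamma> k \<le> n - k"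
  shows "\<exists>w. w permutes {1..n} \<and> (\<forall>k\<in>{1..n}. lehmer_code n w k = \<gamma> k)"
  using assms
proof (induction n arbitrary: \<gamma>)
  case 0
  then show ?case using permutes_id[of "{1..0::nat}"] by (auto simp del: One_nat_def)
next
  case (Suc n)
  have "\<gamma> (k + 1) \<le> n - k" if "k \<in> {1..n}" for k using Suc.prems[of "k + 1"] that by auto
  then obtain w where w: "w permutes {1..n}" "\<And>k. k \<in> {1..n} \<Longrightarrow> lehmer_code n w k = \<gamma> (k + 1)"
    using Suc.IH[of "\<lambda>k. \<gamma> (k + 1)"] by blast
  have d: "\<gamma> 1 \<le> n" using Suc.prems[of 1] by auto
  have "lehmer_code (n + 1) (cons_perm (\<gamma> 1) w) k = \<gamma> k" if "k \<in> {1..n + 1}" for k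
  proof (cases "k = 1")
    case True
    then show ?thesis using lehmer_code_cons_perm_1[OF w(1) d] by simp
  next
    case False
    then have "k = (k - 1) + 1" "1 \<le> k - 1" "k - 1 \<in> {1..n}" using that by auto
    then show ?thesis using lehmer_code_cons_perm_Suc[of "k - 1" n "\<gamma> 1" w] w(2)[of "k - 1"] by simp
  qed
  then show ?case using cons_perm_permutes[OF w(1) d] by auto
qed

text \<open>The values \<open>w(1), \<dots>, w(k - 1)\<close> being known, \<open>w(k)\<close> is the remaining value with exactly as many smaller
  remaining values as the \<open>k\<close>-th entry of the code.\<close>

lemma lehmer_code_inj:
  assumes u: "u permutes {1..n}" and v: "v permutes {1..n}"
    and eq: "\<And>k. k \<in> {1..n} \<Longrightarrow> lehmer_code n u k = lehmer_code n v k"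
  shows "u = v"
proof -
  have card: "lehmer_code n w k = card {r \<in> {1..n} - w ` {1..<k}. r < w k}"
    if w: "w permutes {1..n}" and k: "k \<in> {1..n}" for w k
  proof -
    have inj: "w a = w b \<longleftrightarrow> a = b" for a b using permutes_inj[OF w] by (auto dest: injD)
    have "w ` {j. k < j \<and> j \<le> n \<and> w j < w k} = {r \<in> {1..n} - w ` {1..<k}. r < w k}" (is "?L = ?R")
    proof (intro equalityI subsetI)
      fix r assume "r \<in> ?L"
      then obtain j where j: "r = w j" "k < j" "j \<le> n" "w j < w k" by blast
      then have "w j \<in> {1..n}" using permutes_in_image[OF w, of j] k by simp
      moreover have "w j \<notin> w ` {1..<k}" using j(2) by (simp add: image_iff inj)
      ultimately show "r \<in> ?R" using j by simp
    next
      fix r assume r: "r \<in> ?R"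
      then have "r \<in> w ` {1..n}" using permutes_image[OF w] by simp
      then obtain j where j: "r = w j" "j \<in> {1..n}" by blast
      have "j \<notin> {1..<k}" using r j(1) by blast
      moreover have "j \<noteq> k" using r j(1) by auto
      ultimately have "k < j" using j(2) by auto
      then show "r \<in> ?L" using r j by auto
    qed
    moreover have "inj_on w {j. k < j \<and> j \<le> n \<and> w j < w k}"
      by (rule inj_on_subset[OF permutes_inj[OF w]]) simp
    ultimately show ?thesis unfolding lehmer_code_def by (simp flip: card_image)
  qed
  have agree: "u k = v k" if "k \<in> {1..n}" for k
    using that
  proof (induction k rule: less_induct)
    case (less k)
    have not_less: "\<not> p k < q k"
      if p: "p permutes {1..n}" and q: "q permutes {1..n}" and pq: "\<And>j. j \<in> {1..<k} \<Longrightarrow> p j = q j"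
        and c: "lehmer_code n p k = lehmer_code n q k" for p q
    proof
      assume lt: "p k < q k"
      let ?R = "{1..n} - p ` {1..<k}"
      have R: "{1..n} - q ` {1..<k} = ?R" using pq by (auto simp: image_def)
      have "p k \<notin> p ` {1..<k}"
      proof
        assume "p k \<in> p ` {1..<k}"
        then obtain j where "p k = p j" "j < k" by auto
        then show False using permutes_inj[OF p] by (simp add: inj_eq)
      qed
      then have "p k \<in> ?R" using permutes_in_image[OF p, of k] less.prems by blast
      then have "{r \<in> ?R. r < p k} \<subset> {r \<in> ?R. r < q k}" using lt by auto
      then have "card {r \<in> ?R. r < p k} < card {r \<in> ?R. r < q k}" by (intro psubset_card_mono) auto
      then have "lehmer_code n p k < lehmer_code n q k"
        unfolding card[OF p less.prems] card[OF q less.prems] R .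
      then show False using c by simp
    qed
    have "u j = v j" if "j \<in> {1..<k}" for j using less that by auto
    then show ?case using not_less[OF u v] not_less[OF v u] eq[OF less.prems] by (metis linorder_neqE_nat)
  qed
  show ?thesis
  proof
    fix k show "u k = v k" using agree permutes_not_in[OF u] permutes_not_in[OF v] by (cases "k \<in> {1..n}") auto
  qed
qed

section \<open>Expansion of Schubert polynomials in the first variable\<close>

text \<open>On the extra variable \<open>x\<^sub>0\<close> this gives \<open>x\<^sub>1\<close>, so the image is not free of \<open>x\<^sub>1\<close> in general.\<close>

definition shift :: "nat mpoly \<Rightarrow> nat mpoly" where
  "shift = substitute (\<lambda>i. Var (i + 1))"

lemma shift_hom:
  "shift 0 = 0" "shift (p + q) = shift p + shift q" "shift (p * q) = shift p * shift q"
  "shift (p - q) = shift p - shift q" "shift (p ^ k) = shift p ^ k" "shift (Const c) = Const c"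
  "shift (prod f S) = (\<Prod>j\<in>S. shift (f j))" "shift (Var j) = Var (j + 1)"
  "shift 1 = 1" "shift (- p) = - shift p"
  by (simp_all add: shift_def substitute_hom)

lemma swap_vars_shift: "swap_vars (i + 1) (shift p) = shift (swap_vars i p)"
  unfolding swap_vars_def shift_def substitute_substitute
  by (rule insertion_cong) (auto simp: substitute_simps Transposition.transpose_def)

lemma divdiff_shift: "divdiff (i + 1) (shift f) = shift (divdiff i f)"
  using arg_cong[OF divided_difference[of i f], of shift]
  by (intro divdiff_eqI) (simp add: shift_hom swap_vars_shift[simplified])

lemma divdiff_Var1_power: "1 \<le> i \<Longrightarrow> divdiff (i + 1) (Var 1 ^ k * f) = Var 1 ^ k * divdiff (i + 1) f"
  by (rule divdiff_mult_invariant) (simp add: swap_vars_hom Transposition.transpose_def)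

text \<open>A chain for \<open>w\<close>, moved one position to the right, never touches the first position, so its divided
  differences treat \<open>x\<^sub>1\<close> as a constant.\<close>

lemma is_schubert_cons_perm_top:
  "is_schubert n w f \<Longrightarrow> is_schubert (n + 1) (cons_perm n w) (Var 1 ^ n * shift f)"
proof (induction rule: is_schubert.induct)
  case longest
  have "(\<Prod>i = 1..n + 1. Var i ^ (n + 1 - i)) = Var 1 ^ n * shift (\<Prod>i = 1..n. Var i ^ (n - i))"
  proof -
    have "(\<Prod>i = 1..n + 1. Var i ^ (n + 1 - i) :: nat mpoly) =
        Var 1 ^ n * (\<Prod>i = 1 + 1..n + 1. Var i ^ (n + 1 - i))"
      by (subst prod.atLeast_Suc_atMost) simp_all
    also have "(\<Prod>i = 1 + 1..n + 1. Var i ^ (n + 1 - i) :: nat mpoly) = (\<Prod>i = 1..n. Var (i + 1) ^ (n - i))"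
      by (subst prod.shift_bounds_cl_nat_ivl) simp
    finally show ?thesis by (simp add: shift_hom)
  qed
  then show ?case using is_schubert.longest[of "n + 1"] cons_perm_longest[of n] by simp
next
  case (step w i f)
  have "w i < w (i + 1)" using step perm_length_step_iff by blast
  then have "is_schubert (n + 1) (cons_perm n w) (divdiff (i + 1) (Var 1 ^ n * shift f))"
  proof (intro is_schubert_step)
    show "is_schubert (n + 1) (cons_perm n w \<circ> Transposition.transpose (i + 1) (i + 1 + 1))
        (Var 1 ^ n * shift f)"
      using step.IH unfolding cons_perm_comp_transpose[OF step(2)] .
  qed (use step cons_perm_permutes[of w n n] cons_perm_ascent[of i w n] in auto)
  then show ?case by (simp only: divdiff_Var1_power[OF step(2)] divdiff_shift)
qed

text \<open>The only ascent of a permutation \<open>(d + 1, n + 2, n + 1, \<dots>)\<close> is at the first position. Exchanging the two entries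
  there puts the maximal value first, where \<open>is_schubert_cons_perm_top\<close> applies.\<close>

lemma cons_perm_longest_transpose:
  assumes "d \<le> n"
  shows "cons_perm (n + 1) (cons_perm d (longest_perm n)) =
    cons_perm d (longest_perm (n + 1)) \<circ> Transposition.transpose 1 (1 + 1)"
proof
  fix j
  consider "j = 0" | "j = 1" | "j = 2" | k where "j = Suc (Suc (Suc k))"
    by (metis One_nat_def Suc_1 nat.exhaust)
  then show "cons_perm (n + 1) (cons_perm d (longest_perm n)) j =
      (cons_perm d (longest_perm (n + 1)) \<circ> Transposition.transpose 1 (1 + 1)) j"
    using assms by cases (auto simp: cons_perm_def longest_perm_def Transposition.transpose_def)
qed

lemma divdiff_Var_power: "\<exists>h. divdiff i (Var i ^ Suc k) = Var (i + 1) ^ k + Var i * h"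
proof -
  have "(Var i - Var (i + 1)) * (\<Sum>p<Suc k. Var i ^ p * Var (i + 1) ^ (k - p)) =
      Var i ^ Suc k - (Var (i + 1) ^ Suc k :: nat mpoly)"
    using power_diff_sumr2[of "Var i :: nat mpoly" "Suc k" "Var (i + 1)"] 
    by (simp add: mult.commute)
  then have "divdiff i (Var i ^ Suc k) = (\<Sum>p<Suc k. Var i ^ p * Var (i + 1) ^ (k - p))"
    by (intro divdiff_eqI) (simp add: swap_vars_hom)
  also have "\<dots> = Var (i + 1) ^ k + Var i * (\<Sum>p<k. Var i ^ p * Var (i + 1) ^ (k - Suc p))"
    by (subst sum.lessThan_Suc_shift) (simp add: sum_distrib_left mult.assoc)
  finally show ?thesis by blast
qed

text \<open>The Schubert polynomial of the longest permutation.\<close>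

definition staircase :: "nat \<Rightarrow> nat mpoly" where
  "staircase n = (\<Prod>i = 1..n. Var i ^ (n - i))"

lemma shift_staircase_Suc: "shift (staircase (n + 1)) = Var 2 ^ n * shift (shift (staircase n))"
proof -
  have "staircase (n + 1) = Var 1 ^ n * (\<Prod>i = 1 + 1..n + 1. Var i ^ (n + 1 - i))"
    unfolding staircase_def by (subst prod.atLeast_Suc_atMost) simp_all
  also have "(\<Prod>i = 1 + 1..n + 1. Var i ^ (n + 1 - i) :: nat mpoly) = shift (staircase n)"
    unfolding staircase_def by (subst prod.shift_bounds_cl_nat_ivl) (simp add: shift_hom)
  finally show ?thesis by (simp add: shift_hom numeral_2_eq_2)
qed

text \<open>The starting point for the expansion of \<open>\<SS>\<^sub>w\<close> modulo a power of \<open>x\<^sub>1\<close>: the case where the entries after the first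
  one decrease. For \<open>d\<close> maximal the formula is exact. Otherwise apply \<open>\<partial>\<^sub>1\<close> to \<open>x\<^sub>1\<^bsup>n+1\<^esup>\<close> times the shift of the
  formula for \<open>n\<close>, pulling out powers of the symmetric product \<open>x\<^sub>1 x\<^sub>2\<close>.\<close>

lemma is_schubert_cons_perm_longest:
  "d \<le> n \<Longrightarrow> \<exists>h. is_schubert (n + 1) (cons_perm d (longest_perm n))
     (Var 1 ^ d * shift (staircase n) + Var 1 ^ (d + 1) * h)"
proof (induction n)
  case 0
  then show ?case using is_schubert_cons_perm_top[OF is_schubert.longest[of 0]]
    by (intro exI[of _ 0]) (simp add: staircase_def)
next
  case (Suc n)
  show ?case
  proof (cases "d = Suc n")
    case True
    then show ?thesis using is_schubert_cons_perm_top[OF is_schubert.longest[of "Suc n"]]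
      by (intro exI[of _ 0]) (simp add: staircase_def)
  next
    case False
    then have d: "d \<le> n" using Suc.prems by simp
    let ?w = "cons_perm d (longest_perm n)"
    obtain h where "is_schubert (n + 1) ?w (Var 1 ^ d * shift (staircase n) + Var 1 ^ (d + 1) * h)"
      using Suc.IH d by blast
    then have top: "is_schubert (n + 1 + 1) (cons_perm (n + 1) ?w)
        (Var 1 ^ (n + 1) * shift (Var 1 ^ d * shift (staircase n) + Var 1 ^ (d + 1) * h))"
      by (rule is_schubert_cons_perm_top)
    let ?a = "Var 1 :: nat mpoly" and ?b = "Var 2 :: nat mpoly"
    define Q where "Q = shift (shift (staircase n))"
    have sym_power: "swap_vars 1 ((?a * ?b) ^ k) = (?a * ?b) ^ k" for k
      by (simp add: swap_vars_hom mult.commute flip: numeral_2_eq_2)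
    have sym_Q: "swap_vars 1 Q = Q"
      by (simp add: Q_def staircase_def swap_vars_hom shift_hom Transposition.transpose_def)
    obtain k where k: "n = d + k" using d le_Suc_ex by blast
    obtain h' where h': "divdiff 1 (?a ^ Suc k) = ?b ^ k + ?a * h'"
      using divdiff_Var_power[of 1 k] by (auto simp: numeral_2_eq_2)
    \<comment> \<open>with \<open>n = d + k\<close>, both summands are split into a symmetric factor and a power of \<open>x\<^sub>1\<close>\<close>
    have "divdiff 1 (Var 1 ^ (n + 1) * shift (Var 1 ^ d * shift (staircase n) + Var 1 ^ (d + 1) * h)) =
        divdiff 1 (((?a * ?b) ^ d * Q) * ?a ^ Suc k + (?a * ?b) ^ (d + 1) * (?a ^ k * shift h))"
      by (simp add: k Q_def shift_hom power_mult_distrib power_add algebra_simps flip: numeral_2_eq_2)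
    also have "\<dots> = (?a * ?b) ^ d * Q * divdiff 1 (?a ^ Suc k) +
        (?a * ?b) ^ (d + 1) * divdiff 1 (?a ^ k * shift h)"
      by (simp only: divdiff_add divdiff_mult_invariant sym_power sym_Q swap_vars_hom(3))
    also have "\<dots> = ?a ^ d * (?b ^ n * Q) +
        ?a ^ (d + 1) * (?b ^ d * Q * h' + ?b ^ (d + 1) * divdiff 1 (?a ^ k * shift h))"
      unfolding h' by (simp add: k power_mult_distrib power_add algebra_simps)
    also have "?b ^ n * Q = shift (staircase (n + 1))"
      by (simp add: shift_staircase_Suc[simplified] Q_def)
    finally have eq: "divdiff 1 (Var 1 ^ (n + 1) * shift (Var 1 ^ d * shift (staircase n) + Var 1 ^ (d + 1) * h)) =
        ?a ^ d * shift (staircase (n + 1)) +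
        ?a ^ (d + 1) * (?b ^ d * Q * h' + ?b ^ (d + 1) * divdiff 1 (?a ^ k * shift h))" .
    have "is_schubert (n + 1 + 1) (cons_perm d (longest_perm (n + 1)))
        (divdiff 1 (Var 1 ^ (n + 1) * shift (Var 1 ^ d * shift (staircase n) + Var 1 ^ (d + 1) * h)))"
    proof (rule is_schubert_step)
      show "cons_perm d (longest_perm (n + 1)) permutes {1..n + 1 + 1}"
        using d by (intro cons_perm_permutes longest_perm_permutes) simp
      show "cons_perm d (longest_perm (n + 1)) 1 < cons_perm d (longest_perm (n + 1)) (1 + 1)"
        using d by (simp add: cons_perm_def longest_perm_def)
    qed (use top cons_perm_longest_transpose[OF d] in simp_all)
    then show ?thesis unfolding eq by auto
  qed
qed

text \<open>Divided differences at positions \<open>\<ge> 2\<close> commute with multiplication by \<open>x\<^sub>1\<close>, so the congruence propagates along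
  a chain for \<open>w\<close> from the case of the longest permutation.\<close>

lemma schubert_cons_perm:
  assumes w: "w permutes {1..n}" and d: "d \<le> n"
  shows "\<exists>h. schubert (n + 1) (cons_perm d w) = Var 1 ^ d * shift (schubert n w) + Var 1 ^ (d + 1) * h"
proof -
  have "\<exists>h. is_schubert (n + 1) (cons_perm d w) (Var 1 ^ d * shift f + Var 1 ^ (d + 1) * h)"
    if "is_schubert n w f" for f
    using that
  proof (induction rule: is_schubert.induct)
    case longest
    then show ?case using is_schubert_cons_perm_longest[OF d] by (simp add: staircase_def)
  next
    case (step w i f)
    then obtain h where h: "is_schubert (n + 1) (cons_perm d (w \<circ> Transposition.transpose i (i + 1)))
        (Var 1 ^ d * shift f + Var 1 ^ (d + 1) * h)" by blast
    have "w i < w (i + 1)" using step perm_length_step_iff by blast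
    then have "is_schubert (n + 1) (cons_perm d w)
        (divdiff (i + 1) (Var 1 ^ d * shift f + Var 1 ^ (d + 1) * h))"
    proof (intro is_schubert_step)
      show "is_schubert (n + 1) (cons_perm d w \<circ> Transposition.transpose (i + 1) (i + 1 + 1))
          (Var 1 ^ d * shift f + Var 1 ^ (d + 1) * h)"
        using h unfolding cons_perm_comp_transpose[OF step(2)] .
    qed (use step d cons_perm_permutes[of w n d] cons_perm_ascent[of i w d] in auto)
    then show ?case
      by (simp only: divdiff_add divdiff_Var1_power[OF step(2)] divdiff_shift) blast
  qed
  then show ?thesis using is_schubert_schubert[OF w] schubert_eqI by metis
qed

section \<open>Fillings\<close>

text \<open>The order of the rows by decreasing length, rows of equal length being listed from top to bottom. Rows are
  numbered from \<open>0\<close> here, as list positions.\<close>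

definition row_before :: "nat list \<Rightarrow> nat \<Rightarrow> nat \<Rightarrow> bool" where
  "row_before \<alpha> i r \<longleftrightarrow> \<alpha> ! r < \<alpha> ! i \<or> \<alpha> ! i = \<alpha> ! r \<and> i < r"

definition row_rank :: "nat list \<Rightarrow> nat \<Rightarrow> nat" where
  "row_rank \<alpha> r = card {i. i < length \<alpha> \<and> row_before \<alpha> i r}"

text \<open>Row ranks are distinct, and the nonempty rows precede all empty ones, so the ranks of the nonempty rows fill an
  initial segment.\<close>

lemma row_rank_exists:
  assumes "d < card {i. i < length \<alpha> \<and> 0 < \<alpha> ! i}"
  shows "\<exists>r < length \<alpha>. 0 < \<alpha> ! r \<and> row_rank \<alpha> r = d"
proof -
  let ?A = "{i. i < length \<alpha> \<and> 0 < \<alpha> ! i}" and ?B = "\<lambda>r. {i. i < length \<alpha> \<and> row_before \<alpha> i r}"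
  have fin: "finite (?B r)" for r by simp
  have mono: "row_rank \<alpha> r < row_rank \<alpha> s" if "r < length \<alpha>" "row_before \<alpha> r s" for r s
    unfolding row_rank_def
  proof (rule psubset_card_mono[OF fin])
    have "r \<in> ?B s" "r \<notin> ?B r" using that by (auto simp: row_before_def)
    moreover have "?B r \<subseteq> ?B s" using that by (auto simp: row_before_def)
    ultimately show "?B r \<subset> ?B s" by blast
  qed
  have "inj_on (row_rank \<alpha>) ?A"
  proof (rule inj_onI)
    fix r s assume "r \<in> ?A" "s \<in> ?A" "row_rank \<alpha> r = row_rank \<alpha> s"
    moreover have "r = s \<or> row_before \<alpha> r s \<or> row_before \<alpha> s r" by (auto simp: row_before_def)
    ultimately show "r = s" using mono by fastforce
  qed
  then have "card (row_rank \<alpha> ` ?A) = card ?A" by (rule card_image)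
  moreover have "row_rank \<alpha> ` ?A \<subseteq> {..<card ?A}"
  proof clarsimp
    fix r assume r: "r < length \<alpha>" "0 < \<alpha> ! r"
    have "?B r \<subset> ?A" using r by (auto simp: row_before_def)
    then show "row_rank \<alpha> r < card ?A" unfolding row_rank_def by (intro psubset_card_mono) auto
  qed
  ultimately have "row_rank \<alpha> ` ?A = {..<card ?A}" by (intro card_subset_eq) auto
  then have "d \<in> row_rank \<alpha> ` ?A" using assms by auto
  then show ?thesis by auto
qed

lemma RSCT_range: "\<Upsilon> \<in> RSCT \<alpha> \<Longrightarrow> x \<in> diagram \<alpha> \<Longrightarrow> 1 \<le> \<Upsilon> x \<and> \<Upsilon> x \<le> sum_list \<alpha>"
  unfolding RSCT_def using bij_betwE by fastforce

text \<open>A row \<open>j\<close> is counted at most once, and it contains an entry larger than \<open>k\<close>.\<close>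

lemma inversion_vector_le:
  assumes \<Upsilon>: "\<Upsilon> \<in> RSCT \<alpha>"
  shows "inversion_vector \<alpha> \<Upsilon> k \<le> sum_list \<alpha> - k"
proof -
  have inj: "inj_on \<Upsilon> (diagram \<alpha>)" using \<Upsilon> by (auto simp: RSCT_def bij_betw_def)
  have "{j. springer_inversion \<alpha> \<Upsilon> k j} \<subseteq> (\<lambda>y. fst (inv_into (diagram \<alpha>) \<Upsilon> y)) ` {k + 1..sum_list \<alpha>}"
  proof
    fix j assume "j \<in> {j. springer_inversion \<alpha> \<Upsilon> k j}"
    then obtain c' where c': "(j, c') \<in> diagram \<alpha>" "k < \<Upsilon> (j, c')"
      by (auto simp: springer_inversion_def)
    then have "\<Upsilon> (j, c') \<in> {k + 1..sum_list \<alpha>}" using RSCT_range[OF \<Upsilon> c'(1)] by auto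
    moreover have "j = fst (inv_into (diagram \<alpha>) \<Upsilon> (\<Upsilon> (j, c')))"
      using inv_into_f_f[OF inj c'(1)] by simp
    ultimately show "j \<in> (\<lambda>y. fst (inv_into (diagram \<alpha>) \<Upsilon> y)) ` {k + 1..sum_list \<alpha>}" by blast
  qed
  then have "inversion_vector \<alpha> \<Upsilon> k \<le> card {k + 1..sum_list \<alpha>}"
    unfolding inversion_vector_def by (meson finite_atLeastAtMost surj_card_le)
  then show ?thesis by simp
qed

lemma u_perm_eqI:
  assumes \<Upsilon>: "\<Upsilon> \<in> RSCT \<alpha>" and u: "u permutes {1..sum_list \<alpha>}"
    and code: "\<And>k. k \<in> {1..sum_list \<alpha>} \<Longrightarrow> lehmer_code (sum_list \<alpha>) u k = inversion_vector \<alpha> \<Upsilon> k"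
  shows "u_perm \<alpha> \<Upsilon> = u"
proof -
  have if_eq: "(if k < sum_list \<alpha> then inversion_vector \<alpha> \<Upsilon> k else 0) = inversion_vector \<alpha> \<Upsilon> k" for k
    using inversion_vector_le[OF \<Upsilon>, of k] by auto
  show ?thesis unfolding u_perm_def if_eq
    by (rule the_equality) (use u code lehmer_code_inj in auto)
qed

lemma u_perm_code:
  assumes \<Upsilon>: "\<Upsilon> \<in> RSCT \<alpha>"
  shows "u_perm \<alpha> \<Upsilon> permutes {1..sum_list \<alpha>}"
    "k \<in> {1..sum_list \<alpha>} \<Longrightarrow> lehmer_code (sum_list \<alpha>) (u_perm \<alpha> \<Upsilon>) k = inversion_vector \<alpha> \<Upsilon> k"
proof -
  obtain u where "u permutes {1..sum_list \<alpha>}"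
    "\<forall>k\<in>{1..sum_list \<alpha>}. lehmer_code (sum_list \<alpha>) u k = inversion_vector \<alpha> \<Upsilon> k"
    using lehmer_code_exists[of "sum_list \<alpha>" "inversion_vector \<alpha> \<Upsilon>"] inversion_vector_le[OF \<Upsilon>] by blast
  moreover from this have "u_perm \<alpha> \<Upsilon> = u" using u_perm_eqI[OF \<Upsilon>] by blast
  ultimately show "u_perm \<alpha> \<Upsilon> permutes {1..sum_list \<alpha>}"
    "k \<in> {1..sum_list \<alpha>} \<Longrightarrow> lehmer_code (sum_list \<alpha>) (u_perm \<alpha> \<Upsilon>) k = inversion_vector \<alpha> \<Upsilon> k" by auto
qed

lemma W_set_permutes: "w \<in> W_set \<alpha> \<Longrightarrow> w permutes {1..sum_list \<alpha>}"
  unfolding W_set_def using u_perm_code(1) by blast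

definition remove_box :: "nat list \<Rightarrow> nat \<Rightarrow> nat list" where
  "remove_box \<alpha> r = \<alpha>[r := \<alpha> ! r - 1]"

lemma sum_list_remove_box: "r < length \<alpha> \<Longrightarrow> 0 < \<alpha> ! r \<Longrightarrow> sum_list \<alpha> = sum_list (remove_box \<alpha> r) + 1"
  using elem_le_sum_list[of r \<alpha>] by (simp add: remove_box_def sum_list_update)

lemma diagram_remove_box:
  assumes "r < length \<alpha>" "0 < \<alpha> ! r"
  shows "diagram \<alpha> = insert (r + 1, \<alpha> ! r) (diagram (remove_box \<alpha> r))"
    "(r + 1, \<alpha> ! r) \<notin> diagram (remove_box \<alpha> r)"
  using assms by (auto simp: diagram_def remove_box_def nth_list_update split: if_splits)

text \<open>Put the new entry \<open>1\<close> at the end of row \<open>r\<close> and raise the others by one. The entry \<open>1\<close> never is the larger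
  one in an inversion, so the other inversion counts stay; its own count is the number of rows longer than row \<open>r\<close>,
  or equally long and above it.\<close>

lemma W_set_cons_perm:
  assumes r: "r < length \<alpha>" "0 < \<alpha> ! r" and w: "w \<in> W_set (remove_box \<alpha> r)"
  shows "cons_perm (row_rank \<alpha> r) w \<in> W_set \<alpha>"
proof -
  let ?\<beta> = "remove_box \<alpha> r" and ?new = "(r + 1, \<alpha> ! r)"
  obtain \<Upsilon> where \<Upsilon>: "\<Upsilon> \<in> RSCT ?\<beta>" and w_eq: "w = u_perm ?\<beta> \<Upsilon>" using w by (auto simp: W_set_def)
  define m where "m = sum_list ?\<beta>"
  have n: "sum_list \<alpha> = m + 1" using sum_list_remove_box[OF r] by (simp add: m_def)
  note D = diagram_remove_box[OF r]
  define \<Upsilon>' where "\<Upsilon>' x = (if x = ?new then 1 else if x \<in> diagram ?\<beta> then \<Upsilon> x + 1 else undefined)" for x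
  have old: "\<Upsilon>' x = \<Upsilon> x + 1" "1 \<le> \<Upsilon> x" if "x \<in> diagram ?\<beta>" for x
    using that D(2) RSCT_range[OF \<Upsilon> that] by (auto simp: \<Upsilon>'_def)
  have new: "\<Upsilon>' ?new = 1" by (simp add: \<Upsilon>'_def)
  have bij: "bij_betw \<Upsilon> (diagram ?\<beta>) {1..m}" using \<Upsilon> by (auto simp: RSCT_def m_def)
  have col: "c \<le> \<alpha> ! r" if "(r + 1, c) \<in> diagram \<alpha>" for c using that by (auto simp: diagram_def)
  have \<Upsilon>': "\<Upsilon>' \<in> RSCT \<alpha>"
    unfolding RSCT_def
  proof (intro CollectI conjI allI impI)
    show "\<Upsilon>' \<in> extensional (diagram \<alpha>)" by (auto simp: extensional_def \<Upsilon>'_def D(1))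
    have "\<Upsilon>' ` diagram ?\<beta> = Suc ` \<Upsilon> ` diagram ?\<beta>" by (force simp: old(1))
    also have "\<dots> = {2..m + 1}" using bij by (auto simp: bij_betw_def image_Suc_atLeastAtMost)
    finally have img: "\<Upsilon>' ` diagram ?\<beta> = {2..m + 1}" .
    have "inj_on \<Upsilon>' (diagram ?\<beta>)"
      using bij by (auto simp: bij_betw_def inj_on_def old(1))
    then have "bij_betw \<Upsilon>' (diagram ?\<beta>) {2..m + 1}" using img by (simp add: bij_betw_def)
    then have "bij_betw \<Upsilon>' (insert ?new (diagram ?\<beta>)) (insert (\<Upsilon>' ?new) {2..m + 1})"
      using notIn_Un_bij_betw[of ?new "diagram ?\<beta>" \<Upsilon>' "{2..m + 1}"] D(2) new by simp
    moreover have "insert (\<Upsilon>' ?new) {2..m + 1} = {1..sum_list \<alpha>}" unfolding new n by auto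
    ultimately show "bij_betw \<Upsilon>' (diagram \<alpha>) {1..sum_list \<alpha>}" by (simp only: D(1))
    fix R c c' assume *: "(R, c) \<in> diagram \<alpha> \<and> (R, c') \<in> diagram \<alpha> \<and> c < c'"
    have "(R, c) \<noteq> ?new" using * col[of c'] by auto
    then have c: "(R, c) \<in> diagram ?\<beta>" using * D(1) by auto
    show "\<Upsilon>' (R, c') < \<Upsilon>' (R, c)"
    proof (cases "(R, c') = ?new")
      case True
      then show ?thesis using old[OF c] new by simp
    next
      case False
      then have c': "(R, c') \<in> diagram ?\<beta>" using * D(1) by auto
      then have "\<Upsilon> (R, c') < \<Upsilon> (R, c)" using * c \<Upsilon> by (auto simp: RSCT_def)
      then show ?thesis using old[OF c] old[OF c'] by simp
    qed
  qed
  have new_iff: "\<Upsilon>' x = 1 \<longleftrightarrow> x = ?new" if "x \<in> diagram \<alpha>" for x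
    using that new old[of x] D(1) by auto
  have pos: "1 \<le> \<Upsilon>' x" if "x \<in> diagram \<alpha>" for x using RSCT_range[OF \<Upsilon>' that] by simp
  have "springer_inversion \<alpha> \<Upsilon>' 1 j \<longleftrightarrow> j \<in> Suc ` {i. i < length \<alpha> \<and> row_before \<alpha> i r}" for j
  proof
    assume "springer_inversion \<alpha> \<Upsilon>' 1 j"
    then obtain R c c' where *: "(R, c) \<in> diagram \<alpha>" "(j, c') \<in> diagram \<alpha>" "\<Upsilon>' (R, c) = 1"
      "c' = c \<and> j < R \<or> c < c'" by (auto simp: springer_inversion_def)
    then have "c = \<alpha> ! r" "R = r + 1" using new_iff[of "(R, c)"] by auto
    then have "j - 1 < length \<alpha>" "row_before \<alpha> (j - 1) r" "j = Suc (j - 1)"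
      using * by (auto simp: row_before_def diagram_def)
    then show "j \<in> Suc ` {i. i < length \<alpha> \<and> row_before \<alpha> i r}" by blast
  next
    assume "j \<in> Suc ` {i. i < length \<alpha> \<and> row_before \<alpha> i r}"
    then obtain i where i: "j = i + 1" "i < length \<alpha>" "row_before \<alpha> i r" by auto
    have box: "(j, \<alpha> ! i) \<in> diagram \<alpha>" using i r by (auto simp: diagram_def row_before_def)
    have "(j, \<alpha> ! i) \<noteq> ?new" using i by (auto simp: row_before_def)
    then have "\<Upsilon>' (j, \<alpha> ! i) \<noteq> 1" using new_iff[OF box] by blast
    then have "1 < \<Upsilon>' (j, \<alpha> ! i)" using pos[OF box] by simp
    moreover have "?new \<in> diagram \<alpha>" using D(1) by simp
    ultimately show "springer_inversion \<alpha> \<Upsilon>' 1 j"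
      unfolding springer_inversion_def using box i new by (fastforce simp: row_before_def)
  qed
  then have code1: "inversion_vector \<alpha> \<Upsilon>' 1 = row_rank \<alpha> r"
    by (simp add: inversion_vector_def row_rank_def card_image)
  have "springer_inversion \<alpha> \<Upsilon>' (k + 1) j \<longleftrightarrow> springer_inversion ?\<beta> \<Upsilon> k j" if k: "1 \<le> k" for k j
  proof
    assume "springer_inversion \<alpha> \<Upsilon>' (k + 1) j"
    then obtain R c c' where *: "(R, c) \<in> diagram \<alpha>" "(j, c') \<in> diagram \<alpha>" "\<Upsilon>' (R, c) = k + 1"
      "k + 1 < \<Upsilon>' (j, c')" "c' = c \<and> j < R \<or> c < c'" by (auto simp: springer_inversion_def)
    then have "\<Upsilon>' (R, c) \<noteq> 1" "\<Upsilon>' (j, c') \<noteq> 1" using k by simp_all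
    then have "(R, c) \<noteq> ?new" "(j, c') \<noteq> ?new" using new by metis+
    then have "(R, c) \<in> diagram ?\<beta>" "(j, c') \<in> diagram ?\<beta>" using * D(1) by auto
    then show "springer_inversion ?\<beta> \<Upsilon> k j"
      unfolding springer_inversion_def using * old(1) by fastforce
  next
    assume "springer_inversion ?\<beta> \<Upsilon> k j"
    then obtain R c c' where *: "(R, c) \<in> diagram ?\<beta>" "(j, c') \<in> diagram ?\<beta>" "\<Upsilon> (R, c) = k"
      "k < \<Upsilon> (j, c')" "c' = c \<and> j < R \<or> c < c'" by (auto simp: springer_inversion_def)
    then show "springer_inversion \<alpha> \<Upsilon>' (k + 1) j"
      unfolding springer_inversion_def using old(1)[OF *(1)] old(1)[OF *(2)] D(1) by fastforce
  qed
  then have code_Suc: "inversion_vector \<alpha> \<Upsilon>' (k + 1) = inversion_vector ?\<beta> \<Upsilon> k" if "1 \<le> k" for k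
    using that by (simp add: inversion_vector_def)
  have d: "row_rank \<alpha> r \<le> m" using inversion_vector_le[OF \<Upsilon>', of 1] code1 n by simp
  have wp: "w permutes {1..m}" using u_perm_code(1)[OF \<Upsilon>] by (simp add: w_eq m_def)
  have "u_perm \<alpha> \<Upsilon>' = cons_perm (row_rank \<alpha> r) w"
  proof (rule u_perm_eqI[OF \<Upsilon>'])
    show "cons_perm (row_rank \<alpha> r) w permutes {1..sum_list \<alpha>}"
      unfolding n by (rule cons_perm_permutes[OF wp d])
    fix k assume k: "k \<in> {1..sum_list \<alpha>}"
    show "lehmer_code (sum_list \<alpha>) (cons_perm (row_rank \<alpha> r) w) k = inversion_vector \<alpha> \<Upsilon>' k"
    proof (cases "k = 1")
      case True
      then show ?thesis using lehmer_code_cons_perm_1[OF wp d] code1 by (simp add: n)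
    next
      case False
      then have k': "k = (k - 1) + 1" "1 \<le> k - 1" "k - 1 \<in> {1..m}" using k n by auto
      have "lehmer_code (m + 1) (cons_perm (row_rank \<alpha> r) w) (k - 1 + 1) = inversion_vector ?\<beta> \<Upsilon> (k - 1)"
        using lehmer_code_cons_perm_Suc[OF k'(2)] u_perm_code(2)[OF \<Upsilon>, of "k - 1"] k'(3)
        by (simp add: w_eq m_def)
      then show ?thesis using code_Suc[OF k'(2)] k'(1) n by simp
    qed
  qed
  then show ?thesis unfolding W_set_def using \<Upsilon>' by force
qed

section \<open>Tanisaki's relations\<close>

text \<open>The number of roots that \<open>\<Prod>\<^bsub>s\<in>S\<^esub>(t - x\<^sub>s)\<close> must have among the \<open>z\<^sub>i\<close> at each point of \<open>Z\<^sub>\<alpha>\<close>, counted with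
  forced multiplicities, when \<open>q\<close> of the \<open>n\<close> variables are missing from \<open>S\<close>.\<close>

definition excess :: "nat list \<Rightarrow> nat \<Rightarrow> nat" where
  "excess \<alpha> q = (\<Sum>i<length \<alpha>. \<alpha> ! i - q)"

lemma excess_Suc: "excess \<alpha> q = excess \<alpha> (q + 1) + card {i. i < length \<alpha> \<and> q < \<alpha> ! i}"
proof -
  have "excess \<alpha> q = (\<Sum>i<length \<alpha>. (\<alpha> ! i - (q + 1)) + (if q < \<alpha> ! i then 1 else 0))"
    unfolding excess_def by (intro sum.cong) auto
  also have "\<dots> = excess \<alpha> (q + 1) + card {i \<in> {..<length \<alpha>}. q < \<alpha> ! i}"
    by (simp add: excess_def sum.distrib flip: sum.inter_filter)
  finally show ?thesis by (simp add: lessThan_def)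
qed

lemma excess_0: "excess \<alpha> 0 = sum_list \<alpha>"
  by (simp add: excess_def sum_list_sum_nth atLeast0LessThan)

lemma excess_remove_box:
  assumes "r < length \<alpha>"
  shows "excess \<alpha> q = excess (remove_box \<alpha> r) q + (if q < \<alpha> ! r then 1 else 0)"
proof -
  have "excess \<alpha> q = (\<Sum>i<length \<alpha>. (remove_box \<alpha> r ! i - q) + (if i = r then if q < \<alpha> ! r then 1 else 0 else 0))"
    unfolding excess_def using assms by (intro sum.cong) (auto simp: remove_box_def nth_list_update)
  then show ?thesis using assms by (simp add: excess_def sum.distrib remove_box_def)
qed

text \<open>Up to sign, the elementary symmetric polynomial of degree \<open>card S - j\<close> in the variables \<open>S\<close>.\<close>

definition monic_coeff :: "nat set \<Rightarrow> nat \<Rightarrow> nat mpoly" where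
  "monic_coeff S j = coeff (\<Prod>s\<in>S. [:- Var s, 1:]) j"

lemma monic_coeff_insert:
  "finite S \<Longrightarrow> s \<notin> S \<Longrightarrow>
    monic_coeff (insert s S) j = (if j = 0 then 0 else monic_coeff S (j - 1)) - Var s * monic_coeff S j"
  by (cases j) (simp_all add: monic_coeff_def)

lemma monic_coeff_empty: "monic_coeff {} j = (if j = 0 then 1 else 0)"
  by (simp add: monic_coeff_def)

lemma monic_coeff_card: "finite S \<Longrightarrow> monic_coeff S (card S) = 1 \<and> (\<forall>j > card S. monic_coeff S j = 0)"
  by (induction S rule: finite_induct) (auto simp: monic_coeff_empty monic_coeff_insert)

lemma shift_monic_coeff: "finite S \<Longrightarrow> shift (monic_coeff S j) = monic_coeff (Suc ` S) j"
proof (induction S arbitrary: j rule: finite_induct)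
  case empty
  then show ?case by (simp add: monic_coeff_empty shift_hom)
next
  case (insert s S)
  have "Suc s \<notin> Suc ` S" using insert by auto
  then show ?case using insert by (simp add: monic_coeff_insert shift_hom)
qed

text \<open>The conditions on \<open>x\<^sub>0\<close> and on the variables beyond \<open>x\<^sub>n\<close> let \<open>I\<close> be an ideal of the polynomial ring in all
  variables \<open>x\<^sub>0, x\<^sub>1, x\<^sub>2, \<dots>\<close> while its quotient only sees \<open>x\<^sub>1, \<dots>, x\<^sub>n\<close>. This makes the notion stable under
  pulling back along \<open>shift\<close>.\<close>

definition tanisaki_ideal :: "nat list \<Rightarrow> nat mpoly set \<Rightarrow> bool" where
  "tanisaki_ideal \<alpha> I \<longleftrightarrow>
     (\<forall>p\<in>I. \<forall>q\<in>I. p + q \<in> I) \<and> (\<forall>p\<in>I. \<forall>q. q * p \<in> I) \<and>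
     Var 0 \<in> I \<and> (\<forall>j > sum_list \<alpha>. Var j \<in> I) \<and>
     (\<forall>S j. S \<subseteq> {1..sum_list \<alpha>} \<longrightarrow> j < excess \<alpha> (sum_list \<alpha> - card S) \<longrightarrow> monic_coeff S j \<in> I)"

text \<open>The relations say that multiplication by \<open>x\<close> lowers the index of \<open>c\<close> by one modulo \<open>I\<close>; after \<open>a\<close> steps from
  the top index \<open>e + a - 1\<close> the result has index below \<open>e\<close>, or has fallen off below \<open>0\<close>.\<close>

lemma power_annihilates:
  fixes x :: "'a::comm_ring_1" and c :: "nat \<Rightarrow> 'a"
  assumes add: "\<And>p q. p \<in> I \<Longrightarrow> q \<in> I \<Longrightarrow> p + q \<in> I" and mult: "\<And>p q. p \<in> I \<Longrightarrow> q * p \<in> I"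
    and rel: "\<And>j. j < e + a \<Longrightarrow> (if j = 0 then 0 else c (j - 1)) - x * c j \<in> I"
    and c: "\<And>j. j < e \<Longrightarrow> c j \<in> I" and "0 < e + a"
  shows "x ^ a * c (e + a - 1) \<in> I"
proof -
  have neg: "- p \<in> I" if "p \<in> I" for p using mult[OF that, of "- 1"] by simp
  have chain: "x ^ i * c (e + a - 1) - c (e + a - 1 - i) \<in> I" if "i < e + a" for i
    using that
  proof (induction i)
    case 0
    then show ?case using mult[OF rel[of 0], of 0] by simp
  next
    case (Suc i)
    have "x * (x ^ i * c (e + a - 1) - c (e + a - 1 - i)) +
        - (c (e + a - 1 - i - 1) - x * c (e + a - 1 - i)) \<in> I"
      using rel[of "e + a - 1 - i"] Suc by (intro add mult neg) auto
    then show ?case by (simp add: algebra_simps)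
  qed
  show ?thesis
  proof (cases "e = 0")
    case True
    then have a: "0 < a" using \<open>0 < e + a\<close> by simp
    have "x * (x ^ (a - 1) * c (a - 1) - c 0) + - (0 - x * c 0) \<in> I"
      using chain[of "a - 1"] rel[of 0] True a by (intro add mult neg) auto
    \<comment> \<open>the chain ends at \<open>c 0\<close>, which one more factor \<open>x\<close> annihilates\<close>
    then have "x ^ Suc (a - 1) * c (a - 1) \<in> I" by (simp add: algebra_simps)
    then show ?thesis using True a by simp
  next
    case False
    then have "(x ^ a * c (e + a - 1) - c (e + a - 1 - a)) + c (e - 1) \<in> I"
      using chain[of a] c[of "e - 1"] by (intro add) auto
    then show ?thesis by simp
  qed
qed

text \<open>For a set \<open>S\<close> of variables among \<open>x\<^sub>2, \<dots>, x\<^sub>n\<close>, given by its unshifted indices, the relations for \<open>S\<close> and for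
  \<open>S \<union> {x\<^sub>1}\<close> are combined; the latter compare consecutive coefficients for \<open>S\<close>.\<close>

lemma tanisaki_ideal_step:
  assumes I: "tanisaki_ideal \<alpha> I" and n: "sum_list \<alpha> = m + 1" and S: "S \<subseteq> {1..m}"
  defines "q \<equiv> m - card S"
  shows "j < excess \<alpha> (q + 1) \<Longrightarrow> monic_coeff (Suc ` S) j \<in> I"
    "j < excess \<alpha> q \<Longrightarrow>
      (if j = 0 then 0 else monic_coeff (Suc ` S) (j - 1)) - Var 1 * monic_coeff (Suc ` S) j \<in> I"
    "0 < excess \<alpha> q \<Longrightarrow> Var 1 ^ card {i. i < length \<alpha> \<and> q < \<alpha> ! i} *
      monic_coeff (Suc ` S) (excess \<alpha> q - 1) \<in> I"
proof -
  have fin: "finite S" using S finite_subset by blast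
  have card: "card S \<le> m" using card_mono[OF _ S] by simp
  have card_Suc: "card (Suc ` S) = card S" by (simp add: card_image)
  have notin: "1 \<notin> Suc ` S" using S by auto
  have sub: "Suc ` S \<subseteq> {1..sum_list \<alpha>}" "insert 1 (Suc ` S) \<subseteq> {1..sum_list \<alpha>}" using S n by auto
  have rel: "monic_coeff T j \<in> I" if "T \<subseteq> {1..sum_list \<alpha>}" "j < excess \<alpha> (sum_list \<alpha> - card T)" for T j
    using I that unfolding tanisaki_ideal_def by blast
  show 1: "monic_coeff (Suc ` S) j \<in> I" if "j < excess \<alpha> (q + 1)" for j
    using that card card_Suc n by (intro rel sub) (simp add: q_def Suc_diff_le)
  show 2: "(if j = 0 then 0 else monic_coeff (Suc ` S) (j - 1)) - Var 1 * monic_coeff (Suc ` S) j \<in> I"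
    if "j < excess \<alpha> q" for j
  proof -
    have "monic_coeff (insert 1 (Suc ` S)) j \<in> I"
      using that card card_Suc n fin notin by (intro rel sub) (simp add: q_def)
    then show ?thesis unfolding monic_coeff_insert[OF finite_imageI[OF fin] notin] .
  qed
  let ?a = "card {i. i < length \<alpha> \<and> q < \<alpha> ! i}"
  show "Var 1 ^ ?a * monic_coeff (Suc ` S) (excess \<alpha> q - 1) \<in> I" if "0 < excess \<alpha> q"
    unfolding excess_Suc[of \<alpha> q]
    by (rule power_annihilates) (use I that 1 2 excess_Suc[of \<alpha> q] in \<open>auto simp: tanisaki_ideal_def\<close>)
qed

lemma first_variable_decomposition: "\<exists>g h k. p = shift g + Var 1 * h + Var 0 * k"
proof (induction p rule: mpoly_ring_induct)
  case (Const c)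
  have "Const c = shift (Const c) + Var 1 * 0 + Var 0 * 0" by (simp add: shift_hom)
  then show ?case by blast
next
  case (Var i)
  consider "i = 0" | "i = 1" | j where "i = Suc (Suc j)" by (metis One_nat_def nat.exhaust)
  then show ?case
  proof cases
    case 1
    then have "Var i = shift 0 + Var 1 * 0 + Var 0 * 1" by (simp add: shift_hom)
    then show ?thesis by blast
  next
    case 2
    then have "Var i = shift 0 + Var 1 * 1 + Var 0 * 0" by (simp add: shift_hom)
    then show ?thesis by blast
  next
    case (3 j)
    then have "Var i = shift (Var (Suc j)) + Var 1 * 0 + Var 0 * 0" by (simp add: shift_hom)
    then show ?thesis by blast
  qed
next
  case (add p q)
  then obtain g h k g' h' k' where "p = shift g + Var 1 * h + Var 0 * k" "q = shift g' + Var 1 * h' + Var 0 * k'"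
    by blast
  then have "p + q = shift (g + g') + Var 1 * (h + h') + Var 0 * (k + k')"
    by (simp add: shift_hom algebra_simps)
  then show ?case by blast
next
  case (mult p q)
  then obtain g h k g' h' k' where p: "p = shift g + Var 1 * h + Var 0 * k"
    and q: "q = shift g' + Var 1 * h' + Var 0 * k'" by blast
  have "p * q = shift (g * g') + Var 1 * (h * q + shift g * h') + Var 0 * (k * q + shift g * k')"
    unfolding p shift_hom(3) by (simp add: q algebra_simps)
  then show ?case by blast
qed

text \<open>Stated with an arbitrary subspace \<open>U\<close> in place of the span, and with an arbitrary ideal containing the relations,
  so that the induction hypothesis applies to the ideal and the subspace of those \<open>f\<close> for which \<open>x\<^sub>1\<^sup>d f(x\<^sub>2, x\<^sub>3, \<dots>)\<close> lies in
  \<open>I\<close> modulo \<open>x\<^sub>1\<^bsup>d+1\<^esup>\<close>, respectively in \<open>U\<close>.\<close>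

theorem schubert_span_mod_tanisaki_ideal:
  assumes "tanisaki_ideal \<alpha> I" "I \<subseteq> U" "\<And>p q. p \<in> U \<Longrightarrow> q \<in> U \<Longrightarrow> p + q \<in> U"
    "\<And>c p. p \<in> U \<Longrightarrow> Const c * p \<in> U" "\<And>w. w \<in> W_set \<alpha> \<Longrightarrow> schubert (sum_list \<alpha>) w \<in> U"
  shows "p \<in> U"
  using assms
proof (induction "sum_list \<alpha>" arbitrary: \<alpha> I U p)
  case 0
  note U = "0.prems"
  have I: "q * p \<in> I" if "p \<in> I" for p q using U(1) that by (simp add: tanisaki_ideal_def)
  have I0: "Var 0 \<in> I" using U(1) by (simp add: tanisaki_ideal_def)
  have I_Var: "Var j \<in> I" for j using U(1) 0(1) by (cases j) (simp_all add: tanisaki_ideal_def)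
  have empty: "diagram \<alpha> = {}"
  proof -
    have "\<alpha> ! i = 0" if "i < length \<alpha>" for i using elem_le_sum_list[OF that] 0(1) by simp
    then show ?thesis by (auto simp: diagram_def)
  qed
  then have "(\<lambda>_. undefined) \<in> RSCT \<alpha>" using 0(1) by (simp add: RSCT_def bij_betw_def flip: 0(1))
  then have "u_perm \<alpha> (\<lambda>_. undefined) \<in> W_set \<alpha>" by (auto simp: W_set_def)
  then obtain w where w: "w \<in> W_set \<alpha>" by blast
  have "w permutes {1..0}" using W_set_permutes[OF w] 0(1) by simp
  then have "w = longest_perm 0" by (auto simp: longest_perm_def permutes_empty)
  then have "schubert 0 w = 1" using schubert_eqI[OF is_schubert.longest[of 0]] by simp
  then have one: "1 \<in> U" using U(5)[OF w] 0(1) by simp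
  have "\<exists>c. \<exists>q\<in>I. p = Const c + q" for p
  proof (induction p rule: mpoly_ring_induct)
    case (Const c)
    then show ?case using I[OF I0, of 0] by (intro exI[of _ c] bexI[of _ 0]) auto
  next
    case (Var i)
    then show ?case using I_Var by (intro exI[of _ 0] bexI[of _ "Var i"]) (auto simp: Const_hom)
  next
    case (add p q)
    then obtain c p' d q' where "p = Const c + p'" "q = Const d + q'" "p' \<in> I" "q' \<in> I" by blast
    then show ?case using U(1) unfolding tanisaki_ideal_def
      by (intro exI[of _ "c + d"] bexI[of _ "p' + q'"]) (auto simp: Const_hom)
  next
    case (mult p q)
    then obtain c p' d q' where "p = Const c + p'" "q = Const d + q'" "p' \<in> I" "q' \<in> I" by blast
    moreover from this have "q * p' + Const c * q' \<in> I"
      using U(1) by (simp add: tanisaki_ideal_def)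
    moreover have "(Const c + p') * q = Const c * (Const d + q') + q * p'"
      using \<open>q = Const d + q'\<close> by (simp add: distrib_right mult.commute)
    ultimately show ?case
      by (intro exI[of _ "c * d"] bexI[of _ "q * p' + Const c * q'"]) (simp_all add: Const_hom(3) distrib_left)
  qed
  then obtain c q where "p = Const c * 1 + q" "q \<in> I" by (metis mult.right_neutral)
  then show ?case using U(2) U(3)[OF U(4)[OF one]] by blast
next
  case (Suc m)
  note U = Suc.prems
  let ?x = "Var 1 :: nat mpoly"
  have n: "sum_list \<alpha> = m + 1" using Suc(2) by simp
  have I: "p + q \<in> I" if "p \<in> I" "q \<in> I" for p q using U(1) that by (simp add: tanisaki_ideal_def)
  have I_mult: "q * p \<in> I" if "p \<in> I" for p q using U(1) that by (simp add: tanisaki_ideal_def)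
  have I_Var: "Var 0 \<in> I" "\<And>j. sum_list \<alpha> < j \<Longrightarrow> Var j \<in> I" using U(1) by (simp_all add: tanisaki_ideal_def)
  have zero: "0 \<in> I" using I_mult[OF I_Var(1), of 0] by simp
  let ?k = "card {i. i < length \<alpha> \<and> 0 < \<alpha> ! i}"
  \<comment> \<open>the relations for all of \<open>x\<^sub>2, \<dots>, x\<^sub>n\<close>, where the top coefficient is \<open>1\<close>\<close>
  have "?x ^ ?k * monic_coeff (Suc ` {1..m}) m \<in> I"
    using tanisaki_ideal_step(3)[OF U(1) n order.refl] by (simp add: excess_0 n)
  then have x_power: "?x ^ ?k \<in> I"
    using monic_coeff_card[of "Suc ` {1..m}"] by (simp add: card_image)
  have "\<forall>p. ?x ^ 0 * p \<in> U"
    using le0[of ?k]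
  proof (induction rule: inc_induct)
    case base
    then show ?case using I_mult[OF x_power] U(2) by (auto simp: mult.commute)
  next
    case (step d)
    obtain r where r: "r < length \<alpha>" "0 < \<alpha> ! r" and d: "row_rank \<alpha> r = d"
      using row_rank_exists step(2) by blast
    let ?\<beta> = "remove_box \<alpha> r"
    have m: "sum_list ?\<beta> = m" using sum_list_remove_box[OF r] n by simp
    define J where "J = {f. \<exists>h. ?x ^ d * shift f - ?x ^ (d + 1) * h \<in> I}"
    define V where "V = {f. ?x ^ d * shift f \<in> U}"
    have high: "?x ^ (d + 1) * h \<in> U" for h using step.IH by simp
    have "tanisaki_ideal ?\<beta> J"
      unfolding tanisaki_ideal_def
    proof (intro conjI ballI allI impI)
      fix f g assume "f \<in> J" "g \<in> J"
      then obtain h h' where "?x ^ d * shift f - ?x ^ (d + 1) * h \<in> I" "?x ^ d * shift g - ?x ^ (d + 1) * h' \<in> I"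
        by (auto simp: J_def)
      then have "?x ^ d * shift (f + g) - ?x ^ (d + 1) * (h + h') \<in> I"
        using I by (fastforce simp: shift_hom algebra_simps)
      then show "f + g \<in> J" by (auto simp: J_def)
    next
      fix f g assume "f \<in> J"
      then obtain h where "?x ^ d * shift f - ?x ^ (d + 1) * h \<in> I" by (auto simp: J_def)
      then have "shift g * (?x ^ d * shift f - ?x ^ (d + 1) * h) \<in> I" by (rule I_mult)
      then have "?x ^ d * shift (g * f) - ?x ^ (d + 1) * (shift g * h) \<in> I"
        by (simp add: shift_hom algebra_simps)
      then show "g * f \<in> J" by (auto simp: J_def)
    next
      have "?x ^ d * shift (Var 0) - ?x ^ (d + 1) * 1 \<in> I" using zero by (simp add: shift_hom)
      then show "Var 0 \<in> J" unfolding J_def by blast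
    next
      fix j assume "sum_list ?\<beta> < j"
      then have "?x ^ d * shift (Var j) - ?x ^ (d + 1) * 0 \<in> I"
        using I_mult[OF I_Var(2)[of "j + 1"]] m n by (simp add: shift_hom)
      then show "Var j \<in> J" unfolding J_def by blast
    next
      fix S j assume S: "S \<subseteq> {1..sum_list ?\<beta>}" and j: "j < excess ?\<beta> (sum_list ?\<beta> - card S)"
      define q where "q = m - card S"
      have S': "S \<subseteq> {1..m}" using S m by simp
      have j': "j < excess ?\<beta> q" using j m by (simp add: q_def)
      note c = tanisaki_ideal_step[OF U(1) n S', folded q_def]
      have shift: "shift (monic_coeff S j) = monic_coeff (Suc ` S) j"
        using S' by (intro shift_monic_coeff) (rule finite_subset, auto)
      show "monic_coeff S j \<in> J"
      \<comment> \<open>below the top index, the coefficient already is a multiple of \<open>x\<^sub>1\<close> modulo \<open>I\<close>\<close>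
      proof (cases "j + 1 < excess \<alpha> q")
        case True
        then have "?x ^ d * (monic_coeff (Suc ` S) j - ?x * monic_coeff (Suc ` S) (j + 1)) \<in> I"
          using c(2)[of "j + 1"] by (intro I_mult) simp
        then have "?x ^ d * shift (monic_coeff S j) - ?x ^ (d + 1) * monic_coeff (Suc ` S) (j + 1) \<in> I"
          unfolding shift by (simp add: algebra_simps)
        then show ?thesis by (auto simp: J_def)
      next
        case False
        \<comment> \<open>at the top index, row \<open>r\<close> is short, so all rows longer than \<open>q\<close> precede it and \<open>x\<^sub>1\<^sup>d\<close> suffices\<close>
        then have q: "\<alpha> ! r \<le> q" and j_eq: "j = excess \<alpha> q - 1" and pos: "0 < excess \<alpha> q"
          using j' excess_remove_box[OF r(1), of q] by (auto split: if_splits)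
        have "card {i. i < length \<alpha> \<and> q < \<alpha> ! i} \<le> row_rank \<alpha> r"
          unfolding row_rank_def using q by (intro card_mono) (auto simp: row_before_def)
        then obtain e where e: "d = card {i. i < length \<alpha> \<and> q < \<alpha> ! i} + e"
          using d le_Suc_ex by blast
        have "?x ^ e * (?x ^ card {i. i < length \<alpha> \<and> q < \<alpha> ! i} * monic_coeff (Suc ` S) j) \<in> I"
          unfolding j_eq using c(3)[OF pos] by (rule I_mult)
        then have "?x ^ d * shift (monic_coeff S j) - ?x ^ (d + 1) * 0 \<in> I"
          unfolding shift e by (simp add: power_add mult_ac)
        then show ?thesis unfolding J_def by blast
      qed
    qed
    moreover have "J \<subseteq> V"
    proof
      fix f assume "f \<in> J"
      then obtain h where h: "?x ^ d * shift f - ?x ^ (d + 1) * h \<in> I" by (auto simp: J_def)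
      then have "(?x ^ d * shift f - ?x ^ (d + 1) * h) + ?x ^ (d + 1) * h \<in> U"
        using U(2) high by (intro U(3)) auto
      then show "f \<in> V" by (simp add: V_def)
    qed
    moreover have "f + g \<in> V" if "f \<in> V" "g \<in> V" for f g
      using U(3) that by (simp add: V_def shift_hom distrib_left)
    moreover have "Const c * f \<in> V" if "f \<in> V" for c f
      using U(4) that by (simp add: V_def shift_hom mult.left_commute)
    moreover have "schubert (sum_list ?\<beta>) w \<in> V" if w: "w \<in> W_set ?\<beta>" for w
    proof -
      have W: "cons_perm d w \<in> W_set \<alpha>" using W_set_cons_perm[OF r w] d by simp
      have wp: "w permutes {1..m}" using W_set_permutes[OF w] m by simp
      have "d + 1 \<le> m + 1"
        using permutes_in_image[OF W_set_permutes[OF W], of 1] n by (simp add: cons_perm_def)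
      then obtain h where h: "schubert (m + 1) (cons_perm d w) = ?x ^ d * shift (schubert m w) + ?x ^ (d + 1) * h"
        using schubert_cons_perm[OF wp] by auto
      have "schubert (m + 1) (cons_perm d w) + ?x ^ (d + 1) * (- h) \<in> U"
        using U(5)[OF W] n high[of "- h"] by (intro U(3)) simp_all
      then show ?thesis unfolding h by (simp add: V_def m)
    qed
    ultimately have V: "g \<in> V" for g using Suc.hyps(1)[of ?\<beta> J V g] m by blast
    show ?case
    proof
      fix p
      obtain g h k where p: "p = shift g + ?x * h + Var 0 * k" using first_variable_decomposition by blast
      have "?x ^ d * shift g + ?x ^ (d + 1) * h + (?x ^ d * k) * Var 0 \<in> U"
        using V[of g] high I_mult[OF I_Var(1)] U(2) by (intro U(3)) (auto simp: V_def)
      then show "?x ^ d * p \<in> U" by (simp add: p algebra_simps)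
    qed
  qed
  then show ?case by simp
qed

section \<open>The points of the variety\<close>

text \<open>The word \<open>1\<^bsup>a 0\<^esup> 2\<^bsup>a 1\<^esup> \<dots> k\<^bsup>a (k-1)\<^esup>\<close>. It serves both for the coordinates of a point of \<open>\<s>\<close> and for the list of forced
  roots.\<close>

definition blocks :: "(nat \<Rightarrow> nat) \<Rightarrow> nat \<Rightarrow> nat list" where
  "blocks a k = concat (map (\<lambda>i. replicate (a i) (i + 1)) [0..<k])"

lemma blocks_Suc: "blocks a (Suc k) = blocks a k @ replicate (a k) (k + 1)"
  by (simp add: blocks_def)

lemma length_blocks: "length (blocks a k) = (\<Sum>i<k. a i)"
  by (induction k) (simp_all add: blocks_Suc, simp add: blocks_def)

lemma set_blocks: "set (blocks a k) \<subseteq> {1..k}"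
  by (auto simp: blocks_def)

lemma count_list_blocks: "i \<in> {1..k} \<Longrightarrow> count_list (blocks a k) i = a (i - 1)"
proof (induction k)
  case (Suc k)
  have rep: "count_list (replicate m x) y = (if x = y then m else 0)" for m and x y :: nat
    by (induction m) auto
  show ?case
  proof (cases "i = k + 1")
    case True
    then have "i \<notin> set (blocks a k)" using set_blocks[of a k] by auto
    then show ?thesis using True by (simp add: blocks_Suc rep)
  next
    case False
    then show ?thesis using Suc by (simp add: blocks_Suc rep)
  qed
qed simp

lemma prod_list_blocks: "prod_list (map f (blocks a k)) = (\<Prod>i<k. f (i + 1) ^ a i)"
  by (induction k) (simp_all add: blocks_Suc, simp add: blocks_def)

definition block_index :: "nat list \<Rightarrow> nat \<Rightarrow> nat" where
  "block_index \<alpha> j = blocks ((!) \<alpha>) (length \<alpha>) ! (j - 1)"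

lemma sum_list_eq_sum: "sum_list \<alpha> = (\<Sum>i<length \<alpha>. \<alpha> ! i)"
  by (simp add: sum_list_sum_nth atLeast0LessThan)

lemma block_vec_eq:
  assumes "j \<in> {1..sum_list \<alpha>}"
  shows "block_vec \<alpha> z j = z (block_index \<alpha> j)"
proof -
  have "map2 replicate \<alpha> (map z [1..<length \<alpha> + 1]) =
      map (map z) (map (\<lambda>i. replicate (\<alpha> ! i) (i + 1)) [0..<length \<alpha>])"
    by (rule nth_equalityI) (simp_all del: upt_Suc)
  then have "concat (map2 replicate \<alpha> (map z [1..<length \<alpha> + 1])) = map z (blocks ((!) \<alpha>) (length \<alpha>))"
    by (simp add: blocks_def map_concat)
  moreover have "j - 1 < length (blocks ((!) \<alpha>) (length \<alpha>))"
    using assms by (auto simp: length_blocks sum_list_eq_sum)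
  ultimately show ?thesis using assms by (simp add: block_vec_def block_index_def)
qed

lemma block_vec_outside: "j \<notin> {1..sum_list \<alpha>} \<Longrightarrow> block_vec \<alpha> z j = 0"
  unfolding block_vec_def by (rule if_not_P)

text \<open>Words \<open>p\<close> of content \<open>\<alpha>\<close> index the points above a given \<open>h \<in> \<s>\<close>: the coordinate \<open>x\<^sub>s\<close> of the point is \<open>z\<^bsub>p(s)\<^esub>\<close>.\<close>

definition has_content :: "nat list \<Rightarrow> (nat \<Rightarrow> nat) \<Rightarrow> bool" where
  "has_content \<alpha> p \<longleftrightarrow> (\<forall>s\<in>{1..sum_list \<alpha>}. p s \<in> {1..length \<alpha>}) \<and>
     (\<forall>i\<in>{1..length \<alpha>}. card {s \<in> {1..sum_list \<alpha>}. p s = i} = \<alpha> ! (i - 1))"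

lemma block_index_has_content: "has_content \<alpha> (block_index \<alpha>)"
proof -
  let ?w = "blocks ((!) \<alpha>) (length \<alpha>)"
  have len: "length ?w = sum_list \<alpha>" by (simp add: length_blocks sum_list_eq_sum)
  have "block_index \<alpha> s \<in> {1..length \<alpha>}" if "s \<in> {1..sum_list \<alpha>}" for s
  proof -
    have "?w ! (s - 1) \<in> set ?w" using that len by (intro nth_mem) auto
    then show ?thesis using set_blocks[of "(!) \<alpha>" "length \<alpha>"] unfolding block_index_def by blast
  qed
  moreover have "card {s \<in> {1..sum_list \<alpha>}. block_index \<alpha> s = i} = \<alpha> ! (i - 1)"
    if "i \<in> {1..length \<alpha>}" for i
  proof -
    have "{s \<in> {1..sum_list \<alpha>}. block_index \<alpha> s = i} = Suc ` {j. j < length ?w \<and> i = ?w ! j}"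
      (is "?L = ?R")
    proof (intro equalityI subsetI)
      fix s assume "s \<in> ?L"
      then have "s = Suc (s - 1)" "s - 1 \<in> {j. j < length ?w \<and> i = ?w ! j}"
        using len by (auto simp: block_index_def)
      then show "s \<in> ?R" by blast
    qed (use len in \<open>auto simp: block_index_def\<close>)
    then have "card {s \<in> {1..sum_list \<alpha>}. block_index \<alpha> s = i} = count_list ?w i"
      by (simp add: card_image count_list_eq_length_filter length_filter_conv_card)
    then show ?thesis using count_list_blocks[OF that] by simp
  qed
  ultimately show ?thesis by (simp add: has_content_def)
qed

lemma Z_variety_word:
  assumes "(block_vec \<alpha> z, x) \<in> Z_variety \<alpha>"
  obtains p where "has_content \<alpha> p" "\<And>s. s \<in> {1..sum_list \<alpha>} \<Longrightarrow> x s = z (p s)"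
    "\<And>s. s \<notin> {1..sum_list \<alpha>} \<Longrightarrow> x s = 0"
proof -
  let ?n = "sum_list \<alpha>"
  obtain w where w: "w permutes {1..?n}" and x: "x = perm_act w (block_vec \<alpha> z)"
    using assms by (auto simp: Z_variety_def)
  have v: "inv_into UNIV w permutes {1..?n}" using permutes_inv[OF w] .
  let ?p = "\<lambda>s. block_index \<alpha> (inv_into UNIV w s)"
  have "has_content \<alpha> ?p"
    unfolding has_content_def
  proof (intro conjI ballI)
    fix s assume "s \<in> {1..?n}"
    then show "?p s \<in> {1..length \<alpha>}"
      using permutes_in_image[OF v, of s] block_index_has_content by (auto simp: has_content_def)
  next
    fix i assume i: "i \<in> {1..length \<alpha>}"
    have "{s \<in> {1..?n}. ?p s = i} = w ` {s \<in> {1..?n}. block_index \<alpha> s = i}" (is "?L = ?R")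
    proof (intro equalityI subsetI)
      fix s assume s: "s \<in> ?L"
      then have "inv_into UNIV w s \<in> {1..?n}" using permutes_in_image[OF v, of s] by blast
      moreover have "s = w (inv_into UNIV w s)" using permutes_inverses(1)[OF w] by simp
      ultimately show "s \<in> ?R" using s by blast
    next
      fix s assume "s \<in> ?R"
      then obtain t where t: "s = w t" "t \<in> {1..?n}" "block_index \<alpha> t = i" by blast
      then have "s \<in> {1..?n}" using permutes_in_image[OF w, of t] by blast
      then show "s \<in> ?L" using t permutes_inverses(2)[OF w] by simp
    qed
    moreover have "inj_on w {s \<in> {1..?n}. block_index \<alpha> s = i}"
      by (rule inj_on_subset[OF permutes_inj[OF w]]) simp
    ultimately show "card {s \<in> {1..?n}. ?p s = i} = \<alpha> ! (i - 1)"
      using block_index_has_content i by (simp add: card_image has_content_def)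
  qed
  moreover have "x s = z (?p s)" if "s \<in> {1..?n}" for s
    using permutes_in_image[OF v, of s] that block_vec_eq[of "inv_into UNIV w s" \<alpha> z]
    by (simp only: x perm_act_def)
  moreover have "x s = 0" if "s \<notin> {1..?n}" for s
    using permutes_not_in[OF v that] block_vec_outside[OF that] by (simp add: x perm_act_def)
  ultimately show ?thesis using that by blast
qed

text \<open>Words with the same content are rearrangements of each other.\<close>

lemma word_in_Z_variety:
  assumes h: "block_vec \<alpha> z \<in> s_space \<alpha>" and p: "has_content \<alpha> p"
  shows "(block_vec \<alpha> z, \<lambda>s. if s \<in> {1..sum_list \<alpha>} then z (p s) else 0) \<in> Z_variety \<alpha>"
proof -
  let ?n = "sum_list \<alpha>"
  have count: "count (image_mset f (mset_set {1..?n})) i = card {s \<in> {1..?n}. f s = i}" for f :: "nat \<Rightarrow> nat" and i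
  proof -
    have "f -` {i} \<inter> {1..?n} = {s \<in> {1..?n}. f s = i}" by auto
    then show ?thesis by (simp add: count_image_mset)
  qed
  have "image_mset p (mset_set {1..?n}) = image_mset (block_index \<alpha>) (mset_set {1..?n})"
  proof (rule multiset_eqI)
    fix i
    show "count (image_mset p (mset_set {1..?n})) i = count (image_mset (block_index \<alpha>) (mset_set {1..?n})) i"
    proof (cases "i \<in> {1..length \<alpha>}")
      case True
      then show ?thesis using p block_index_has_content unfolding count has_content_def by simp
    next
      case False
      then have "{s \<in> {1..?n}. p s = i} = {}" "{s \<in> {1..?n}. block_index \<alpha> s = i} = {}"
        using p block_index_has_content unfolding has_content_def by blast+
      then show ?thesis unfolding count by (simp only:)
    qed
  qed
  then obtain q where q: "q permutes {1..?n}" "\<forall>s\<in>{1..?n}. p s = block_index \<alpha> (q s)"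
    by (rule image_mset_eq_implies_permutes[OF finite_atLeastAtMost])
  let ?w = "inv_into UNIV q"
  have w: "?w permutes {1..?n}" using permutes_inv[OF q(1)] .
  have "perm_act ?w (block_vec \<alpha> z) = (\<lambda>s. if s \<in> {1..?n} then z (p s) else 0)"
  proof
    fix s
    have "perm_act ?w (block_vec \<alpha> z) s = block_vec \<alpha> z (q s)"
      using permutes_inv_inv[OF q(1)] by (simp add: perm_act_def)
    also have "\<dots> = (if s \<in> {1..?n} then z (p s) else 0)"
    proof (cases "s \<in> {1..?n}")
      case True
      then have "q s \<in> {1..?n}" using permutes_in_image[OF q(1), of s] by blast
      then show ?thesis using True q(2) block_vec_eq[of "q s" \<alpha> z] by (simp del: atLeastAtMost_iff)
    next
      case False
      then show ?thesis using permutes_not_in[OF q(1) False] block_vec_outside[OF False] by auto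
    qed
    finally show "perm_act ?w (block_vec \<alpha> z) s = (if s \<in> {1..?n} then z (p s) else 0)" .
  qed
  then have "(block_vec \<alpha> z, \<lambda>s. if s \<in> {1..?n} then z (p s) else 0) =
      (block_vec \<alpha> z, perm_act ?w (block_vec \<alpha> z))" by simp
  then show ?thesis unfolding Z_variety_def using h w by blast
qed

section \<open>Tanisaki's relations hold in \<open>A\<^sub>0\<close>\<close>

text \<open>Successive division by \<open>t - r\<close> for the listed roots. Evaluated at the next root, the quotients are the
  coefficients of the remainder of \<open>P\<close> in Newton's interpolation basis, so the remainder is available over any
  commutative ring.\<close>

primrec iterated_quotient :: "'a::comm_ring_1 poly \<Rightarrow> 'a list \<Rightarrow> 'a poly" where
  "iterated_quotient P [] = P"
| "iterated_quotient P (r # rs) = iterated_quotient (synthetic_div P r) rs"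

lemma iterated_quotient_root:
  fixes P :: "'a::idom poly"
  shows "(\<Prod>r\<leftarrow>rs. [:- r, 1:]) dvd P \<Longrightarrow> j < length rs \<Longrightarrow>
    poly (iterated_quotient P (take j rs)) (rs ! j) = 0"
proof (induction rs arbitrary: P j)
  case (Cons r rs)
  then obtain Q where "P = (\<Prod>r\<leftarrow>r # rs. [:- r, 1:]) * Q" by (elim dvdE)
  then have Q: "P = [:- r, 1:] * ((\<Prod>r\<leftarrow>rs. [:- r, 1:]) * Q)"
    by (simp only: list.map prod_list.Cons mult.assoc)
  have root: "poly P r = 0" by (simp add: Q)
  show ?case
  proof (cases j)
    case 0
    then show ?thesis using root by simp
  next
    case (Suc i)
    have "[:- r, 1:] * synthetic_div P r = [:- r, 1:] * ((\<Prod>r\<leftarrow>rs. [:- r, 1:]) * Q)"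
      using synthetic_div_correct'[of r P] root Q by simp
    moreover have "[:- r, 1:] \<noteq> 0" by simp
    ultimately have "synthetic_div P r = (\<Prod>r\<leftarrow>rs. [:- r, 1:]) * Q"
      using mult_left_cancel by blast
    then show ?thesis using Cons Suc by simp
  qed
qed simp

text \<open>When all roots are \<open>0\<close>, the Newton basis is the basis of powers of \<open>t\<close>.\<close>

lemma iterated_quotient_zeros: "poly (iterated_quotient P (replicate j 0)) 0 = coeff P j"
proof (induction j arbitrary: P)
  case 0
  then show ?case by (simp add: poly_0_coeff_0)
next
  case (Suc j)
  have "coeff (synthetic_div P 0) j = coeff (P + Polynomial.smult 0 (synthetic_div P 0)) (Suc j)"
    by (simp only: synthetic_div_correct coeff_pCons_Suc)
  then show ?case using Suc by simp
qed

lemma map_poly_iterated_quotient: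
  fixes h :: "'a::comm_ring_1 \<Rightarrow> 'b::comm_ring_1"
  assumes h: "h 0 = 0" "\<And>a b. h (a + b) = h a + h b" "\<And>a b. h (a * b) = h a * h b"
  shows "h (poly (iterated_quotient P rs) r) = poly (iterated_quotient (map_poly h P) (map h rs)) (h r)"
proof -
  have poly: "h (poly P r) = poly (map_poly h P) (h r)" for P r
    by (induction P) (simp_all add: h map_poly_pCons)
  have "map_poly h (synthetic_div P r) = synthetic_div (map_poly h P) (h r)" for P r
    by (induction P) (simp_all add: h map_poly_pCons poly)
  then show ?thesis by (induction rs arbitrary: P) (simp_all add: poly)
qed

lemma map_poly_prod_linear:
  fixes h :: "'a::comm_ring_1 \<Rightarrow> 'b::comm_ring_1"
  assumes h: "h 0 = 0" "h 1 = 1" "\<And>a b. h (a + b) = h a + h b" "\<And>a b. h (a * b) = h a * h b"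
  assumes "finite S"
  shows "map_poly h (\<Prod>s\<in>S. [:- f s, 1:]) = (\<Prod>s\<in>S. [:- h (f s), 1:])"
  using \<open>finite S\<close>
proof (induction S rule: finite_induct)
  case empty
  then show ?case by (simp add: h map_poly_pCons one_pCons)
next
  case (insert s S)
  have neg: "h (- a) = - h a" for a using h(3)[of a "- a"] h(1) by (simp add: add_eq_0_iff)
  have diff: "h (a - b) = h a - h b" for a b using h(3)[of "a - b" b] by simp
  have "map_poly h ([:- f s, 1:] * P) = [:- h (f s), 1:] * map_poly h P" for P
    by (rule poly_eqI) (simp add: coeff_map_poly h neg diff coeff_pCons split: nat.split)
  then show ?case using insert by simp
qed

text \<open>Divide \<open>\<Prod>\<^bsub>s\<in>S\<^esub>(t - x\<^sub>s)\<close> by \<open>\<Prod>\<^sub>i(t - z\<^sub>i)\<^bsup>\<alpha>\<^sub>i-q\<^esup>\<close>. At a point of \<open>Z\<^sub>\<alpha>\<close> the division is exact: the \<open>q\<close> indices outside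
  \<open>S\<close> can absorb at most \<open>q\<close> of the \<open>\<alpha>\<^sub>i\<close> occurrences of \<open>z\<^sub>i\<close>. For \<open>z = 0\<close> the coefficients of the remainder are
  the low coefficients in \<open>t\<close>.\<close>

lemma tanisaki_lift:
  assumes S: "S \<subseteq> {1..sum_list \<alpha>}" and j: "j < excess \<alpha> (sum_list \<alpha> - card S)"
  shows "\<exists>f :: (nat + nat) mpoly. (\<forall>z x. (block_vec \<alpha> z, x) \<in> Z_variety \<alpha> \<longrightarrow> eval_at (case_sum z x) f = 0) \<and>
    set_z_zero f = monic_coeff S j"
proof -
  let ?n = "sum_list \<alpha>" and ?L = "length \<alpha>"
  define q where "q = ?n - card S"
  have fin: "finite S" using S finite_subset by blast
  define rs where "rs = blocks (\<lambda>i. \<alpha> ! i - q) ?L"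
  have len: "j < length rs" using j by (simp add: rs_def length_blocks excess_def q_def)
  define P :: "(nat + nat) mpoly poly" where "P = (\<Prod>s\<in>S. [:- Var (Inr s), 1:])"
  define f where "f = poly (iterated_quotient P (map (\<lambda>i. Var (Inl i)) (take j rs))) (Var (Inl (rs ! j)))"
  have "eval_at (case_sum z x) f = 0" if Z: "(block_vec \<alpha> z, x) \<in> Z_variety \<alpha>" for z x
  proof -
    obtain p where p: "has_content \<alpha> p" "\<And>s. s \<in> {1..?n} \<Longrightarrow> x s = z (p s)"
      by (rule Z_variety_word[OF Z]) blast
    have "(\<Prod>s\<in>S. [:- x s, 1:]) = (\<Prod>s\<in>S. [:- z (p s), 1:])"
      using p(2) S by (intro prod.cong) auto
    also have "\<dots> = (\<Prod>i\<in>{1..?L}. \<Prod>s\<in>{s \<in> S. p s = i}. [:- z (p s), 1:])"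
      using p(1) S fin by (intro prod.group[symmetric]) (auto simp: has_content_def)
    also have "\<dots> = (\<Prod>i\<in>{1..?L}. [:- z i, 1:] ^ card {s \<in> S. p s = i})" by simp
    finally have 1: "(\<Prod>s\<in>S. [:- x s, 1:]) = (\<Prod>i\<in>{1..?L}. [:- z i, 1:] ^ card {s \<in> S. p s = i})" .
    have "(\<Prod>r\<leftarrow>map z rs. [:- r, 1:]) = (\<Prod>i<?L. [:- z (i + 1), 1:] ^ (\<alpha> ! i - q))"
      unfolding rs_def using prod_list_blocks[of "\<lambda>i. [:- z i, 1:]"] by (simp add: o_def)
    also have "\<dots> = (\<Prod>i\<in>{1..?L}. [:- z i, 1:] ^ (\<alpha> ! (i - 1) - q))"
      by (rule prod.reindex_bij_witness[of _ "\<lambda>i. i - 1" Suc]) auto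
    finally have 2: "(\<Prod>r\<leftarrow>map z rs. [:- r, 1:]) = (\<Prod>i\<in>{1..?L}. [:- z i, 1:] ^ (\<alpha> ! (i - 1) - q))" .
    have "(\<Prod>r\<leftarrow>map z rs. [:- r, 1:]) dvd (\<Prod>s\<in>S. [:- x s, 1:])"
      unfolding 1 2
    proof (intro prod_dvd_prod le_imp_power_dvd)
      fix i assume i: "i \<in> {1..?L}"
      have "\<alpha> ! (i - 1) = card {s \<in> {1..?n}. p s = i}" using p(1) i by (simp add: has_content_def)
      also have "\<dots> \<le> card ({s \<in> S. p s = i} \<union> ({1..?n} - S))"
        using fin by (intro card_mono) auto
      also have "\<dots> \<le> card {s \<in> S. p s = i} + card ({1..?n} - S)" by (rule card_Un_le)
      also have "card ({1..?n} - S) = q" using S fin by (simp add: card_Diff_subset q_def)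
      finally show "\<alpha> ! (i - 1) - q \<le> card {s \<in> S. p s = i}" by simp
    qed
    then have "poly (iterated_quotient (\<Prod>s\<in>S. [:- x s, 1:]) (take j (map z rs))) (map z rs ! j) = 0"
      using len by (intro iterated_quotient_root) auto
    moreover have "map_poly (eval_at (case_sum z x)) P = (\<Prod>s\<in>S. [:- x s, 1:])"
      unfolding P_def using fin eval_at_simps(4)[of "case_sum z x" 1]
      by (subst map_poly_prod_linear) (simp_all add: eval_at_simps Const_hom)
    moreover have "map (eval_at (case_sum z x)) (map (\<lambda>i. Var (Inl i)) (take j rs)) = take j (map z rs)"
      by (simp add: eval_at_simps take_map)
    moreover have "eval_at (case_sum z x) (Var (Inl (rs ! j))) = map z rs ! j"
      using len by (simp add: eval_at_simps)
    ultimately show ?thesis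
      unfolding f_def by (subst map_poly_iterated_quotient) (simp_all add: eval_at_simps)
  qed
  moreover have "set_z_zero f = monic_coeff S j"
  proof -
    have "map_poly set_z_zero P = (\<Prod>s\<in>S. [:- Var s, 1:])"
      unfolding P_def using fin
      by (subst map_poly_prod_linear) (simp_all add: set_z_zero_def substitute_hom)
    moreover have "map set_z_zero (map (\<lambda>i. Var (Inl i)) (take j rs)) = replicate j 0"
      using len by (intro nth_equalityI) (simp_all add: set_z_zero_def substitute_hom)
    moreover have "set_z_zero (Var (Inl (rs ! j))) = 0" by (simp add: set_z_zero_def substitute_hom)
    ultimately show ?thesis
      unfolding f_def monic_coeff_def
      by (subst map_poly_iterated_quotient) (simp_all add: set_z_zero_def substitute_hom iterated_quotient_zeros)
  qed
  ultimately show ?thesis by blast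
qed

definition truncate_vars :: "nat \<Rightarrow> nat mpoly \<Rightarrow> nat mpoly" where
  "truncate_vars n = substitute (\<lambda>j. if j \<in> {1..n} then Var j else 0)"

lemma truncate_vars_hom:
  "truncate_vars n 0 = 0" "truncate_vars n (p + q) = truncate_vars n p + truncate_vars n q"
  "truncate_vars n (p * q) = truncate_vars n p * truncate_vars n q"
  "truncate_vars n (p - q) = truncate_vars n p - truncate_vars n q"
  "truncate_vars n (Const c) = Const c"
  "truncate_vars n (Var j) = (if j \<in> {1..n} then Var j else 0)"
  by (simp_all add: truncate_vars_def substitute_hom)

lemma vars_truncate_vars: "vars (truncate_vars n p) \<subseteq> {1..n}"
  unfolding truncate_vars_def by (rule order.trans[OF vars_substitute]) (auto simp: vars_01 vars_Var split: if_splits)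

lemma truncate_vars_idem: "vars p \<subseteq> {1..n} \<Longrightarrow> truncate_vars n p = p"
proof -
  assume "vars p \<subseteq> {1..n}"
  then have "truncate_vars n p = substitute Var p"
    unfolding truncate_vars_def by (intro insertion_cong) auto
  then show ?thesis by (simp add: substitute_Var)
qed

lemma eval_at_substitute: "eval_at v (substitute f p) = eval_at (\<lambda>i. eval_at v (f i)) p"
  by (induction p rule: mpoly_ring_induct) (simp_all add: substitute_simps eval_at_simps)

text \<open>A way into \<open>I0\<close> without tracking variables: those not occurring among the coordinates may be set to \<open>0\<close>
  first, since the corresponding coordinates of points vanish or do not influence \<open>block_vec\<close>.\<close>

lemma truncate_set_z_zero_in_I0:
  assumes "\<And>z x. (block_vec \<alpha> z, x) \<in> Z_variety \<alpha> \<Longrightarrow> eval_at (case_sum z x) f = 0"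
  shows "truncate_vars (sum_list \<alpha>) (set_z_zero f) \<in> I0 \<alpha>"
proof -
  let ?t = "\<lambda>v. if v \<in> zx_vars \<alpha> then Var v else 0 :: (nat + nat) mpoly"
  let ?f = "substitute ?t f"
  have "vars ?f \<subseteq> zx_vars \<alpha>"
    by (rule order.trans[OF vars_substitute]) (auto simp: vars_01 vars_Var split: if_splits)
  moreover have "eval_at (case_sum z x) ?f = 0" if Z: "(block_vec \<alpha> z, x) \<in> Z_variety \<alpha>" for z x
  proof -
    let ?z = "\<lambda>i. if i \<in> {1..length \<alpha>} then z i else 0"
    have "block_vec \<alpha> ?z j = block_vec \<alpha> z j" for j
    proof (cases "j \<in> {1..sum_list \<alpha>}")
      case True
      then show ?thesis using block_index_has_content[of \<alpha>] by (simp add: block_vec_eq has_content_def)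
    qed (simp add: block_vec_outside del: atLeastAtMost_iff)
    then have "block_vec \<alpha> ?z = block_vec \<alpha> z" by blast
    then have "eval_at (case_sum ?z x) f = 0" using assms[of ?z x] Z by simp
    moreover have "x s = 0" if "s \<notin> {1..sum_list \<alpha>}" for s using Z_variety_word[OF Z] that by metis
    then have "(\<lambda>v. eval_at (case_sum z x) (?t v)) = case_sum ?z x"
      by (auto simp: fun_eq_iff zx_vars_def eval_at_simps image_iff split: sum.split)
    ultimately show ?thesis by (simp add: eval_at_substitute)
  qed
  ultimately have "?f \<in> vanishing_ideal \<alpha>" by (simp add: vanishing_ideal_def mpoly_ring_def)
  moreover have "set_z_zero ?f = truncate_vars (sum_list \<alpha>) (set_z_zero f)"
    unfolding set_z_zero_def truncate_vars_def substitute_substitute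
    by (rule insertion_cong) (auto simp: substitute_hom zx_vars_def split: sum.split)
  ultimately show ?thesis unfolding I0_def by (intro image_eqI[of _ _ ?f]) simp_all
qed

lemma I0_closed:
  "0 \<in> I0 \<alpha>" "p \<in> I0 \<alpha> \<Longrightarrow> q \<in> I0 \<alpha> \<Longrightarrow> p + q \<in> I0 \<alpha>"
  "p \<in> I0 \<alpha> \<Longrightarrow> vars q \<subseteq> {1..sum_list \<alpha>} \<Longrightarrow> q * p \<in> I0 \<alpha>"
proof -
  interpret I: ideal "I0 \<alpha>" "x_ring \<alpha>" by (rule ideal_I0)
  show "0 \<in> I0 \<alpha>" using additive_subgroup.zero_closed[OF I.is_additive_subgroup] by (simp add: mpoly_ring_def)
  show "p \<in> I0 \<alpha> \<Longrightarrow> q \<in> I0 \<alpha> \<Longrightarrow> p + q \<in> I0 \<alpha>"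
    using additive_subgroup.a_closed[OF I.is_additive_subgroup, of p q] by (simp add: mpoly_ring_def)
  show "p \<in> I0 \<alpha> \<Longrightarrow> vars q \<subseteq> {1..sum_list \<alpha>} \<Longrightarrow> q * p \<in> I0 \<alpha>"
    using I.I_l_closed[of p q] by (simp add: mpoly_ring_def)
qed

theorem tanisaki_ideal_I0: "tanisaki_ideal \<alpha> {p. truncate_vars (sum_list \<alpha>) p \<in> I0 \<alpha>}"
  unfolding tanisaki_ideal_def
proof (intro conjI ballI allI impI)
  fix S j assume S: "S \<subseteq> {1..sum_list \<alpha>}" "j < excess \<alpha> (sum_list \<alpha> - card S)"
  then show "monic_coeff S j \<in> {p. truncate_vars (sum_list \<alpha>) p \<in> I0 \<alpha>}"
    using tanisaki_lift[OF S] truncate_set_z_zero_in_I0 by (metis mem_Collect_eq)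
next
  fix p q assume "p \<in> {p. truncate_vars (sum_list \<alpha>) p \<in> I0 \<alpha>}"
  then show "q * p \<in> {p. truncate_vars (sum_list \<alpha>) p \<in> I0 \<alpha>}"
    using I0_closed(3)[of _ \<alpha> "truncate_vars (sum_list \<alpha>) q"] vars_truncate_vars
    by (simp add: truncate_vars_hom)
qed (auto simp: truncate_vars_hom I0_closed)

section \<open>Homogeneous components\<close>

definition mdeg :: "('v \<Rightarrow>\<^sub>0 nat) \<Rightarrow> nat" where
  "mdeg m = (\<Sum>i\<in>Poly_Mapping.keys m. Poly_Mapping.lookup m i)"

lemma mdeg_add: "mdeg (m + m') = mdeg m + mdeg m'"
proof -
  let ?S = "Poly_Mapping.keys m \<union> Poly_Mapping.keys m'"
  have *: "mdeg k = (\<Sum>i\<in>?S. Poly_Mapping.lookup k i)" if "Poly_Mapping.keys k \<subseteq> ?S" for k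
    unfolding mdeg_def using that by (intro sum.mono_neutral_left) (auto simp: in_keys_iff)
  show ?thesis
    using Poly_Mapping.keys_add[of m m'] * [of m] * [of m'] * [of "m + m'"]
    by (simp add: lookup_add sum.distrib)
qed

definition homogeneous :: "nat \<Rightarrow> 'v mpoly \<Rightarrow> bool" where
  "homogeneous d p \<longleftrightarrow> (\<forall>m\<in>Poly_Mapping.keys p. mdeg m = d)"

text \<open>A strict bound, so that \<open>deg_less 0\<close> singles out the zero polynomial.\<close>

definition deg_less :: "nat \<Rightarrow> 'v mpoly \<Rightarrow> bool" where
  "deg_less d p \<longleftrightarrow> (\<forall>m\<in>Poly_Mapping.keys p. mdeg m < d)"

lemma homogeneous_mult: "homogeneous d p \<Longrightarrow> homogeneous e q \<Longrightarrow> homogeneous (d + e) (p * q)"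
  using Poly_Mapping.keys_mult[of p q] by (fastforce simp: homogeneous_def mdeg_add)

lemma homogeneous_add: "homogeneous d p \<Longrightarrow> homogeneous d q \<Longrightarrow> homogeneous d (p + q)"
  using Poly_Mapping.keys_add[of p q] by (fastforce simp: homogeneous_def)

lemma homogeneous_minus: "homogeneous d (- p) \<longleftrightarrow> homogeneous d p"
  by (simp add: homogeneous_def)

lemma homogeneous_simps [simp]:
  "homogeneous d 0" "homogeneous 0 (Const c)" "homogeneous 0 1" "homogeneous (Suc 0) (Var i)"
  by (simp_all add: homogeneous_def Const_def Var_def mdeg_def)

lemma homogeneous_power: "homogeneous d p \<Longrightarrow> homogeneous (k * d) (p ^ k)"
  by (induction k) (simp_all add: homogeneous_mult)

lemma homogeneous_prod:
  "(\<And>i. i \<in> S \<Longrightarrow> homogeneous (d i) (p i)) \<Longrightarrow> homogeneous (sum d S) (prod p S)"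
  by (induction S rule: infinite_finite_induct) (simp_all add: homogeneous_mult)

lemma deg_less_add: "deg_less d p \<Longrightarrow> deg_less d q \<Longrightarrow> deg_less d (p + q)"
  using Poly_Mapping.keys_add[of p q] by (fastforce simp: deg_less_def)

lemma deg_less_0 [simp]: "deg_less d 0"
  by (simp add: deg_less_def)

lemma deg_less_mult_homogeneous: "deg_less d p \<Longrightarrow> homogeneous e q \<Longrightarrow> deg_less (d + e) (p * q)"
  using Poly_Mapping.keys_mult[of p q] by (fastforce simp: homogeneous_def deg_less_def mdeg_add)

lemma deg_less_mult: "deg_less d p \<Longrightarrow> deg_less e q \<Longrightarrow> deg_less (d + e) (p * q)"
  using Poly_Mapping.keys_mult[of p q] by (fastforce simp: deg_less_def mdeg_add)

definition hom_component :: "nat \<Rightarrow> 'v mpoly \<Rightarrow> 'v mpoly" where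
  "hom_component e p = (\<Sum>m | m \<in> Poly_Mapping.keys p \<and> mdeg m = e. Poly_Mapping.single m (Poly_Mapping.lookup p m))"

lemma lookup_hom_component: "Poly_Mapping.lookup (hom_component e p) m = (if mdeg m = e then Poly_Mapping.lookup p m else 0)"
proof -
  have "Poly_Mapping.lookup (hom_component e p) m =
      (\<Sum>k | k \<in> Poly_Mapping.keys p \<and> mdeg k = e. if k = m then Poly_Mapping.lookup p k else 0)"
    unfolding hom_component_def lookup_sum by (intro sum.cong) (auto simp: lookup_single when_def)
  also have "\<dots> = (if mdeg m = e then Poly_Mapping.lookup p m else 0)"
    by (simp add: sum.delta' in_keys_iff)
  finally show ?thesis .
qed

lemma lookup_Const_mult: "Poly_Mapping.lookup (Const c * p) m = c * Poly_Mapping.lookup p m"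
proof (induction p rule: mpoly_induct)
  case (single k d)
  then show ?case by (simp add: Const_def Poly_Mapping.mult_single lookup_single when_def)
qed (simp add: distrib_left lookup_add)

lemma hom_component_add: "hom_component e (p + q) = hom_component e p + hom_component e q"
  by (rule poly_mapping_eqI) (simp add: lookup_hom_component lookup_add)

lemma hom_component_diff: "hom_component e (p - q) = hom_component e p - hom_component e q"
  by (rule poly_mapping_eqI) (simp add: lookup_hom_component lookup_minus)

lemma hom_component_Const_mult: "hom_component e (Const c * p) = Const c * hom_component e p"
  by (rule poly_mapping_eqI) (simp add: lookup_hom_component lookup_Const_mult)

lemma hom_component_homogeneous: "homogeneous d p \<Longrightarrow> hom_component e p = (if e = d then p else 0)"
  by (rule poly_mapping_eqI) (auto simp: lookup_hom_component homogeneous_def in_keys_iff)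

lemma homogeneous_hom_component: "homogeneous e (hom_component e p)"
  by (auto simp: homogeneous_def in_keys_iff lookup_hom_component split: if_splits)

lemma deg_less_iff_hom_component: "deg_less e p \<longleftrightarrow> (\<forall>d\<ge>e. hom_component d p = 0)"
proof
  assume *: "deg_less e p"
  show "\<forall>d\<ge>e. hom_component d p = 0"
  proof (intro allI impI poly_mapping_eqI)
    fix d m assume "e \<le> d"
    then have "mdeg m = d \<Longrightarrow> m \<notin> Poly_Mapping.keys p" using * by (auto simp: deg_less_def)
    then show "Poly_Mapping.lookup (hom_component d p) m = Poly_Mapping.lookup 0 m"
      by (auto simp: lookup_hom_component in_keys_iff)
  qed
next
  assume *: "\<forall>d\<ge>e. hom_component d p = 0"
  show "deg_less e p"
    unfolding deg_less_def
  proof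
    fix m assume "m \<in> Poly_Mapping.keys p"
    then have "Poly_Mapping.lookup (hom_component (mdeg m) p) m \<noteq> 0" by (simp add: lookup_hom_component in_keys_iff)
    then show "mdeg m < e" using * by (metis linorder_not_less lookup_zero)
  qed
qed

lemma deg_less_Suc_diff: "deg_less (Suc e) p \<Longrightarrow> deg_less e (p - hom_component e p)"
  unfolding deg_less_iff_hom_component
  by (simp add: hom_component_diff hom_component_homogeneous[OF homogeneous_hom_component] Suc_le_eq)

lemma deg_less_exists: "\<exists>e. deg_less e p"
proof
  show "deg_less (Suc (Max (mdeg ` Poly_Mapping.keys p))) p"
    by (auto simp: deg_less_def less_Suc_eq_le)
qed

lemma hom_component_mult_homogeneous:
  assumes l: "homogeneous d l"
  shows "hom_component (d + e) (l * p) = l * hom_component e p"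
proof (induction p rule: mpoly_induct)
  case (single m c)
  have m: "homogeneous (mdeg m) (Poly_Mapping.single m c)" by (simp add: homogeneous_def)
  show ?case using hom_component_homogeneous[OF homogeneous_mult[OF l m], of "d + e"] hom_component_homogeneous[OF m, of e]
    by auto
qed (simp add: distrib_left hom_component_add)

text \<open>Induction over monomials with the degree as a parameter: a property that is multiplicative in pairs of degree and
  polynomial holds for every monomial in a degree in which
  it is homogeneous.\<close>

lemma homogeneous_single_cases:
  assumes "\<And>c. Q 0 (Const c)" "\<And>i. Q 1 (Var i)"
    "\<And>d e p q. homogeneous d p \<Longrightarrow> homogeneous e q \<Longrightarrow> Q d p \<Longrightarrow> Q e q \<Longrightarrow> Q (d + e) (p * q)"
  shows "\<exists>d. homogeneous d (Poly_Mapping.single m c) \<and> Q d (Poly_Mapping.single m c :: 'v mpoly)"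
proof (induction m c rule: single_induct)
  case (Const c)
  then show ?case using assms(1) by (intro exI[of _ 0]) simp
next
  case (Var i)
  then show ?case using assms(2) by (intro exI[of _ 1]) simp
next
  case (mult p q)
  then show ?case using assms(3) homogeneous_mult by blast
qed

lemma hom_component_substitute:
  assumes f: "\<And>i. homogeneous 1 (f i)"
  shows "hom_component e (substitute f p) = substitute f (hom_component e p)"
proof (induction p rule: mpoly_induct)
  case (single m c)
  have "\<exists>d. homogeneous d (Poly_Mapping.single m c) \<and> homogeneous d (substitute f (Poly_Mapping.single m c))"
    by (rule homogeneous_single_cases) (use f in \<open>simp_all add: substitute_hom homogeneous_mult\<close>)
  then obtain d where "homogeneous d (Poly_Mapping.single m c)"
    "homogeneous d (substitute f (Poly_Mapping.single m c))" by blast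
  then show ?case by (simp add: hom_component_homogeneous substitute_hom)
qed (simp add: hom_component_add substitute_hom)

text \<open>Taking components of \<open>(x\<^sub>i - x\<^bsub>i+1\<^esub>) \<partial>\<^sub>i f = f - s\<^sub>i f\<close> shows that only the component of degree \<open>d - 1\<close> of \<open>\<partial>\<^sub>i f\<close> can
  be nonzero.\<close>

lemma homogeneous_divdiff:
  assumes f: "homogeneous d f"
  shows "homogeneous (d - 1) (divdiff i f)"
  unfolding homogeneous_def
proof
  let ?l = "Var i - Var (i + 1) :: nat mpoly"
  fix m assume "m \<in> Poly_Mapping.keys (divdiff i f)"
  then have "Poly_Mapping.lookup (hom_component (mdeg m) (divdiff i f)) m \<noteq> 0"
    by (simp add: lookup_hom_component in_keys_iff)
  then have nonzero: "hom_component (mdeg m) (divdiff i f) \<noteq> 0" by auto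
  have l: "homogeneous 1 ?l"
    using homogeneous_add[of 1 "Var i" "- Var (i + 1)"] by (simp add: homogeneous_minus)
  have "?l * hom_component (mdeg m) (divdiff i f) = hom_component (1 + mdeg m) (f - swap_vars i f)"
    using hom_component_mult_homogeneous[OF l, of "mdeg m" "divdiff i f"] divided_difference[of i f] by simp
  also have "\<dots> = hom_component (1 + mdeg m) f - swap_vars i (hom_component (1 + mdeg m) f)"
    unfolding swap_vars_def by (subst hom_component_substitute[symmetric]) (simp_all add: hom_component_diff)
  finally have "hom_component (1 + mdeg m) f \<noteq> 0"
    using nonzero Var_diff_nonzero[of i "i + 1"] by (auto simp: swap_vars_hom)
  then have "1 + mdeg m = d" using hom_component_homogeneous[OF f, of "1 + mdeg m"] by (simp split: if_splits)
  then show "mdeg m = d - 1" by simp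
qed

lemma schubert_homogeneous:
  assumes "w permutes {1..n}"
  shows "\<exists>d. homogeneous d (schubert n w)"
proof -
  have "\<exists>d. homogeneous d f" if "is_schubert n w f" for f
    using that
  proof (induction rule: is_schubert.induct)
    case longest
    have "homogeneous (\<Sum>i = 1..n. (n - i) * 1) (\<Prod>i = 1..n. Var i ^ (n - i))"
      by (intro homogeneous_prod homogeneous_power) simp
    then show ?case by blast
  qed (use homogeneous_divdiff in blast)
  then show ?thesis using is_schubert_schubert[OF assms] by blast
qed

lemma truncate_vars_swap_vars:
  "1 \<le> i \<Longrightarrow> i < n \<Longrightarrow> truncate_vars n (swap_vars i p) = swap_vars i (truncate_vars n p)"
  unfolding truncate_vars_def swap_vars_def substitute_substitute
  by (rule insertion_cong) (auto simp: substitute_hom Transposition.transpose_def)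

lemma truncate_vars_divdiff:
  assumes i: "1 \<le> i" "i < n" and f: "truncate_vars n f = f"
  shows "truncate_vars n (divdiff i f) = divdiff i f"
proof -
  have "truncate_vars n ((Var i - Var (i + 1)) * divdiff i f) = truncate_vars n (f - swap_vars i f)"
    by (simp only: divided_difference)
  then have "(Var i - Var (i + 1)) * truncate_vars n (divdiff i f) = f - swap_vars i f"
    using i by (simp add: truncate_vars_hom truncate_vars_swap_vars f)
  then show ?thesis by (metis divdiff_eqI)
qed

lemma truncate_vars_schubert:
  assumes "w permutes {1..n}"
  shows "truncate_vars n (schubert n w) = schubert n w"
proof -
  have "truncate_vars n f = f" if "is_schubert n w f" for f
    using that
  proof (induction rule: is_schubert.induct)
    case longest
    then show ?case
      unfolding truncate_vars_def substitute_prod by (intro prod.cong) (simp_all add: substitute_hom)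
  qed (simp add: truncate_vars_divdiff)
  then show ?thesis using is_schubert_schubert[OF assms] by blast
qed

section \<open>The vanishing ideal is homogeneous\<close>

text \<open>On the line through \<open>v\<close>, the homogeneous components are read off as coefficients of a polynomial in the
  scaling parameter.\<close>

lemma eval_at_scaled:
  "\<exists>q. (\<forall>t. poly q t = eval_at (\<lambda>i. t * v i) p) \<and> (\<forall>e. coeff q e = eval_at v (hom_component e p))"
proof (induction p rule: mpoly_induct)
  case (single m c)
  have "eval_at (\<lambda>i. t * v i) (Poly_Mapping.single m c) = eval_at v (Poly_Mapping.single m c) * t ^ mdeg m" for t
    by (simp add: insertion_single power_mult_distrib prod.distrib mdeg_def power_sum)
  moreover have "hom_component e (Poly_Mapping.single m c) = (if e = mdeg m then Poly_Mapping.single m c else 0)" for e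
    by (rule hom_component_homogeneous) (simp add: homogeneous_def)
  ultimately show ?case
    by (intro exI[of _ "monom (eval_at v (Poly_Mapping.single m c)) (mdeg m)"])
      (auto simp: poly_monom eval_at_simps)
next
  case (add p q)
  then obtain a b where "\<forall>t. poly a t = eval_at (\<lambda>i. t * v i) p" "\<forall>e. coeff a e = eval_at v (hom_component e p)"
    "\<forall>t. poly b t = eval_at (\<lambda>i. t * v i) q" "\<forall>e. coeff b e = eval_at v (hom_component e q)" by blast
  then show ?case by (intro exI[of _ "a + b"]) (simp add: eval_at_simps hom_component_add)
qed

lemma Z_variety_scale:
  assumes "(block_vec \<alpha> z, x) \<in> Z_variety \<alpha>"
  shows "(block_vec \<alpha> (\<lambda>i. t * z i), \<lambda>s. t * x s) \<in> Z_variety \<alpha>"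
proof -
  have scale: "block_vec \<alpha> (\<lambda>i. t * z i) = (\<lambda>j. t * block_vec \<alpha> z j)"
  proof
    fix j show "block_vec \<alpha> (\<lambda>i. t * z i) j = t * block_vec \<alpha> z j"
      by (cases "j \<in> {1..sum_list \<alpha>}") (simp_all add: block_vec_eq block_vec_outside del: atLeastAtMost_iff)
  qed
  obtain w where w: "block_vec \<alpha> z \<in> s_space \<alpha>" "w permutes {1..sum_list \<alpha>}" "x = perm_act w (block_vec \<alpha> z)"
    using assms by (auto simp: Z_variety_def)
  have "(\<lambda>j. t * block_vec \<alpha> z j) \<in> t_space (sum_list \<alpha>)"
    using w(1) by (simp add: s_space_def t_space_def flip: sum_distrib_left)
  then have "block_vec \<alpha> (\<lambda>i. t * z i) \<in> s_space \<alpha>" unfolding s_space_def scale[symmetric] by blast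
  moreover have "(\<lambda>s. t * x s) = perm_act w (block_vec \<alpha> (\<lambda>i. t * z i))"
    unfolding scale w(3) by (simp add: perm_act_def)
  ultimately show ?thesis unfolding Z_variety_def using w(2) by blast
qed

text \<open>\<open>Z\<^sub>\<alpha>\<close> is a cone, so the polynomial in the scaling parameter vanishes identically.\<close>

lemma vanishing_ideal_hom_component:
  assumes f: "f \<in> vanishing_ideal \<alpha>" and Z: "(block_vec \<alpha> z, x) \<in> Z_variety \<alpha>"
  shows "eval_at (case_sum z x) (hom_component e f) = 0"
proof -
  obtain q where q: "\<forall>t. poly q t = eval_at (\<lambda>i. t * case_sum z x i) f"
    "\<forall>e. coeff q e = eval_at (case_sum z x) (hom_component e f)" using eval_at_scaled by blast
  have "poly q t = 0" for t
  proof -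
    have "(\<lambda>i. t * case_sum z x i) = case_sum (\<lambda>i. t * z i) (\<lambda>s. t * x s)"
      by (auto simp: fun_eq_iff split: sum.split)
    then show ?thesis using q(1) f Z_variety_scale[OF Z, of t] by (simp add: vanishing_ideal_def)
  qed
  then have "q = 0" using poly_all_0_iff_0 by blast
  then show ?thesis using q(2) by (metis coeff_0)
qed

definition specialize_z :: "(nat \<Rightarrow> complex) \<Rightarrow> (nat + nat) mpoly \<Rightarrow> nat mpoly" where
  "specialize_z z = substitute (case_sum (\<lambda>i. Const (z i)) Var)"

text \<open>A monomial that involves some \<open>z\<^sub>i\<close> loses degree when \<open>z\<close> is replaced by constants, and becomes \<open>0\<close> under
  \<open>z = 0\<close>; the other monomials are the same in both cases.\<close>

lemma deg_less_set_z_zero_diff: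
  "homogeneous e f \<Longrightarrow> deg_less e (set_z_zero f - specialize_z z f)"
proof -
  let ?Q = "\<lambda>d f. homogeneous d (set_z_zero f) \<and> deg_less d (set_z_zero f - specialize_z z f)"
  have hom: "set_z_zero (p * q) = set_z_zero p * set_z_zero q" "set_z_zero (p + q) = set_z_zero p + set_z_zero q"
    "specialize_z z (p * q) = specialize_z z p * specialize_z z q"
    "specialize_z z (p + q) = specialize_z z p + specialize_z z q" for p q
    by (simp_all add: set_z_zero_def specialize_z_def substitute_hom)
  have monomial: "\<exists>d. homogeneous d (Poly_Mapping.single m c) \<and> ?Q d (Poly_Mapping.single m c)" for m c
  proof (rule homogeneous_single_cases)
    fix i :: "nat + nat"
    show "?Q 1 (Var i)"
      by (cases i) (simp_all add: set_z_zero_def specialize_z_def substitute_hom deg_less_def Const_def mdeg_def)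
  next
    fix d e and p q :: "(nat + nat) mpoly"
    assume p: "?Q d p" and q: "?Q e q"
    let ?sp = "set_z_zero p" and ?sq = "set_z_zero q" and ?dp = "set_z_zero p - specialize_z z p"
      and ?dq = "set_z_zero q - specialize_z z q"
    have "deg_less (d + e) (?dp * ?sq)" using p q deg_less_mult_homogeneous by blast
    moreover have "deg_less (d + e) (?dq * ?sp)"
      using p q deg_less_mult_homogeneous[of e ?dq d ?sp] by (simp add: add.commute)
    moreover have "deg_less (d + e) (- (?dp * ?dq))"
      using p q deg_less_mult[of d ?dp e ?dq] by (simp add: deg_less_def)
    ultimately have "deg_less (d + e) (?dp * ?sq + ?dq * ?sp + - (?dp * ?dq))"
      by (intro deg_less_add)
    also have "?dp * ?sq + ?dq * ?sp + - (?dp * ?dq) = set_z_zero (p * q) - specialize_z z (p * q)"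
      by (simp add: hom algebra_simps)
    finally show "?Q (d + e) (p * q)" using p q by (simp add: hom homogeneous_mult)
  qed (simp add: set_z_zero_def specialize_z_def substitute_hom)
  have "deg_less e (set_z_zero (hom_component e f) - specialize_z z (hom_component e f))" for f
  proof (induction f rule: mpoly_induct)
    case (single m c)
    obtain d where "homogeneous d (Poly_Mapping.single m c)"
      "deg_less d (set_z_zero (Poly_Mapping.single m c) - specialize_z z (Poly_Mapping.single m c))"
      using monomial by blast
    then show ?case by (simp add: hom_component_homogeneous set_z_zero_def specialize_z_def insertion_zero)
  next
    case (add p q)
    then show ?case using deg_less_add by (fastforce simp: hom_component_add hom algebra_simps)
  qed
  then show "homogeneous e f \<Longrightarrow> ?thesis" by (metis hom_component_homogeneous)
qed

section \<open>Lower bound for the dimension\<close>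

text \<open>A homogeneous linear system with fewer equations than unknowns has a nonzero solution; one unknown is
  eliminated at a time.\<close>

lemma exists_nonzero_annihilator:
  fixes B :: "('p \<Rightarrow> complex) set"
  assumes "finite P" "finite B" "card B < card P"
  shows "\<exists>l. (\<exists>x\<in>P. l x \<noteq> 0) \<and> (\<forall>b\<in>B. (\<Sum>x\<in>P. l x * b x) = 0)"
  using assms
proof (induction "card B" arbitrary: B P rule: less_induct)
  case less
  show ?case
  proof (cases "B = {}")
    case True
    have "P \<noteq> {}" using less.prems by auto
    then show ?thesis using True by (intro exI[of _ "\<lambda>_. 1"]) auto
  next
    case False
    then obtain b where b: "b \<in> B" by blast
    have card: "card (B - {b}) < card B" using b less.prems(2) by (meson card_Diff1_less)
    show ?thesis
    proof (cases "\<forall>x\<in>P. b x = 0")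
      case True
      have "\<exists>l. (\<exists>x\<in>P. l x \<noteq> 0) \<and> (\<forall>c\<in>B - {b}. (\<Sum>x\<in>P. l x * c x) = 0)"
        using card less.prems by (intro less.hyps) auto
      then obtain l where l: "\<exists>x\<in>P. l x \<noteq> 0" "\<forall>c\<in>B - {b}. (\<Sum>x\<in>P. l x * c x) = 0" by blast
      have "(\<Sum>x\<in>P. l x * c x) = 0" if "c \<in> B" for c
      proof (cases "c = b")
        case True
        then show ?thesis using \<open>\<forall>x\<in>P. b x = 0\<close> by (intro sum.neutral) simp
      qed (use l(2) that in simp)
      then show ?thesis using l(1) by blast
    next
      case False
      then obtain y where y: "y \<in> P" "b y \<noteq> 0" by blast
      \<comment> \<open>eliminate the coefficient at \<open>y\<close> from the other equations\<close>
      define e where "e c x = c x - c y * b x / b y" for c x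
      let ?B = "e ` (B - {b})" and ?P = "P - {y}"
      have cB: "card ?B < card B" using card card_image_le[of "B - {b}" e] less.prems(2) by simp
      have "0 < card B" using b less.prems(2) by (auto simp: card_gt_0_iff)
      then have "card (B - {b}) < card ?P" using less.prems b y by (simp add: card_Diff_singleton)
      then have "card ?B < card ?P" using card_image_le[of "B - {b}" e] less.prems(2) by simp
      then obtain l where l: "\<exists>x\<in>?P. l x \<noteq> 0" "\<forall>c\<in>?B. (\<Sum>x\<in>?P. l x * c x) = 0"
        using less.hyps[OF cB, of ?P] less.prems by auto
      define s where "s = (\<Sum>x\<in>?P. l x * b x)"
      let ?l = "l(y := - s / b y)"
      have sum: "(\<Sum>x\<in>P. ?l x * c x) = - s / b y * c y + (\<Sum>x\<in>?P. l x * c x)" for c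
        using less.prems(1) y by (simp add: sum.remove[of P y])
      have "(\<Sum>x\<in>P. ?l x * c x) = 0" if c: "c \<in> B" for c
      proof (cases "c = b")
        case True
        then show ?thesis unfolding sum using y by (simp add: s_def)
      next
        case False
        have "(\<Sum>x\<in>?P. l x * c x) = (\<Sum>x\<in>?P. l x * e c x + c y / b y * (l x * b x))"
          by (intro sum.cong) (simp_all add: e_def algebra_simps)
        also have "\<dots> = (\<Sum>x\<in>?P. l x * e c x) + c y / b y * s"
          by (simp add: sum.distrib s_def sum_distrib_left)
        also have "(\<Sum>x\<in>?P. l x * e c x) = 0" using l(2) c False by blast
        finally show ?thesis unfolding sum by simp
      qed
      moreover have "\<exists>x\<in>P. ?l x \<noteq> 0" using l(1) by auto
      ultimately show ?thesis by blast
    qed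
  qed
qed

lemma eval_at_diff: "eval_at v (p - q) = eval_at v p - eval_at v q"
  using eval_at_simps(2)[of v "p - q" q] by simp

lemma eval_at_prod: "eval_at v (prod f S) = (\<Prod>i\<in>S. eval_at v (f i))"
  using eval_at_simps(4)[of v 1]
  by (induction S rule: infinite_finite_induct) (simp_all add: eval_at_simps Const_hom)

lemma separating_polynomial:
  assumes "finite P"
  shows "\<exists>q. eval_at x0 q \<noteq> 0 \<and> (\<forall>x\<in>P - {x0}. eval_at x q = 0)"
proof -
  have "\<exists>i. x i \<noteq> x0 i" if "x \<noteq> x0" for x using that by auto
  then obtain i where i: "\<And>x. x \<noteq> x0 \<Longrightarrow> x (i x) \<noteq> x0 (i x)" by metis
  define q where "q = (\<Prod>x\<in>P - {x0}. Var (i x) - Const (x (i x)))"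
  have eval: "eval_at v q = (\<Prod>x\<in>P - {x0}. v (i x) - x (i x))" for v
    by (simp add: q_def eval_at_prod eval_at_diff eval_at_simps)
  have "eval_at x0 q \<noteq> 0" using assms i by (auto simp: eval) (metis i)
  moreover have "eval_at x q = 0" if "x \<in> P - {x0}" for x
    unfolding eval using assms that by (intro prod_zero) auto
  ultimately show ?thesis by blast
qed

definition orbit :: "nat list \<Rightarrow> (nat \<Rightarrow> complex) \<Rightarrow> (nat \<Rightarrow> complex) set" where
  "orbit \<alpha> z = {x. (block_vec \<alpha> z, x) \<in> Z_variety \<alpha>}"

lemma finite_orbit: "finite (orbit \<alpha> z)"
proof -
  have "orbit \<alpha> z \<subseteq> (\<lambda>w. perm_act w (block_vec \<alpha> z)) ` {w. w permutes {1..sum_list \<alpha>}}"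
    by (auto simp: orbit_def Z_variety_def)
  then show ?thesis using finite_permutations finite_subset by blast
qed

lemma eval_at_truncate_vars:
  assumes "x \<in> orbit \<alpha> z"
  shows "eval_at x (truncate_vars (sum_list \<alpha>) p) = eval_at x p"
proof -
  have "x s = 0" if "s \<notin> {1..sum_list \<alpha>}" for s
    using Z_variety_word[of \<alpha> z x] assms that unfolding orbit_def by blast
  then have "(\<lambda>s. eval_at x (if s \<in> {1..sum_list \<alpha>} then Var s else 0)) = x"
    by (auto simp: fun_eq_iff eval_at_simps)
  then show ?thesis by (simp add: truncate_vars_def eval_at_substitute)
qed

lemma deg_less_truncate_vars: "deg_less e p \<Longrightarrow> deg_less e (truncate_vars n p)"
  unfolding deg_less_iff_hom_component truncate_vars_def
  by (subst hom_component_substitute) (auto simp: substitute_hom)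

text \<open>The condition \<open>gen\<close> says that \<open>B\<close> spans modulo \<open>I0\<close>. With fewer generators than points of the orbit, some nonzero
  functional \<open>l\<close> on the functions on the orbit kills all of \<open>B\<close>. Its kernel \<open>U\<close> contains \<open>f(h, x)\<close> for every \<open>f\<close> in the
  vanishing ideal, and \<open>f(h, x)\<close> has the leading form \<open>f(0, x)\<close> when \<open>f\<close> is homogeneous. So every homogeneous
  polynomial is congruent to an element of \<open>U\<close> modulo lower degree, whence \<open>U\<close> is everything, although
  polynomials separate the points.\<close>

theorem card_orbit_le_card_homogeneous_generators:
  assumes B: "finite B" "\<And>b. b \<in> B \<Longrightarrow> \<exists>d. homogeneous d b"
      "\<And>b. b \<in> B \<Longrightarrow> truncate_vars (sum_list \<alpha>) b = b"
    and gen: "\<And>V. (\<And>p q. p \<in> V \<Longrightarrow> q \<in> V \<Longrightarrow> p + q \<in> V) \<Longrightarrow> (\<And>c p. p \<in> V \<Longrightarrow> Const c * p \<in> V) \<Longrightarrow>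
      {p. truncate_vars (sum_list \<alpha>) p \<in> I0 \<alpha>} \<subseteq> V \<Longrightarrow> B \<subseteq> V \<Longrightarrow> V = UNIV"
  shows "card (orbit \<alpha> z) \<le> card B"
proof (rule ccontr)
  let ?P = "orbit \<alpha> z" and ?t = "truncate_vars (sum_list \<alpha>)"
  assume "\<not> card ?P \<le> card B"
  then have "card ((\<lambda>b x. eval_at x b) ` B) < card ?P" using card_image_le[OF B(1), of "\<lambda>b x. eval_at x b"] by linarith
  then obtain l where l: "\<exists>x\<in>?P. l x \<noteq> 0" "\<forall>b\<in>B. (\<Sum>x\<in>?P. l x * eval_at x b) = 0"
    using exists_nonzero_annihilator[OF finite_orbit, of "(\<lambda>b x. eval_at x b) ` B" \<alpha> z] B(1) by auto
  define U where "U = {p. (\<Sum>x\<in>?P. l x * eval_at x p) = 0}"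
  have U_add: "p + q \<in> U" if "p \<in> U" "q \<in> U" for p q
    using that by (simp add: U_def eval_at_simps distrib_left sum.distrib)
  have U_scale: "Const c * p \<in> U" if "p \<in> U" for c p
    using that by (simp add: U_def eval_at_simps mult.left_commute[of _ c] flip: sum_distrib_left)
  have U_vanish: "p \<in> U" if "\<And>x. x \<in> ?P \<Longrightarrow> eval_at x p = 0" for p
    using that by (simp add: U_def)
  have U_truncate: "p \<in> U" if "?t p \<in> U" for p
    using that by (simp add: U_def eval_at_truncate_vars)
  \<comment> \<open>polynomials whose truncation has all homogeneous components in \<open>U\<close> modulo lower degree\<close>
  define D where "D = {p. \<forall>e. \<exists>u\<in>U. deg_less e (hom_component e (?t p) - u)}"
  have "D = UNIV"
  proof (rule gen)
    fix p q assume p: "p \<in> D" and q: "q \<in> D"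
    show "p + q \<in> D"
      unfolding D_def
    proof (intro CollectI allI)
      fix e
      obtain u v where uv: "u \<in> U" "deg_less e (hom_component e (?t p) - u)"
        "v \<in> U" "deg_less e (hom_component e (?t q) - v)"
        using p q unfolding D_def by blast
      have "hom_component e (?t (p + q)) - (u + v) = (hom_component e (?t p) - u) + (hom_component e (?t q) - v)"
        by (simp add: truncate_vars_hom hom_component_add)
      then have "deg_less e (hom_component e (?t (p + q)) - (u + v))" using deg_less_add[OF uv(2,4)] by metis
      then show "\<exists>u\<in>U. deg_less e (hom_component e (?t (p + q)) - u)" using U_add[OF uv(1,3)] by blast
    qed
  next
    fix c p assume p: "p \<in> D"
    show "Const c * p \<in> D"
      unfolding D_def
    proof (intro CollectI allI)
      fix e
      obtain u where u: "u \<in> U" "deg_less e (hom_component e (?t p) - u)" using p unfolding D_def by blast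
      have "hom_component e (?t (Const c * p)) - Const c * u = (hom_component e (?t p) - u) * Const c"
        by (simp add: truncate_vars_hom hom_component_Const_mult algebra_simps)
      then have "deg_less e (hom_component e (?t (Const c * p)) - Const c * u)"
        using deg_less_mult_homogeneous[OF u(2), of 0 "Const c"] by simp
      then show "\<exists>u\<in>U. deg_less e (hom_component e (?t (Const c * p)) - u)" using U_scale[OF u(1)] by blast
    qed
  next
    show "{p. ?t p \<in> I0 \<alpha>} \<subseteq> D"
      unfolding D_def
    proof (intro subsetI CollectI allI)
      fix p e assume "p \<in> {p. ?t p \<in> I0 \<alpha>}"
      then obtain f where f: "f \<in> vanishing_ideal \<alpha>" "?t p = set_z_zero f" by (auto simp: I0_def)
      have "eval_at x (specialize_z z (hom_component e f)) = 0" if "x \<in> ?P" for x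
      proof -
        have "(\<lambda>i. eval_at x (case_sum (\<lambda>i. Const (z i)) Var i)) = case_sum z x"
          by (auto simp: fun_eq_iff eval_at_simps split: sum.split)
        then show ?thesis
          using vanishing_ideal_hom_component[OF f(1)] that by (simp add: specialize_z_def eval_at_substitute orbit_def)
      qed
      then have "specialize_z z (hom_component e f) \<in> U" by (rule U_vanish)
      moreover have "hom_component e (?t p) = set_z_zero (hom_component e f)"
        unfolding f(2) set_z_zero_def by (rule hom_component_substitute) (simp split: sum.split)
      ultimately show "\<exists>u\<in>U. deg_less e (hom_component e (?t p) - u)"
        using deg_less_set_z_zero_diff[OF homogeneous_hom_component] by metis
    qed
  next
    show "B \<subseteq> D"
      unfolding D_def
    proof (intro subsetI CollectI allI)
      fix b e assume b: "b \<in> B"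
      obtain d where "homogeneous d b" using B(2)[OF b] by blast
      then have "hom_component e (?t b) = b \<or> hom_component e (?t b) = 0" using B(3)[OF b] hom_component_homogeneous by metis
      moreover have "b \<in> U" "0 \<in> U" using l(2) b by (simp_all add: U_def eval_at_simps)
      ultimately show "\<exists>u\<in>U. deg_less e (hom_component e (?t b) - u)" by force
    qed
  qed
  have "p \<in> U" if "deg_less e p" for e p
    using that
  proof (induction e arbitrary: p)
    case 0
    then have "p = 0" by (simp add: deg_less_def)
    then show ?case by (simp add: U_def eval_at_simps)
  next
    case (Suc e)
    obtain u where u: "u \<in> U" "deg_less e (hom_component e (?t p) - u)" using \<open>D = UNIV\<close> unfolding D_def by blast
    have "?t p - hom_component e (?t p) \<in> U"
      using Suc.IH[OF deg_less_Suc_diff[OF deg_less_truncate_vars[OF Suc.prems]]] .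
    then have "(?t p - hom_component e (?t p)) + ((hom_component e (?t p) - u) + u) \<in> U"
      using Suc.IH[OF u(2)] u(1) by (intro U_add)
    then show ?case using U_truncate by simp
  qed
  then have all: "p \<in> U" for p using deg_less_exists by blast
  obtain x0 where x0: "x0 \<in> ?P" "l x0 \<noteq> 0" using l(1) by blast
  obtain q where q: "eval_at x0 q \<noteq> 0" "\<forall>x\<in>?P - {x0}. eval_at x q = 0"
    using separating_polynomial[OF finite_orbit] by blast
  have "(\<Sum>x\<in>?P. l x * eval_at x q) = l x0 * eval_at x0 q"
    using q(2) by (simp add: sum.remove[OF finite_orbit x0(1)])
  then show False using all[of q] q(1) x0(2) by (simp add: U_def)
qed

section \<open>Counting fillings\<close>

definition filling_word :: "nat list \<Rightarrow> (nat \<times> nat \<Rightarrow> nat) \<Rightarrow> nat \<Rightarrow> nat" where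
  "filling_word \<alpha> \<Upsilon> s = fst (inv_into (diagram \<alpha>) \<Upsilon> s)"

lemma RSCT_row_set:
  assumes \<Upsilon>: "\<Upsilon> \<in> RSCT \<alpha>" and i: "i \<in> {1..length \<alpha>}"
  shows "{s \<in> {1..sum_list \<alpha>}. filling_word \<alpha> \<Upsilon> s = i} = (\<lambda>c. \<Upsilon> (i, c)) ` {1..\<alpha> ! (i - 1)}"
proof -
  have inj: "inj_on \<Upsilon> (diagram \<alpha>)" and img: "\<Upsilon> ` diagram \<alpha> = {1..sum_list \<alpha>}"
    using \<Upsilon> by (auto simp: RSCT_def bij_betw_def)
  have word: "filling_word \<alpha> \<Upsilon> (\<Upsilon> x) = fst x" if "x \<in> diagram \<alpha>" for x
    using inv_into_f_f[OF inj that] by (simp add: filling_word_def)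
  show ?thesis
  proof (intro equalityI subsetI)
    fix s assume s: "s \<in> {s \<in> {1..sum_list \<alpha>}. filling_word \<alpha> \<Upsilon> s = i}"
    then have "s \<in> \<Upsilon> ` diagram \<alpha>" using img by simp
    then obtain r c where rc: "(r, c) \<in> diagram \<alpha>" "s = \<Upsilon> (r, c)" by auto
    then have "r = i" using s word by fastforce
    then show "s \<in> (\<lambda>c. \<Upsilon> (i, c)) ` {1..\<alpha> ! (i - 1)}" using rc by (auto simp: diagram_def)
  next
    fix s assume "s \<in> (\<lambda>c. \<Upsilon> (i, c)) ` {1..\<alpha> ! (i - 1)}"
    then obtain c where c: "s = \<Upsilon> (i, c)" "c \<in> {1..\<alpha> ! (i - 1)}" by blast
    have "(i, c) \<in> diagram \<alpha>" using c i by (simp add: diagram_def)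
    then show "s \<in> {s \<in> {1..sum_list \<alpha>}. filling_word \<alpha> \<Upsilon> s = i}" using word[of "(i, c)"] img c(1) by auto
  qed
qed

lemma RSCT_row_inj:
  assumes "\<Upsilon> \<in> RSCT \<alpha>" "i \<in> {1..length \<alpha>}"
  shows "inj_on (\<lambda>c. \<Upsilon> (i, c)) {1..\<alpha> ! (i - 1)}"
proof -
  have "inj_on \<Upsilon> (diagram \<alpha>)" using assms by (simp add: RSCT_def bij_betw_def)
  then show ?thesis using assms(2) by (auto simp: inj_on_def diagram_def)
qed

lemma filling_word_has_content:
  assumes \<Upsilon>: "\<Upsilon> \<in> RSCT \<alpha>"
  shows "has_content \<alpha> (filling_word \<alpha> \<Upsilon>)"
  unfolding has_content_def
proof (intro conjI ballI)
  fix s assume "s \<in> {1..sum_list \<alpha>}"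
  then have "s \<in> \<Upsilon> ` diagram \<alpha>" using \<Upsilon> by (simp add: RSCT_def bij_betw_def)
  then have "inv_into (diagram \<alpha>) \<Upsilon> s \<in> diagram \<alpha>" by (rule inv_into_into)
  then show "filling_word \<alpha> \<Upsilon> s \<in> {1..length \<alpha>}" by (auto simp: filling_word_def diagram_def)
next
  fix i assume i: "i \<in> {1..length \<alpha>}"
  show "card {s \<in> {1..sum_list \<alpha>}. filling_word \<alpha> \<Upsilon> s = i} = \<alpha> ! (i - 1)"
    unfolding RSCT_row_set[OF \<Upsilon> i] card_image[OF RSCT_row_inj[OF \<Upsilon> i]] by simp
qed

text \<open>A row is the decreasing enumeration of its set of entries: \<open>\<Upsilon>(i, c)\<close> is the entry of row \<open>i\<close> that has exactly
  \<open>c\<close> entries of the row greater than or equal to it.\<close>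

lemma RSCT_eqI:
  assumes \<Upsilon>: "\<Upsilon> \<in> RSCT \<alpha>" and \<Psi>: "\<Psi> \<in> RSCT \<alpha>"
    and eq: "\<And>s. s \<in> {1..sum_list \<alpha>} \<Longrightarrow> filling_word \<alpha> \<Upsilon> s = filling_word \<alpha> \<Psi> s"
  shows "\<Upsilon> = \<Psi>"
proof (rule extensionalityI)
  show "\<Upsilon> \<in> extensional (diagram \<alpha>)" "\<Psi> \<in> extensional (diagram \<alpha>)" using \<Upsilon> \<Psi> by (simp_all add: RSCT_def)
  fix x assume x: "x \<in> diagram \<alpha>"
  obtain i c where ic: "x = (i, c)" by (cases x)
  have i: "i \<in> {1..length \<alpha>}" and c: "c \<in> {1..\<alpha> ! (i - 1)}" using x ic by (auto simp: diagram_def)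
  let ?R = "{s \<in> {1..sum_list \<alpha>}. filling_word \<alpha> \<Upsilon> s = i}"
  have rank: "card {s \<in> ?R. F (i, c) \<le> s} = c" and mem: "F (i, c) \<in> ?R" 
    if F: "F \<in> RSCT \<alpha>" and R: "?R = {s \<in> {1..sum_list \<alpha>}. filling_word \<alpha> F s = i}" for F
  proof -
    have dec: "F (i, c') < F (i, c'')" if "c'' \<in> {1..\<alpha> ! (i - 1)}" "c' \<in> {1..\<alpha> ! (i - 1)}" "c'' < c'" for c' c''
      using F that i by (auto simp: RSCT_def diagram_def)
    have row: "?R = (\<lambda>c. F (i, c)) ` {1..\<alpha> ! (i - 1)}" unfolding R by (rule RSCT_row_set[OF F i])
    then show "F (i, c) \<in> ?R" using c by blast
    \<comment> \<open>the position of an entry in its row is its rank from above within the row\<close>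
    have "{s \<in> ?R. F (i, c) \<le> s} = (\<lambda>c. F (i, c)) ` {1..c}"
    proof (intro equalityI subsetI)
      fix s assume s: "s \<in> {s \<in> ?R. F (i, c) \<le> s}"
      then have "s \<in> (\<lambda>c. F (i, c)) ` {1..\<alpha> ! (i - 1)}" using row by blast
      then obtain c' where c': "c' \<in> {1..\<alpha> ! (i - 1)}" "s = F (i, c')" by blast
      then have "c' \<le> c" using s dec[OF c c'(1)] by (cases "c < c'") auto
      then have "c' \<in> {1..c}" using c'(1) by simp
      then show "s \<in> (\<lambda>c. F (i, c)) ` {1..c}" unfolding c'(2) by (rule imageI)
    next
      fix s assume "s \<in> (\<lambda>c. F (i, c)) ` {1..c}"
      then obtain c' where c': "c' \<in> {1..c}" "s = F (i, c')" by blast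
      then have "c' \<in> {1..\<alpha> ! (i - 1)}" using c by auto
      moreover have "F (i, c) \<le> s" using dec[OF \<open>c' \<in> {1..\<alpha> ! (i - 1)}\<close> c] c' by (cases "c' = c") auto
      ultimately show "s \<in> {s \<in> ?R. F (i, c) \<le> s}" using row c'(2) by blast
    qed
    moreover have "inj_on (\<lambda>c. F (i, c)) {1..c}"
      using RSCT_row_inj[OF F i] c by (auto intro: inj_on_subset)
    ultimately show "card {s \<in> ?R. F (i, c) \<le> s} = c" by (simp add: card_image)
  qed
  have R: "?R = {s \<in> {1..sum_list \<alpha>}. filling_word \<alpha> \<Psi> s = i}" using eq by auto
  have not_less: "\<not> a < b" if "a \<in> X" "finite X" "card {s \<in> X. a \<le> s} = card {s \<in> X. b \<le> s}"
    for a b and X :: "nat set"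
  proof
    assume "a < b"
    then have "{s \<in> X. b \<le> s} \<subseteq> {s \<in> X. a \<le> s}" by auto
    moreover have "a \<in> {s \<in> X. a \<le> s}" "a \<notin> {s \<in> X. b \<le> s}" using that(1) \<open>a < b\<close> by simp_all
    ultimately have "{s \<in> X. b \<le> s} \<subset> {s \<in> X. a \<le> s}" by blast
    then have "card {s \<in> X. b \<le> s} < card {s \<in> X. a \<le> s}" using that(2) by (intro psubset_card_mono) auto
    then show False using that(3) by simp
  qed
  have fin: "finite ?R" by simp
  have "card {s \<in> ?R. \<Upsilon> (i, c) \<le> s} = card {s \<in> ?R. \<Psi> (i, c) \<le> s}"
    unfolding rank[OF \<Upsilon> refl] rank[OF \<Psi> R] ..
  note not_less[OF mem[OF \<Upsilon> refl] fin this] not_less[OF mem[OF \<Psi> R] fin this[symmetric]]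
  then show "\<Upsilon> x = \<Psi> x" using ic by simp
qed

text \<open>Pairwise distinct numbers can be translated so that the coordinates of the block vector sum to \<open>0\<close>.\<close>

lemma generic_point_exists: "\<exists>z. inj z \<and> block_vec \<alpha> z \<in> s_space \<alpha>"
proof -
  let ?n = "sum_list \<alpha>"
  define a :: complex where "a = (\<Sum>j = 1..?n. of_nat (block_index \<alpha> j)) / of_nat ?n"
  define z where "z i = of_nat i - a" for i
  have "inj z" by (auto simp: inj_def z_def)
  have "(\<Sum>j = 1..?n. block_vec \<alpha> z j) = (\<Sum>j = 1..?n. of_nat (block_index \<alpha> j) - a)"
    by (intro sum.cong) (simp_all add: block_vec_eq z_def)
  also have "\<dots> = 0" by (cases "?n = 0") (simp_all add: sum_subtractf a_def)
  finally have "block_vec \<alpha> z \<in> t_space ?n" using block_vec_outside by (simp add: t_space_def)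
  then show ?thesis using \<open>inj z\<close> unfolding s_space_def by blast
qed

text \<open>A filling is recorded by the word of its rows, and for distinct \<open>z\<^sub>i\<close> by a point of the orbit.\<close>

lemma card_W_set_le:
  assumes z: "inj z" "block_vec \<alpha> z \<in> s_space \<alpha>"
  shows "finite (W_set \<alpha>)" "card (W_set \<alpha>) \<le> card (orbit \<alpha> z)"
proof -
  let ?n = "sum_list \<alpha>"
  define g where "g \<Upsilon> s = (if s \<in> {1..?n} then z (filling_word \<alpha> \<Upsilon> s) else 0)" for \<Upsilon> s
  have into: "g ` RSCT \<alpha> \<subseteq> orbit \<alpha> z"
  proof (rule image_subsetI)
    fix \<Upsilon> assume "\<Upsilon> \<in> RSCT \<alpha>"
    moreover have "g \<Upsilon> = (\<lambda>s. if s \<in> {1..?n} then z (filling_word \<alpha> \<Upsilon> s) else 0)"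
      by (rule ext) (simp only: g_def)
    ultimately show "g \<Upsilon> \<in> orbit \<alpha> z"
      using word_in_Z_variety[OF z(2) filling_word_has_content] unfolding orbit_def by simp
  qed
  have inj: "inj_on g (RSCT \<alpha>)"
  proof (rule inj_onI)
    fix \<Upsilon> \<Psi> assume \<Upsilon>: "\<Upsilon> \<in> RSCT \<alpha>" and \<Psi>: "\<Psi> \<in> RSCT \<alpha>" and eq: "g \<Upsilon> = g \<Psi>"
    have "filling_word \<alpha> \<Upsilon> s = filling_word \<alpha> \<Psi> s" if "s \<in> {1..?n}" for s
      using fun_cong[OF eq, of s] that z(1) by (simp add: g_def inj_eq)
    then show "\<Upsilon> = \<Psi>" by (rule RSCT_eqI[OF \<Upsilon> \<Psi>])
  qed
  have fin: "finite (RSCT \<alpha>)" using finite_imageD[OF finite_subset[OF into finite_orbit] inj] .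
  have W: "W_set \<alpha> = u_perm \<alpha> ` RSCT \<alpha>" by (auto simp: W_set_def)
  show "finite (W_set \<alpha>)" using fin W by simp
  have "card (W_set \<alpha>) \<le> card (RSCT \<alpha>)" unfolding W by (rule card_image_le[OF fin])
  also have "\<dots> \<le> card (orbit \<alpha> z)" using card_inj_on_le[OF inj into finite_orbit] .
  finally show "card (W_set \<alpha>) \<le> card (orbit \<alpha> z)" .
qed

section \<open>The basis\<close>

lemma pi0_hom:
  assumes "vars p \<subseteq> {1..sum_list \<alpha>}" "vars q \<subseteq> {1..sum_list \<alpha>}"
  shows "pi0 \<alpha> p \<in> carrier (A0 \<alpha>)"
    "pi0 \<alpha> p \<oplus>\<^bsub>A0 \<alpha>\<^esub> pi0 \<alpha> q = pi0 \<alpha> (p + q)"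
    "c \<odot>\<^bsub>A0 \<alpha>\<^esub> pi0 \<alpha> p = pi0 \<alpha> (Const c * p)"
    "pi0 \<alpha> p = pi0 \<alpha> q \<longleftrightarrow> p - q \<in> I0 \<alpha>"
proof -
  interpret I: ideal "I0 \<alpha>" "x_ring \<alpha>" by (rule ideal_I0)
  have C: "p \<in> carrier (x_ring \<alpha>)" "q \<in> carrier (x_ring \<alpha>)" "Const c \<in> carrier (x_ring \<alpha>)"
    using assms by (simp_all add: mpoly_ring_def vars_Const)
  note hom = I.rcos_ring_hom
  show "pi0 \<alpha> p \<in> carrier (A0 \<alpha>)"
    using ring_hom_closed[OF hom C(1)] by (simp add: A0_def Let_def pi0_def)
  show "pi0 \<alpha> p \<oplus>\<^bsub>A0 \<alpha>\<^esub> pi0 \<alpha> q = pi0 \<alpha> (p + q)"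
    using ring_hom_add[OF hom C(1,2)] by (simp add: A0_def Let_def pi0_def mpoly_ring_def)
  show "c \<odot>\<^bsub>A0 \<alpha>\<^esub> pi0 \<alpha> p = pi0 \<alpha> (Const c * p)"
    using ring_hom_mult[OF hom C(3,1)] by (simp add: A0_def Let_def pi0_def mpoly_ring_def)
  have minus: "p \<ominus>\<^bsub>x_ring \<alpha>\<^esub> q = p - q"
  proof -
    have "\<ominus>\<^bsub>x_ring \<alpha>\<^esub> q = - q"
      using C(2) by (intro I.minus_equality) (auto simp: mpoly_ring_def vars_minus)
    then show ?thesis by (simp add: a_minus_def) (simp add: mpoly_ring_def)
  qed
  show "pi0 \<alpha> p = pi0 \<alpha> q \<longleftrightarrow> p - q \<in> I0 \<alpha>"
    unfolding pi0_def using I.quotient_eq_iff_same_a_r_cos[OF ideal_I0 C(1,2)] minus by simp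
qed

lemma pi0_zero: "pi0 \<alpha> 0 = \<zero>\<^bsub>A0 \<alpha>\<^esub>"
proof -
  interpret I: ideal "I0 \<alpha>" "x_ring \<alpha>" by (rule ideal_I0)
  show ?thesis
    using ring_hom_zero[OF I.rcos_ring_hom I.ring_axioms I.quotient_is_ring]
    by (simp add: A0_def Let_def pi0_def mpoly_ring_def)
qed

lemma A0_carrierE:
  assumes "X \<in> carrier (A0 \<alpha>)"
  obtains p where "vars p \<subseteq> {1..sum_list \<alpha>}" "X = pi0 \<alpha> p"
  using assms by (auto simp: A0_def Let_def FactRing_def A_RCOSETS_def' pi0_def mpoly_ring_def)

theorem theorem5p9:
  fixes n :: nat and \<alpha> :: "nat list"
  assumes "strong_composition n \<alpha>"
  shows "vectorspace.basis class_ring (A0 \<alpha>) {pi0 \<alpha> (schubert n w) | w. w \<in> W_set \<alpha>}"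
proof -
  have n: "n = sum_list \<alpha>" using assms by (simp add: strong_composition_def)
  interpret V: vectorspace class_ring "A0 \<alpha>" by (rule vectorspace_A0)
  let ?t = "truncate_vars n"
  have vars_t: "vars (?t p) \<subseteq> {1..sum_list \<alpha>}" for p using vars_truncate_vars n by simp
  note pi0 = pi0_hom[of _ \<alpha>]
  define S where "S = schubert n ` W_set \<alpha>"
  have trunc: "?t b = b" if "b \<in> S" for b
    using that W_set_permutes truncate_vars_schubert n by (auto simp: S_def simp del: One_nat_def)
  have vars_S: "vars b \<subseteq> {1..sum_list \<alpha>}" if "b \<in> S" for b using trunc[OF that] vars_t by metis
  have carr: "pi0 \<alpha> ` B \<subseteq> carrier (A0 \<alpha>)" if "B \<subseteq> S" for B
    using that vars_S pi0(1) by blast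
  have gen: "V.span (pi0 \<alpha> ` S) = carrier (A0 \<alpha>)"
  proof
    show "V.span (pi0 \<alpha> ` S) \<subseteq> carrier (A0 \<alpha>)" by (rule V.span_is_subset2[OF carr]) simp
    interpret G: submodule class_ring "V.span (pi0 \<alpha> ` S)" "A0 \<alpha>"
      by (rule V.span_is_submodule[OF carr]) simp
    have "p \<in> {p. pi0 \<alpha> (?t p) \<in> V.span (pi0 \<alpha> ` S)}" for p
    proof (rule schubert_span_mod_tanisaki_ideal[OF tanisaki_ideal_I0])
      show "{p. truncate_vars (sum_list \<alpha>) p \<in> I0 \<alpha>} \<subseteq> {p. pi0 \<alpha> (?t p) \<in> V.span (pi0 \<alpha> ` S)}"
      proof
        fix p assume "p \<in> {p. truncate_vars (sum_list \<alpha>) p \<in> I0 \<alpha>}"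
        then have "pi0 \<alpha> (?t p) = pi0 \<alpha> 0" using pi0(4)[OF vars_t] n by (simp add: vars_01)
        then show "p \<in> {p. pi0 \<alpha> (?t p) \<in> V.span (pi0 \<alpha> ` S)}" using pi0_zero by simp
      qed
      fix p q assume "p \<in> {p. pi0 \<alpha> (?t p) \<in> V.span (pi0 \<alpha> ` S)}" "q \<in> {p. pi0 \<alpha> (?t p) \<in> V.span (pi0 \<alpha> ` S)}"
      then show "p + q \<in> {p. pi0 \<alpha> (?t p) \<in> V.span (pi0 \<alpha> ` S)}"
        using G.m_closed[of "pi0 \<alpha> (?t p)" "pi0 \<alpha> (?t q)"] pi0(2)[OF vars_t vars_t, of p q]
        by (simp add: truncate_vars_hom)
    next
      fix c p assume "p \<in> {p. pi0 \<alpha> (?t p) \<in> V.span (pi0 \<alpha> ` S)}"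
      then show "Const c * p \<in> {p. pi0 \<alpha> (?t p) \<in> V.span (pi0 \<alpha> ` S)}"
        using G.smult_closed[of c "pi0 \<alpha> (?t p)"] pi0(3)[OF vars_t vars_t]
        by (simp add: truncate_vars_hom)
    next
      fix w assume "w \<in> W_set \<alpha>"
      then have b: "schubert n w \<in> S" by (simp add: S_def)
      then have "pi0 \<alpha> (schubert n w) \<in> V.span (pi0 \<alpha> ` S)" using V.in_own_span[OF carr[of S]] by blast
      then show "schubert (sum_list \<alpha>) w \<in> {p. pi0 \<alpha> (?t p) \<in> V.span (pi0 \<alpha> ` S)}"
        using trunc[OF b] n by simp
    qed
    then show "carrier (A0 \<alpha>) \<subseteq> V.span (pi0 \<alpha> ` S)"
      using truncate_vars_idem n by (metis (no_types, lifting) A0_carrierE mem_Collect_eq subsetI)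
  qed
  obtain z where z: "inj z" "block_vec \<alpha> z \<in> s_space \<alpha>" using generic_point_exists by blast
  note count = card_W_set_le[OF z]
  have finS: "finite S" and cardS: "card S \<le> card (orbit \<alpha> z)"
    using count card_image_le[OF count(1), of "schubert n"] by (simp_all add: S_def)
  have min: "card (orbit \<alpha> z) \<le> card B" if B: "B \<subseteq> S" and span: "V.span (pi0 \<alpha> ` B) = carrier (A0 \<alpha>)" for B
  proof (rule card_orbit_le_card_homogeneous_generators)
    show "finite B" using B finS finite_subset by blast
    show "\<exists>d. homogeneous d b" if "b \<in> B" for b
      using that B schubert_homogeneous W_set_permutes n unfolding S_def by blast
    show "truncate_vars (sum_list \<alpha>) b = b" if "b \<in> B" for b using trunc that B n by blast
    fix U
    assume U: "\<And>p q. p \<in> U \<Longrightarrow> q \<in> U \<Longrightarrow> p + q \<in> U" "\<And>c p. p \<in> U \<Longrightarrow> Const c * p \<in> U"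
      "{p. truncate_vars (sum_list \<alpha>) p \<in> I0 \<alpha>} \<subseteq> U" "B \<subseteq> U"
    let ?N = "pi0 \<alpha> ` {p \<in> U. vars p \<subseteq> {1..sum_list \<alpha>}}"
    have zero: "0 \<in> U" using U(3) I0_closed(1) by (auto simp: truncate_vars_hom)
    have sub: "submodule class_ring ?N (A0 \<alpha>)"
    proof (intro submodule.intro)
      show "module class_ring (A0 \<alpha>)" ..
      show "?N \<subseteq> carrier (A0 \<alpha>)" using pi0(1) by blast
      show "\<zero>\<^bsub>A0 \<alpha>\<^esub> \<in> ?N" using zero by (intro image_eqI[of _ _ 0]) (simp_all add: pi0_zero vars_01)
    next
      fix v w assume "v \<in> ?N" "w \<in> ?N"
      then obtain p q where "v = pi0 \<alpha> p" "w = pi0 \<alpha> q" "p \<in> U" "q \<in> U"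
        "vars p \<subseteq> {1..sum_list \<alpha>}" "vars q \<subseteq> {1..sum_list \<alpha>}" by blast
      then show "v \<oplus>\<^bsub>A0 \<alpha>\<^esub> w \<in> ?N"
        using pi0(2) U(1) vars_add[of p q] by (intro image_eqI[of _ _ "p + q"]) auto
    next
      fix c v assume "v \<in> ?N"
      then obtain p where "v = pi0 \<alpha> p" "p \<in> U" "vars p \<subseteq> {1..sum_list \<alpha>}" by blast
      then show "c \<odot>\<^bsub>A0 \<alpha>\<^esub> v \<in> ?N"
        using pi0(3) U(2) vars_mult[of "Const c" p]
        by (intro image_eqI[of _ _ "Const c * p"]) (auto simp: vars_Const)
    qed
    have "pi0 \<alpha> ` B \<subseteq> ?N" using B U(4) vars_S by blast
    then have N: "carrier (A0 \<alpha>) \<subseteq> ?N" unfolding span[symmetric] by (rule V.span_is_subset[OF _ sub])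
    have "p \<in> U" for p
    proof -
      have "pi0 \<alpha> (?t p) \<in> ?N" using N pi0(1)[OF vars_t vars_t] by blast
      then obtain q where q: "q \<in> U" "vars q \<subseteq> {1..sum_list \<alpha>}" "pi0 \<alpha> (?t p) = pi0 \<alpha> q" by blast
      then have "?t p - q \<in> I0 \<alpha>" using pi0(4)[OF vars_t q(2)] by blast
      moreover have "?t (p - q) = ?t p - q" using truncate_vars_idem q(2) n by (simp add: truncate_vars_hom)
      ultimately have "p - q \<in> U" using U(3) n by auto
      then show ?thesis using U(1)[of "p - q" q] q(1) by simp
    qed
    then show "U = UNIV" by blast
  qed
  have "V.basis (pi0 \<alpha> ` S)"
  proof (rule V.min_gen_is_basis, unfold minimal_def, intro conjI allI impI)
    show "pi0 \<alpha> ` S \<subseteq> carrier (A0 \<alpha>)" by (rule carr) simp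
    show "V.span (pi0 \<alpha> ` S) = carrier (A0 \<alpha>)" by (rule gen)
    fix T assume T: "T \<subseteq> pi0 \<alpha> ` S \<and> T \<subseteq> carrier (A0 \<alpha>) \<and> V.span T = carrier (A0 \<alpha>)"
    then obtain B where B: "B \<subseteq> S" "T = pi0 \<alpha> ` B" by (meson subset_imageE)
    have "card S \<le> card B" using order.trans[OF cardS min[OF B(1)]] T B(2) by blast
    then have "B = S" using card_seteq[OF finS B(1)] by blast
    then show "T = pi0 \<alpha> ` S" using B(2) by simp
  qed
  moreover have "pi0 \<alpha> ` S = {pi0 \<alpha> (schubert n w) | w. w \<in> W_set \<alpha>}" by (auto simp: S_def)
  ultimately show ?thesis by simp
qed

end
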